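(* Let $E$ be a $C^*$-correspondence over a $C^*$-algebra $\mathcal{A}$. Let $(A,\sigma)$ be a fully coisometric representation of $E$ on a finite dimensional Hilbert space $\mathcal{V}$, and let $(S,\rho)$ be the minimal isometric dilation of $(A,\sigma)$ on a Hilbert space $\mathcal{H}\supseteq\mathcal{V}$. Let $\mathfrak{A}$ be the unital algebra generated by $(A,\sigma)$ and let $\mathfrak{S}$ be the unital WOT-closed algebra generated by $(S,\rho)$. Suppose $\hat{\mathcal{V}}=\bigoplus_{j=1}^n\mathcal{V}_j$ is a maximal direct sum of minimal, pairwise orthogonal $\mathfrak{A}^*$-invariant subspaces of $\mathcal{V}$. Then: (1) $\hat{\mathcal{V}}$ is the unique minimal $\mathfrak{A}^*$-invariant subspace of $\mathcal V$ such that $\mathfrak{S}[\hat{\mathcal{V}}]=\mathcal{H}$. (2) $\mathcal{H}=\bigoplus_{j=1}^n\mathcal{H}_j$ (orthogonal direct sum), where $\mathcal{H}_j=\mathfrak{S}[\mathcal{V}_j]$. (3) The representation $(P_{\hat{\mathcal{V}}^\perp}S(\cdot)|_{\hat{\mathcal{V}}^\perp},\rho(\cdot)|_{\hat{\mathcal{V}}^\perp})$ of $E$ on $\hat{\mathcal V}^\perp=\mathcal H\ominus\hat{\mathcal V}$ is an induced representation. (4) $\mathfrak{S}^*|_{\hat{\mathcal{V}}}$ is a $C^*$-algebra.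
   Context: Conventions. All $C^*$-algebras and their representations on Hilbert spaces are unital; subspaces are closed. A $C^*$-correspondence $E$ over $\mathcal A$ is a right Hilbert $C^*$-module over $\mathcal A$ ($\mathcal A$-valued inner product conjugate linear in the first variable) with a left action of $\mathcal A$ given by a $*$-homomorphism $\varphi:\mathcal A\to\mathcal L(E)$ into the adjointable operators. A representation $(A,\sigma)$ of $E$ on a Hilbert space $\mathcal V$ is a completely contractive linear map $A:E\to\mathcal B(\mathcal V)$ and a unital representation $\sigma$ of $\mathcal A$ on $\mathcal V$ with $A(a\xi b)=\sigma(a)A(\xi)\sigma(b)$. $E\otimes_\sigma\mathcal V$ is the Hausdorff completion of the algebraic tensor product with respect to $\langle\xi_1\otimes h_1,\xi_2\otimes h_2\rangle=\langle h_1,\sigma(\langle\xi_1,\xi_2\rangle)h_2\rangle$, and $\tilde A:E\otimes_\sigma\mathcal V\to\mathcal V$ is the contraction $\tilde A(\xi\otimes h)=A(\xi)h$. $(A,\sigma)$ is isometric if $A(\xi)^*A(\eta)=\sigma(\langle\xi,\eta\rangle)$ for all $\xi,\eta$ (equivalently $\tilde A$ is an isometry), and fully coisometric if $\tilde A\tilde A^*=I$. $E^n$ is the $n$-fold interior tensor product of $E$ with itself ($E^0=\mathcal A$), and $\tilde A_n:E^n\otimes_\sigma\mathcal V\to\mathcal V$ is $\tilde A_n(\xi_1\otimes\cdots\otimes\xi_n\otimes h)=A(\xi_1)\cdots A(\xi_n)h$. A representation $(S,\rho)$ on $\mathcal H\supseteq\mathcal V$ is a dilation of $(A,\sigma)$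 if $\mathcal V$ reduces $\rho$ with $\rho(a)|_{\mathcal V}=\sigma(a)$, $\mathcal V^\perp$ is invariant under every $S(\xi)$, and $P_{\mathcal V}S(\xi)|_{\mathcal V}=A(\xi)$. It is an isometric dilation if $(S,\rho)$ is isometric, and minimal if $\mathcal H=\bigvee_{n\ge0}\tilde S_n(E^n\otimes\mathcal V)$. Every representation has a minimal isometric dilation, unique up to a unitary equivalence fixing $\mathcal V$ (Muhly–Solel). The unital WOT-closed algebra generated by $(S,\rho)$ is the closure in the weak operator topology of the algebra generated by $I$, all $S(\xi)$ and all $\rho(a)$. For an operator algebra $\mathfrak S$ and a subspace $\mathcal X$, $\mathfrak S[\mathcal X]$ is the closed linear span of $\{Tx:T\in\mathfrak S,x\in\mathcal X\}$ and $\mathfrak S^*=\{T^*:T\in\mathfrak S\}$. A minimal $\mathfrak A^*$-invariant subspace is a non-zero $\mathfrak A^*$-invariant subspace containing no proper non-zero $\mathfrak A^*$-invariant subspace. Induced representations: the Fock space is $\mathcal F(E)=\bigoplus_{n\ge0}E^n$, with left action $\varphi_\infty$ of $\mathcal A$ on the first tensor factor and creation operators $T_\xi(\xi_1\otimes\cdots\otimes\xi_n)=\xi\otimes\xi_1\otimes\cdots\otimes\xi_n$. For a representation $\pi$ of $\mathcal A$ on $\mathcal W$, the representation of $E$ induced by $\pi$ acts on $\mathcal F(E)\otimes_\pi\mathcal W$ by $\xi\mapsto T_\xi\otimes I$, $a\mapsto\varphi_\infty(a)\otimes I$. A representation is called induced if it is unitarily equivalent to one of this form. *)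

theory Defs
  imports "HOL-Analysis.Analysis" "HOL-Library.FuncSet"
begin

section \<open>Complex vector spaces, Hilbert spaces, unital C*-algebras\<close>

class complex_vector = real_vector +
  fixes scaleC :: "complex \<Rightarrow> 'a \<Rightarrow> 'a"
  assumes scaleC_add_right: "scaleC c (x + y) = scaleC c x + scaleC c y"
    and scaleC_add_left: "scaleC (c + d) x = scaleC c x + scaleC d x"
    and scaleC_scaleC: "scaleC c (scaleC d x) = scaleC (c * d) x"
    and scaleC_of_real: "scaleC (complex_of_real r) x = scaleR r x"

lemma vector_space_scaleC: "vector_space (scaleC :: complex \<Rightarrow> 'a \<Rightarrow> 'a::complex_vector)"
proof
  fix x :: 'a
  show "scaleC 1 x = x" using scaleC_of_real[of 1 x] by simp
qed (simp_all add: scaleC_add_right scaleC_add_left scaleC_scaleC)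

global_interpretation complex_vector:
  vector_space "scaleC :: complex \<Rightarrow> 'a \<Rightarrow> 'a::complex_vector"
  defines csubspace = complex_vector.subspace
    and cspan = complex_vector.span
  by (rule vector_space_scaleC)

text \<open>The inner product is conjugate linear in the first variable. The real inner product
  inherited from \<^class>\<open>real_inner\<close> is its real part, so norm and topology are the
  usual ones.\<close>

class complex_hilbert = complex_vector + real_inner + complete_space +
  fixes cinner :: "'a \<Rightarrow> 'a \<Rightarrow> complex"
  assumes cinner_commute: "cinner x y = cnj (cinner y x)"
    and cinner_add_right: "cinner x (y + z) = cinner x y + cinner x z"
    and cinner_scaleC_right: "cinner x (scaleC c y) = c * cinner x y"
    and inner_eq_Re_cinner: "inner x y = Re (cinner x y)"

text \<open>\<^class>\<open>monoid_mult\<close> instead of \<^class>\<open>ring_1\<close> admits the zero algebra; otherwise the norm of the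
  unit is 1 by the C*-identity.\<close>

class cstar_algebra = complex_vector + real_normed_algebra + monoid_mult + complete_space +
  fixes cstar :: "'a \<Rightarrow> 'a"
  assumes scaleC_mult_left: "scaleC c x * y = scaleC c (x * y)"
    and scaleC_mult_right: "x * scaleC c y = scaleC c (x * y)"
    and norm_scaleC: "norm (scaleC c x) = cmod c * norm x"
    and cstar_cstar: "cstar (cstar x) = x"
    and cstar_add: "cstar (x + y) = cstar x + cstar y"
    and cstar_scaleC: "cstar (scaleC c x) = scaleC (cnj c) (cstar x)"
    and cstar_mult: "cstar (x * y) = cstar y * cstar x"
    and norm_cstar_mult: "norm (cstar x * x) = (norm x)\<^sup>2"

section \<open>Subspaces of a Hilbert space and operators on them\<close>

definition closed_csubspace :: "'h::complex_hilbert set \<Rightarrow> bool" where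
  "closed_csubspace M \<longleftrightarrow> csubspace M \<and> closed M"

definition finite_dim :: "'h::complex_vector set \<Rightarrow> bool" where
  "finite_dim M \<longleftrightarrow> (\<exists>B. finite B \<and> M = cspan B)"

definition orthogonal_sets :: "'h::complex_hilbert set \<Rightarrow> 'h set \<Rightarrow> bool" where
  "orthogonal_sets M N \<longleftrightarrow> (\<forall>x\<in>M. \<forall>y\<in>N. cinner x y = 0)"

definition orth_compl :: "'h::complex_hilbert set \<Rightarrow> 'h set" where
  "orth_compl M = {x. \<forall>y\<in>M. cinner y x = 0}"

definition orth_proj :: "'h::complex_hilbert set \<Rightarrow> 'h \<Rightarrow> 'h" where
  "orth_proj M x = (THE y. y \<in> M \<and> x - y \<in> orth_compl M)"

definition is_orth_sum :: "nat \<Rightarrow> (nat \<Rightarrow> 'h::complex_hilbert set) \<Rightarrow> 'h set \<Rightarrow> bool" where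
  "is_orth_sum n M X \<longleftrightarrow>
     (\<forall>i\<in>{1..n}. \<forall>j\<in>{1..n}. i \<noteq> j \<longrightarrow> orthogonal_sets (M i) (M j)) \<and>
     X = {\<Sum>j=1..n. v j |v. \<forall>j\<in>{1..n}. v j \<in> M j}"

text \<open>The bounded operators on a closed subspace \<open>V\<close> are functions which are \<open>undefined\<close>
  outside \<open>V\<close>, so that equality of functions is equality of operators on \<open>V\<close>; products are
  formed with \<^const>\<open>compose\<close>. For \<open>V = UNIV\<close> there is no side condition.\<close>

definition bounded_ops :: "'h::complex_hilbert set \<Rightarrow> ('h \<Rightarrow> 'h) set" where
  "bounded_ops V = {T \<in> V \<rightarrow>\<^sub>E V.
     (\<forall>x\<in>V. \<forall>y\<in>V. T (x + y) = T x + T y) \<and>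
     (\<forall>c. \<forall>x\<in>V. T (scaleC c x) = scaleC c (T x)) \<and>
     (\<exists>K. \<forall>x\<in>V. norm (T x) \<le> K * norm x)}"

definition op_id :: "'h set \<Rightarrow> 'h \<Rightarrow> 'h" where
  "op_id V = (\<lambda>x\<in>V. x)"

definition op_add :: "'h::complex_hilbert set \<Rightarrow> ('h \<Rightarrow> 'h) \<Rightarrow> ('h \<Rightarrow> 'h) \<Rightarrow> 'h \<Rightarrow> 'h" where
  "op_add V S T = (\<lambda>x\<in>V. S x + T x)"

definition op_scale :: "'h::complex_hilbert set \<Rightarrow> complex \<Rightarrow> ('h \<Rightarrow> 'h) \<Rightarrow> 'h \<Rightarrow> 'h" where
  "op_scale V c T = (\<lambda>x\<in>V. scaleC c (T x))"

definition adjoint_on :: "'h::complex_hilbert set \<Rightarrow> ('h \<Rightarrow> 'h) \<Rightarrow> 'h \<Rightarrow> 'h" where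
  "adjoint_on V T =
     (THE R. R \<in> bounded_ops V \<and> (\<forall>x\<in>V. \<forall>y\<in>V. cinner (T x) y = cinner x (R y)))"

inductive_set generated_algebra ::
  "'h::complex_hilbert set \<Rightarrow> ('h \<Rightarrow> 'h) set \<Rightarrow> ('h \<Rightarrow> 'h) set"
  for V :: "'h set" and G :: "('h \<Rightarrow> 'h) set" where
  ident: "op_id V \<in> generated_algebra V G"
| gen: "T \<in> G \<Longrightarrow> T \<in> generated_algebra V G"
| add: "S \<in> generated_algebra V G \<Longrightarrow> T \<in> generated_algebra V G
    \<Longrightarrow> op_add V S T \<in> generated_algebra V G"
| scale: "T \<in> generated_algebra V G \<Longrightarrow> op_scale V c T \<in> generated_algebra V G"
| mult: "S \<in> generated_algebra V G \<Longrightarrow> T \<in> generated_algebra V G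
    \<Longrightarrow> compose V S T \<in> generated_algebra V G"

definition weak_op_topology :: "'h::complex_hilbert set \<Rightarrow> ('h \<Rightarrow> 'h) topology" where
  "weak_op_topology V = topology_generated_by
     {{T \<in> bounded_ops V. cinner x (T y) \<in> U} |x y U. x \<in> V \<and> y \<in> V \<and> open U}"

definition star_set :: "'h::complex_hilbert set \<Rightarrow> ('h \<Rightarrow> 'h) set \<Rightarrow> ('h \<Rightarrow> 'h) set" where
  "star_set V \<AA> = adjoint_on V ` \<AA>"

definition invariant :: "('h \<Rightarrow> 'h) set \<Rightarrow> 'h set \<Rightarrow> bool" where
  "invariant \<AA> M \<longleftrightarrow> (\<forall>T\<in>\<AA>. T ` M \<subseteq> M)"

definition minimal_invariant ::
  "'h::complex_hilbert set \<Rightarrow> ('h \<Rightarrow> 'h) set \<Rightarrow> 'h set \<Rightarrow> bool" where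
  "minimal_invariant V \<AA> M \<longleftrightarrow>
     closed_csubspace M \<and> M \<subseteq> V \<and> M \<noteq> {0} \<and> invariant \<AA> M \<and>
     (\<forall>N. closed_csubspace N \<and> N \<subseteq> M \<and> N \<noteq> {0} \<and> invariant \<AA> N \<longrightarrow> N = M)"

definition closed_image_span ::
  "('h::complex_hilbert \<Rightarrow> 'h) set \<Rightarrow> 'h set \<Rightarrow> 'h set" where
  "closed_image_span \<SS> X = closure (cspan {T x |T x. T \<in> \<SS> \<and> x \<in> X})"

text \<open>A (unital) C*-algebra of operators on \<open>V\<close>: a norm closed unital self-adjoint algebra.\<close>

definition cstar_algebra_on :: "'h::complex_hilbert set \<Rightarrow> ('h \<Rightarrow> 'h) set \<Rightarrow> bool" where
  "cstar_algebra_on V \<CC> \<longleftrightarrow>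
     \<CC> \<subseteq> bounded_ops V \<and> op_id V \<in> \<CC> \<and>
     (\<forall>S\<in>\<CC>. \<forall>T\<in>\<CC>. op_add V S T \<in> \<CC> \<and> compose V S T \<in> \<CC>) \<and>
     (\<forall>c. \<forall>T\<in>\<CC>. op_scale V c T \<in> \<CC>) \<and>
     (\<forall>T\<in>\<CC>. adjoint_on V T \<in> \<CC>) \<and>
     (\<forall>T\<in>bounded_ops V.
        (\<forall>e>0. \<exists>S\<in>\<CC>. \<forall>x\<in>V. norm (T x - S x) \<le> e * norm x) \<longrightarrow> T \<in> \<CC>)"

section \<open>C*-correspondences and their representations\<close>

text \<open>\<open>ip\<close> is the inner product, \<open>ract\<close> and \<open>lact\<close> are the right and left actions.
  Positivity of \<open>ip x x\<close> is expressed by \<open>ip x x = b\<^sup>* b\<close>. The identity for \<open>lact a\<close> against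
  \<open>lact (cstar a)\<close> says that \<open>lact a\<close> is adjointable (hence linear and bounded) and that
  \<open>lact\<close> preserves adjoints. It is not assumed that \<open>lact 1\<close> is the identity.\<close>

definition cstar_correspondence ::
  "('a::cstar_algebra \<Rightarrow> 'e::{complex_vector,banach} \<Rightarrow> 'e) \<Rightarrow> ('e \<Rightarrow> 'a \<Rightarrow> 'e) \<Rightarrow>
   ('e \<Rightarrow> 'e \<Rightarrow> 'a) \<Rightarrow> bool" where
  "cstar_correspondence lact ract ip \<longleftrightarrow>
     (\<forall>x y a. ract (x + y) a = ract x a + ract y a) \<and>
     (\<forall>x a b. ract x (a + b) = ract x a + ract x b) \<and>
     (\<forall>x a b. ract x (a * b) = ract (ract x a) b) \<and>
     (\<forall>x. ract x 1 = x) \<and>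
     (\<forall>c x a. ract (scaleC c x) a = scaleC c (ract x a)) \<and>
     (\<forall>c x a. ract x (scaleC c a) = scaleC c (ract x a)) \<and>
     (\<forall>x y z. ip x (y + z) = ip x y + ip x z) \<and>
     (\<forall>c x y. ip x (scaleC c y) = scaleC c (ip x y)) \<and>
     (\<forall>x y a. ip x (ract y a) = ip x y * a) \<and>
     (\<forall>x y. cstar (ip x y) = ip y x) \<and>
     (\<forall>x. \<exists>b. ip x x = cstar b * b) \<and>
     (\<forall>x. norm x = sqrt (norm (ip x x))) \<and>
     (\<forall>a x y. ip (lact a x) y = ip x (lact (cstar a) y)) \<and>
     (\<forall>a b x. lact (a + b) x = lact a x + lact b x) \<and>
     (\<forall>c a x. lact (scaleC c a) x = scaleC c (lact a x)) \<and>
     (\<forall>a b x. lact (a * b) x = lact a (lact b x))"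

definition unital_star_rep ::
  "'h::complex_hilbert set \<Rightarrow> ('a::cstar_algebra \<Rightarrow> 'h \<Rightarrow> 'h) \<Rightarrow> bool" where
  "unital_star_rep V \<sigma> \<longleftrightarrow>
     (\<forall>a. \<sigma> a \<in> bounded_ops V) \<and>
     (\<forall>a b. \<sigma> (a + b) = op_add V (\<sigma> a) (\<sigma> b)) \<and>
     (\<forall>c a. \<sigma> (scaleC c a) = op_scale V c (\<sigma> a)) \<and>
     (\<forall>a b. \<sigma> (a * b) = compose V (\<sigma> a) (\<sigma> b)) \<and>
     (\<forall>a. \<sigma> (cstar a) = adjoint_on V (\<sigma> a)) \<and>
     \<sigma> 1 = op_id V"

text \<open>\<open>column_norm n a\<close> is the norm of \<open>(a\<^sub>0, \<dots>, a\<^sub>n\<^sub>-\<^sub>1)\<close> in the Hilbert module \<open>\<A>\<^sup>n\<close>. The operator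
  space structure of \<open>E\<close> is the one coming from the linking algebra: \<open>M\<^sub>n(E)\<close> is normed as a
  space of operators from \<open>\<A>\<^sup>n\<close> to \<open>E\<^sup>n\<close> (here \<open>E\<^sup>n\<close> is the direct sum).\<close>

definition column_norm :: "nat \<Rightarrow> (nat \<Rightarrow> 'a::cstar_algebra) \<Rightarrow> real" where
  "column_norm n a = sqrt (norm (\<Sum>i<n. cstar (a i) * a i))"

definition matrix_norm ::
  "('e::{complex_vector,banach} \<Rightarrow> 'a::cstar_algebra \<Rightarrow> 'e) \<Rightarrow> ('e \<Rightarrow> 'e \<Rightarrow> 'a) \<Rightarrow>
   nat \<Rightarrow> (nat \<Rightarrow> nat \<Rightarrow> 'e) \<Rightarrow> real" where
  "matrix_norm ract ip n \<xi> =
     Sup {sqrt (norm (\<Sum>i<n. ip (\<Sum>j<n. ract (\<xi> i j) (a j)) (\<Sum>j<n. ract (\<xi> i j) (a j))))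
          |a. column_norm n a \<le> 1}"

definition completely_contractive ::
  "('e::{complex_vector,banach} \<Rightarrow> 'a::cstar_algebra \<Rightarrow> 'e) \<Rightarrow> ('e \<Rightarrow> 'e \<Rightarrow> 'a) \<Rightarrow>
   'h::complex_hilbert set \<Rightarrow> ('e \<Rightarrow> 'h \<Rightarrow> 'h) \<Rightarrow> bool" where
  "completely_contractive ract ip V A \<longleftrightarrow>
     (\<forall>n \<xi> h. (\<forall>j<n. h j \<in> V) \<longrightarrow>
        sqrt (\<Sum>i<n. (norm (\<Sum>j<n. A (\<xi> i j) (h j)))\<^sup>2)
          \<le> matrix_norm ract ip n \<xi> * sqrt (\<Sum>j<n. (norm (h j))\<^sup>2))"

definition representation ::
  "('a::cstar_algebra \<Rightarrow> 'e::{complex_vector,banach} \<Rightarrow> 'e) \<Rightarrow> ('e \<Rightarrow> 'a \<Rightarrow> 'e) \<Rightarrow>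
   ('e \<Rightarrow> 'e \<Rightarrow> 'a) \<Rightarrow> 'h::complex_hilbert set \<Rightarrow> ('e \<Rightarrow> 'h \<Rightarrow> 'h) \<Rightarrow> ('a \<Rightarrow> 'h \<Rightarrow> 'h) \<Rightarrow> bool" where
  "representation lact ract ip V A \<sigma> \<longleftrightarrow>
     closed_csubspace V \<and>
     unital_star_rep V \<sigma> \<and>
     (\<forall>\<xi>. A \<xi> \<in> bounded_ops V) \<and>
     (\<forall>\<xi> \<eta>. A (\<xi> + \<eta>) = op_add V (A \<xi>) (A \<eta>)) \<and>
     (\<forall>c \<xi>. A (scaleC c \<xi>) = op_scale V c (A \<xi>)) \<and>
     completely_contractive ract ip V A \<and>
     (\<forall>a \<xi> b. A (lact a (ract \<xi> b)) = compose V (\<sigma> a) (compose V (A \<xi>) (\<sigma> b)))"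

definition isometric_rep ::
  "('e \<Rightarrow> 'e \<Rightarrow> 'a) \<Rightarrow> 'h::complex_hilbert set \<Rightarrow> ('e \<Rightarrow> 'h \<Rightarrow> 'h) \<Rightarrow> ('a \<Rightarrow> 'h \<Rightarrow> 'h) \<Rightarrow> bool" where
  "isometric_rep ip V A \<sigma> \<longleftrightarrow>
     (\<forall>\<xi> \<eta>. compose V (adjoint_on V (A \<xi>)) (A \<eta>) = \<sigma> (ip \<xi> \<eta>))"

section \<open>Interior tensor products with a Hilbert space\<close>

text \<open>Let \<open>X\<close> be a set with an \<open>\<A>\<close>-valued kernel \<open>ip\<close> (the inner product of a right module
  spanned by \<open>X\<close>) and \<open>\<sigma>\<close> a representation of \<open>\<A>\<close> on \<open>W\<close>. A list of pairs \<open>(x, h)\<close> stands for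
  the finite sum of the elementary tensors \<open>x \<otimes> h\<close>. The tensor product is the Hausdorff
  completion of these formal sums: equivalence classes of Cauchy sequences for the seminorm of
  \<open>\<langle>x \<otimes> h, y \<otimes> k\<rangle> = \<langle>h, \<sigma>(\<langle>x, y\<rangle>) k\<rangle>\<close>. The relations of the algebraic tensor product (linearity
  in both variables, \<open>\<A>\<close>-balancedness) hold modulo null vectors of this form, so it is not
  necessary to impose them beforehand.\<close>

type_synonym ('x, 'h) fsum = "('x \<times> 'h) list"
type_synonym ('x, 'h) tens = "(nat \<Rightarrow> ('x, 'h) fsum) set"

definition fsum_inner ::
  "('x \<Rightarrow> 'x \<Rightarrow> 'a) \<Rightarrow> ('a \<Rightarrow> 'h \<Rightarrow> 'h) \<Rightarrow> ('x, 'h::complex_hilbert) fsum \<Rightarrow> ('x, 'h) fsum \<Rightarrow> complex"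
  where "fsum_inner ip \<sigma> u v = (\<Sum>(x, h)\<leftarrow>u. \<Sum>(y, k)\<leftarrow>v. cinner h (\<sigma> (ip x y) k))"

definition fsum_dist ::
  "('x \<Rightarrow> 'x \<Rightarrow> 'a) \<Rightarrow> ('a \<Rightarrow> 'h \<Rightarrow> 'h) \<Rightarrow> ('x, 'h::complex_hilbert) fsum \<Rightarrow> ('x, 'h) fsum \<Rightarrow> real"
  where "fsum_dist ip \<sigma> u v =
    (let d = u @ map (\<lambda>(x, h). (x, - h)) v in sqrt (Re (fsum_inner ip \<sigma> d d)))"

definition tens_Cauchy ::
  "'x set \<Rightarrow> ('x \<Rightarrow> 'x \<Rightarrow> 'a) \<Rightarrow> ('a \<Rightarrow> 'h \<Rightarrow> 'h) \<Rightarrow> 'h::complex_hilbert set \<Rightarrow>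
   (nat \<Rightarrow> ('x, 'h) fsum) set" where
  "tens_Cauchy X ip \<sigma> W = {u. (\<forall>n. set (u n) \<subseteq> X \<times> W) \<and>
     (\<forall>e>0. \<exists>N. \<forall>m\<ge>N. \<forall>n\<ge>N. fsum_dist ip \<sigma> (u m) (u n) < e)}"

definition tens_class ::
  "'x set \<Rightarrow> ('x \<Rightarrow> 'x \<Rightarrow> 'a) \<Rightarrow> ('a \<Rightarrow> 'h \<Rightarrow> 'h) \<Rightarrow> 'h::complex_hilbert set \<Rightarrow>
   (nat \<Rightarrow> ('x, 'h) fsum) \<Rightarrow> ('x, 'h) tens" where
  "tens_class X ip \<sigma> W u =
     {v \<in> tens_Cauchy X ip \<sigma> W. (\<lambda>n. fsum_dist ip \<sigma> (u n) (v n)) \<longlonglongrightarrow> 0}"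

definition tensor_space ::
  "'x set \<Rightarrow> ('x \<Rightarrow> 'x \<Rightarrow> 'a) \<Rightarrow> ('a \<Rightarrow> 'h \<Rightarrow> 'h) \<Rightarrow> 'h::complex_hilbert set \<Rightarrow> ('x, 'h) tens set" where
  "tensor_space X ip \<sigma> W = tens_class X ip \<sigma> W ` tens_Cauchy X ip \<sigma> W"

definition tens_rep :: "('x, 'h) tens \<Rightarrow> nat \<Rightarrow> ('x, 'h) fsum" where
  "tens_rep P = (SOME u. u \<in> P)"

definition tens_inner ::
  "('x \<Rightarrow> 'x \<Rightarrow> 'a) \<Rightarrow> ('a \<Rightarrow> 'h \<Rightarrow> 'h) \<Rightarrow> ('x, 'h::complex_hilbert) tens \<Rightarrow> ('x, 'h) tens \<Rightarrow> complex"
  where "tens_inner ip \<sigma> P Q = lim (\<lambda>n. fsum_inner ip \<sigma> (tens_rep P n) (tens_rep Q n))"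

definition tens_add ::
  "'x set \<Rightarrow> ('x \<Rightarrow> 'x \<Rightarrow> 'a) \<Rightarrow> ('a \<Rightarrow> 'h \<Rightarrow> 'h) \<Rightarrow> 'h::complex_hilbert set \<Rightarrow>
   ('x, 'h) tens \<Rightarrow> ('x, 'h) tens \<Rightarrow> ('x, 'h) tens" where
  "tens_add X ip \<sigma> W P Q = tens_class X ip \<sigma> W (\<lambda>n. tens_rep P n @ tens_rep Q n)"

definition tens_scale ::
  "'x set \<Rightarrow> ('x \<Rightarrow> 'x \<Rightarrow> 'a) \<Rightarrow> ('a \<Rightarrow> 'h \<Rightarrow> 'h) \<Rightarrow> 'h::complex_hilbert set \<Rightarrow>
   complex \<Rightarrow> ('x, 'h) tens \<Rightarrow> ('x, 'h) tens" where
  "tens_scale X ip \<sigma> W c P =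
     tens_class X ip \<sigma> W (\<lambda>n. map (\<lambda>(x, h). (x, scaleC c h)) (tens_rep P n))"

text \<open>The operator \<open>t \<otimes> I\<close>.\<close>

definition tens_left ::
  "'x set \<Rightarrow> ('x \<Rightarrow> 'x \<Rightarrow> 'a) \<Rightarrow> ('a \<Rightarrow> 'h \<Rightarrow> 'h) \<Rightarrow> 'h::complex_hilbert set \<Rightarrow>
   ('x \<Rightarrow> 'x) \<Rightarrow> ('x, 'h) tens \<Rightarrow> ('x, 'h) tens" where
  "tens_left X ip \<sigma> W t P =
     tens_class X ip \<sigma> W (\<lambda>n. map (\<lambda>(x, h). (t x, h)) (tens_rep P n))"

text \<open>The continuous extension of \<open>x \<otimes> h \<mapsto> B x h\<close>.\<close>

definition tens_map :: "('x \<Rightarrow> 'h \<Rightarrow> 'h) \<Rightarrow> ('x, 'h::complex_hilbert) tens \<Rightarrow> 'h" where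
  "tens_map B P = lim (\<lambda>n. \<Sum>(x, h)\<leftarrow>tens_rep P n. B x h)"

text \<open>\<open>tens_map A\<close> is the operator \<open>E \<otimes>\<^sub>\<sigma> V \<rightarrow> V\<close> induced by \<open>A\<close>, and \<open>B\<close> is its adjoint.\<close>

definition fully_coisometric ::
  "('e \<Rightarrow> 'e \<Rightarrow> 'a) \<Rightarrow> 'h::complex_hilbert set \<Rightarrow> ('e \<Rightarrow> 'h \<Rightarrow> 'h) \<Rightarrow> ('a \<Rightarrow> 'h \<Rightarrow> 'h) \<Rightarrow> bool" where
  "fully_coisometric ip V A \<sigma> \<longleftrightarrow>
     (\<exists>B. (\<forall>h\<in>V. B h \<in> tensor_space UNIV ip \<sigma> V) \<and>
          (\<forall>P\<in>tensor_space UNIV ip \<sigma> V. \<forall>h\<in>V.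
             cinner (tens_map A P) h = tens_inner ip \<sigma> P (B h)) \<and>
          (\<forall>h\<in>V. tens_map A (B h) = h))"

section \<open>The Fock space\<close>

text \<open>Elementary tensors of all degrees: \<open>Scal a\<close> is the element \<open>a\<close> of \<open>E\<^sup>0 = \<A>\<close> and
  \<open>Tens \<xi> x\<close> is \<open>\<xi> \<otimes> x\<close> in \<open>E\<^sup>n\<^sup>+\<^sup>1 = E \<otimes> E\<^sup>n\<close>. For \<open>n = 0\<close> this is \<open>E \<otimes> \<A> = E\<close>, that is,
  \<open>Tens \<xi> (Scal a)\<close> stands for \<open>\<xi>a\<close>. \<open>word_inner\<close> is the \<open>\<A>\<close>-valued inner product of the Fock
  space; on \<open>E \<otimes> E\<^sup>n\<close> it is given by \<open>\<langle>\<xi> \<otimes> x, \<eta> \<otimes> y\<rangle> = \<langle>x, \<phi>(\<langle>\<xi>, \<eta>\<rangle>) y\<rangle>\<close>.\<close>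

datatype ('a, 'e) word = Scal 'a | Tens 'e "('a, 'e) word"

fun word_degree :: "('a, 'e) word \<Rightarrow> nat" where
  "word_degree (Scal a) = 0"
| "word_degree (Tens \<xi> x) = Suc (word_degree x)"

fun word_act :: "('a::cstar_algebra \<Rightarrow> 'e \<Rightarrow> 'e) \<Rightarrow> 'a \<Rightarrow> ('a, 'e) word \<Rightarrow> ('a, 'e) word" where
  "word_act lact a (Scal b) = Scal (a * b)"
| "word_act lact a (Tens \<xi> x) = Tens (lact a \<xi>) x"

fun word_inner ::
  "('a::cstar_algebra \<Rightarrow> 'e \<Rightarrow> 'e) \<Rightarrow> ('e \<Rightarrow> 'e \<Rightarrow> 'a) \<Rightarrow> ('a, 'e) word \<Rightarrow> ('a, 'e) word \<Rightarrow> 'a" where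
  "word_inner lact ip (Scal a) (Scal b) = cstar a * b"
| "word_inner lact ip (Tens \<xi> x) (Tens \<eta> y) = word_inner lact ip x (word_act lact (ip \<xi> \<eta>) y)"
| "word_inner lact ip (Scal a) (Tens \<eta> y) = 0"
| "word_inner lact ip (Tens \<xi> x) (Scal b) = 0"

fun word_op :: "('e \<Rightarrow> 'h \<Rightarrow> 'h) \<Rightarrow> ('a \<Rightarrow> 'h \<Rightarrow> 'h) \<Rightarrow> ('a, 'e) word \<Rightarrow> 'h \<Rightarrow> 'h" where
  "word_op S \<rho> (Scal a) h = \<rho> a h"
| "word_op S \<rho> (Tens \<xi> x) h = S \<xi> (word_op S \<rho> x h)"

text \<open>The Hilbert space \<open>\<F>(E) \<otimes>\<^sub>\<pi> W\<close>, the direct sum of all \<open>E\<^sup>n \<otimes>\<^sub>\<pi> W\<close>, is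
  \<open>tensor_space UNIV (word_inner lact ip) \<pi> W\<close>. In the definition of induced representations
  \<open>W\<close> ranges over the closed subspaces of the ambient space only. This is no restriction: since
  \<open>\<pi>\<close> is unital, \<open>w \<mapsto> 1 \<otimes> w\<close> embeds \<open>W\<close> isometrically into \<open>\<F>(E) \<otimes>\<^sub>\<pi> W\<close>, which is to be
  unitarily equivalent to the subspace \<open>X\<close>.\<close>

definition induced_rep ::
  "('a::cstar_algebra \<Rightarrow> 'e::{complex_vector,banach} \<Rightarrow> 'e) \<Rightarrow> ('e \<Rightarrow> 'a \<Rightarrow> 'e) \<Rightarrow>
   ('e \<Rightarrow> 'e \<Rightarrow> 'a) \<Rightarrow> 'h::complex_hilbert set \<Rightarrow> ('e \<Rightarrow> 'h \<Rightarrow> 'h) \<Rightarrow> ('a \<Rightarrow> 'h \<Rightarrow> 'h) \<Rightarrow> bool" where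
  "induced_rep lact ract ip X T \<tau> \<longleftrightarrow>
     representation lact ract ip X T \<tau> \<and>
     (\<exists>(W :: 'h set) \<pi> U. closed_csubspace W \<and> unital_star_rep W \<pi> \<and>
        (let k = word_inner lact ip; F = tensor_space UNIV k \<pi> W in
          bij_betw U F X \<and>
          (\<forall>P\<in>F. \<forall>Q\<in>F. U (tens_add UNIV k \<pi> W P Q) = U P + U Q) \<and>
          (\<forall>c. \<forall>P\<in>F. U (tens_scale UNIV k \<pi> W c P) = scaleC c (U P)) \<and>
          (\<forall>P\<in>F. \<forall>Q\<in>F. cinner (U P) (U Q) = tens_inner k \<pi> P Q) \<and>
          (\<forall>\<xi>. \<forall>P\<in>F. U (tens_left UNIV k \<pi> W (Tens \<xi>) P) = T \<xi> (U P)) \<and>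
          (\<forall>a. \<forall>P\<in>F. U (tens_left UNIV k \<pi> W (word_act lact a) P) = \<tau> a (U P))))"

section \<open>Dilations\<close>

text \<open>The space \<open>\<H>\<close> of the dilation is the whole type; \<open>V\<close> is a closed subspace of it.\<close>

definition is_dilation ::
  "('a::cstar_algebra \<Rightarrow> 'e::{complex_vector,banach} \<Rightarrow> 'e) \<Rightarrow> ('e \<Rightarrow> 'a \<Rightarrow> 'e) \<Rightarrow>
   ('e \<Rightarrow> 'e \<Rightarrow> 'a) \<Rightarrow> 'h::complex_hilbert set \<Rightarrow> ('e \<Rightarrow> 'h \<Rightarrow> 'h) \<Rightarrow> ('a \<Rightarrow> 'h \<Rightarrow> 'h) \<Rightarrow>
   ('e \<Rightarrow> 'h \<Rightarrow> 'h) \<Rightarrow> ('a \<Rightarrow> 'h \<Rightarrow> 'h) \<Rightarrow> bool" where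
  "is_dilation lact ract ip V A \<sigma> S \<rho> \<longleftrightarrow>
     representation lact ract ip UNIV S \<rho> \<and>
     (\<forall>a. \<rho> a ` V \<subseteq> V \<and> \<rho> a ` orth_compl V \<subseteq> orth_compl V) \<and>
     (\<forall>a. \<forall>h\<in>V. \<rho> a h = \<sigma> a h) \<and>
     (\<forall>\<xi>. S \<xi> ` orth_compl V \<subseteq> orth_compl V) \<and>
     (\<forall>\<xi>. \<forall>h\<in>V. orth_proj V (S \<xi> h) = A \<xi> h)"

definition minimal_isometric_dilation ::
  "('a::cstar_algebra \<Rightarrow> 'e::{complex_vector,banach} \<Rightarrow> 'e) \<Rightarrow> ('e \<Rightarrow> 'a \<Rightarrow> 'e) \<Rightarrow>
   ('e \<Rightarrow> 'e \<Rightarrow> 'a) \<Rightarrow> 'h::complex_hilbert set \<Rightarrow> ('e \<Rightarrow> 'h \<Rightarrow> 'h) \<Rightarrow> ('a \<Rightarrow> 'h \<Rightarrow> 'h) \<Rightarrow>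
   ('e \<Rightarrow> 'h \<Rightarrow> 'h) \<Rightarrow> ('a \<Rightarrow> 'h \<Rightarrow> 'h) \<Rightarrow> bool" where
  "minimal_isometric_dilation lact ract ip V A \<sigma> S \<rho> \<longleftrightarrow>
     is_dilation lact ract ip V A \<sigma> S \<rho> \<and>
     isometric_rep ip UNIV S \<rho> \<and>
     closure (cspan (\<Union>n. tens_map (word_op S \<rho>) `
       tensor_space {x. word_degree x = n} (word_inner lact ip) \<rho> V)) = UNIV"

end

theory Submission
  imports Defs
begin

text \<open>
  A subspace \<open>M\<close> is called coinvariant if it reduces \<open>\<rho>\<close> and is invariant under all \<open>S(\<xi>)\<^sup>*\<close>; inside
  \<open>V\<close> these are the subspaces invariant under the adjoint algebra. Full coisometry of \<open>A\<close> gives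
  \<open>M \<subseteq> [S(E)M]\<close> for coinvariant \<open>M \<subseteq> V\<close>, so that \<open>\<SS>[M]\<close> is the closure of the increasing union of
  the spaces \<open>[S(E)\<^sup>n M]\<close>. If a coinvariant \<open>U\<close> satisfies \<open>M \<inter> U = 0\<close>, then the angle between \<open>M\<close> and
  \<open>U\<close> is positive because \<open>M\<close> is finite dimensional, and \<open>[S(E)\<^sup>n M]\<close> has at least the same angle to
  \<open>U\<close>; hence \<open>U\<close> meets \<open>\<SS>[M]\<close> only in \<open>0\<close>. Applied to \<open>U = \<SS>[Vhat]\<^sup>\<bottom>\<close> and to
  \<open>U = V\<^sub>j\<close> this gives (1), and (2) follows.

  For (3), a part of the complement of \<open>Vhat\<close> outside the space generated by the wandering subspace
  would be orthogonal to every \<open>[S(E)\<^sup>n Vhat]\<close>.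

  For (4), the same angle argument shows that a coinvariant subspace of a sum of minimal ones has a
  coinvariant complement. This is applied in \<open>\<H> \<otimes> \<ell>\<^sup>2\<close> to the subspace of all \<open>(T\<^sup>* b\<^sub>i)\<^sub>i\<close>, where
  \<open>(b\<^sub>i)\<close> spans \<open>Vhat\<close>: since it reduces the amplification, the algebra on \<open>Vhat\<close> is self-adjoint.
\<close>

section \<open>Hilbert space geometry\<close>

text \<open>The decisive point of the angle argument is a constant that does not depend on
  \<open>n\<close>. For \<open>z\<close> in \<open>U\<close>, the letters of a word can be moved
  onto \<open>z\<close> without leaving \<open>U\<close>, so the inner product of \<open>z\<close>
  with a vector of \<open>[S(E)^n M]\<close> sees only the image of that vector under
  \<open>I \<otimes> Q\<close>, where \<open>Q\<close> projects onto \<open>U\<close>. Isometry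
  makes \<open>[S(E)^n M]\<close> a copy of \<open>E^n \<otimes> M\<close>, and \<open>Q\<close>
  commutes with \<rho> because \<open>U\<close> reduces it. The norm of \<open>I \<otimes> Q\<close>
  on this space is controlled by the positive operator \<open>P Q P\<close>, with \<open>P\<close>
  the projection onto \<open>M\<close>; its norm is less than 1 and does not involve
  \<open>n\<close>. The estimate therefore survives the passage to the limit along the increasing
  spaces. For (4), a coinvariant complement inside \<open>Vhat\<close> concerns subspaces, not
  single operators. In the amplification the adjoint algebra itself becomes a subspace, the orbit of
  the tuple of the \<open>b_i\<close>, and its complement can be used to test whether a given
  operator belongs to the algebra.\<close>

lemmas csubspaceI = complex_vector.subspaceI
  and csubspace_0 = complex_vector.subspace_0
  and csubspace_add = complex_vector.subspace_add
  and csubspace_scale = complex_vector.subspace_scale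
  and csubspace_diff = complex_vector.subspace_diff

section \<open>Inner product and norm\<close>

lemma cinner_zero_right [simp]: "cinner x 0 = 0"
  using cinner_scaleC_right[of x 0 0] by simp

lemma cinner_zero_left [simp]: "cinner 0 x = 0"
  using cinner_commute[of 0 x] by simp

lemma cinner_add_left: "cinner (x + y) z = cinner x z + cinner y z"
  by (metis cinner_add_right cinner_commute complex_cnj_add)

lemma cinner_scaleC_left: "cinner (scaleC c x) y = cnj c * cinner x y"
  by (metis cinner_scaleC_right cinner_commute complex_cnj_mult)

lemma cinner_minus_right [simp]: "cinner x (- y) = - cinner x y"
  using cinner_add_right[of x y "- y"] by (simp add: eq_neg_iff_add_eq_0 add.commute)

lemma cinner_diff_right: "cinner x (y - z) = cinner x y - cinner x z"
  using cinner_add_right[of x y "- z"] by simp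

lemma cinner_sum_right: "cinner x (\<Sum>i\<in>I. f i) = (\<Sum>i\<in>I. cinner x (f i))"
  by (induction I rule: infinite_finite_induct) (auto simp: cinner_add_right)

lemma cinner_self: "cinner x x = of_real ((norm x)\<^sup>2)"
proof -
  have "Im (cinner x x) = 0"
    using arg_cong[OF cinner_commute[of x x], of Im] by simp
  moreover have "Re (cinner x x) = (norm x)\<^sup>2"
    by (simp add: power2_norm_eq_inner inner_eq_Re_cinner)
  ultimately show ?thesis by (simp add: complex_eq_iff)
qed

lemma cinner_eq_zero_iff [simp]: "cinner x x = 0 \<longleftrightarrow> x = 0"
  by (simp add: cinner_self)

lemma norm_scaleC_hilbert: "norm (scaleC c (x :: 'h::complex_hilbert)) = cmod c * norm x"
proof -
  have "complex_of_real ((norm (scaleC c x))\<^sup>2) = of_real ((cmod c * norm x)\<^sup>2)"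
    unfolding cinner_self[symmetric] cinner_scaleC_left cinner_scaleC_right
    by (simp add: cinner_self power_mult_distrib complex_norm_square del: of_real_power)
  then have "(norm (scaleC c x))\<^sup>2 = (cmod c * norm x)\<^sup>2" by (simp only: of_real_eq_iff)
  then show ?thesis by simp
qed

lemma cmod_cinner_le: "cmod (cinner x y) \<le> norm x * norm y"
proof (cases "cinner x y = 0")
  case False
  let ?c = "cinner x y"
  \<comment> \<open>Multiplying \<open>y\<close> by \<open>cnj ?c\<close> makes the inner product
    real, so the Cauchy-Schwarz inequality of the real inner product suffices.\<close>
  have "(cmod ?c)\<^sup>2 = Re (cinner x (scaleC (cnj ?c) y))"
    unfolding cinner_scaleC_right
    by (metis Re_complex_of_real complex_norm_square mult.commute)
  also have "\<dots> = inner x (scaleC (cnj ?c) y)" by (simp add: inner_eq_Re_cinner)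
  also have "\<dots> \<le> norm x * (cmod ?c * norm y)"
    using norm_cauchy_schwarz[of x "scaleC (cnj ?c) y"] by (simp add: norm_scaleC_hilbert)
  finally show ?thesis using False by (simp add: power2_eq_square mult_ac)
qed simp

lemma bounded_bilinear_cinner: "bounded_bilinear (cinner :: 'h::complex_hilbert \<Rightarrow> _)"
proof
  fix r :: real and a b :: 'h
  show "cinner (r *\<^sub>R a) b = r *\<^sub>R cinner a b"
    unfolding scaleC_of_real[symmetric] by (simp add: cinner_scaleC_left scaleR_conv_of_real)
  show "cinner a (r *\<^sub>R b) = r *\<^sub>R cinner a b"
    unfolding scaleC_of_real[symmetric] by (simp add: cinner_scaleC_right scaleR_conv_of_real)
  show "\<exists>K. \<forall>a b. norm (cinner (a::'h) b) \<le> norm a * norm b * K"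
    by (intro exI[of _ 1]) (simp add: cmod_cinner_le)
qed (simp_all add: cinner_add_left cinner_add_right)

lemmas tendsto_cinner [tendsto_intros] = bounded_bilinear.tendsto[OF bounded_bilinear_cinner]
lemmas continuous_on_cinner [continuous_intros] =
  bounded_bilinear.continuous_on[OF bounded_bilinear_cinner]

lemma bounded_linear_scaleC: "bounded_linear (scaleC c :: 'h \<Rightarrow> 'h::complex_hilbert)"
proof (rule bounded_linear_intro)
  fix r :: real and x :: 'h
  show "scaleC c (r *\<^sub>R x) = r *\<^sub>R scaleC c x"
    unfolding scaleC_of_real[symmetric] by (simp add: scaleC_scaleC mult.commute)
  show "norm (scaleC c x) \<le> norm x * cmod c" by (simp add: norm_scaleC_hilbert)
qed (simp add: scaleC_add_right)

lemmas tendsto_scaleC_right [tendsto_intros] = bounded_linear.tendsto[OF bounded_linear_scaleC]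

lemma norm_add_square_orth:
  "cinner x y = 0 \<Longrightarrow> (norm (x + y))\<^sup>2 = (norm x)\<^sup>2 + (norm y)\<^sup>2"
  by (simp add: power2_norm_eq_inner inner_add_left inner_add_right inner_commute[of y x])
     (simp add: inner_eq_Re_cinner)

section \<open>Closed subspaces and orthogonal complements\<close>

lemma csubspace_closure:
  fixes M :: "'h::complex_hilbert set"
  assumes "csubspace M"
  shows "csubspace (closure M)"
proof (rule csubspaceI)
  show "0 \<in> closure M"
    using csubspace_0[OF assms] closure_subset by blast
  show "x + y \<in> closure M" if xy: "x \<in> closure M" "y \<in> closure M" for x y
  proof -
    obtain f g where "\<forall>n. f n \<in> M" "f \<longlonglongrightarrow> x" "\<forall>n. g n \<in> M" "g \<longlonglongrightarrow> y"
      using xy unfolding closure_sequential by blast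
    then show ?thesis unfolding closure_sequential
      by (intro exI[of _ "\<lambda>n. f n + g n"])
         (auto intro: tendsto_add csubspace_add[OF assms])
  qed
  show "scaleC c x \<in> closure M" if x: "x \<in> closure M" for c x
  proof -
    obtain f where "\<forall>n. f n \<in> M" "f \<longlonglongrightarrow> x"
      using x unfolding closure_sequential by blast
    then show ?thesis unfolding closure_sequential
      by (intro exI[of _ "\<lambda>n. scaleC c (f n)"])
         (auto intro: tendsto_scaleC_right csubspace_scale[OF assms])
  qed
qed

lemma closed_csubspace_closure_cspan: "closed_csubspace (closure (cspan X))"
  by (simp add: closed_csubspace_def csubspace_closure complex_vector.subspace_span)

lemma closure_cspan_minimal:
  "X \<subseteq> M \<Longrightarrow> closed_csubspace M \<Longrightarrow> closure (cspan X) \<subseteq> M"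
  by (simp add: closed_csubspace_def closure_minimal complex_vector.span_minimal)

lemma closure_cspan_base: "x \<in> X \<Longrightarrow> x \<in> closure (cspan X)"
  by (meson closure_subset complex_vector.span_base subsetD)

lemma closed_csubspace_UNIV [simp]: "closed_csubspace UNIV"
  by (simp add: closed_csubspace_def)

lemma closed_csubspace_zero: "closed_csubspace {0}"
  by (simp add: closed_csubspace_def complex_vector.subspace_single_0)

lemma closed_csubspace_Int:
  "closed_csubspace M \<Longrightarrow> closed_csubspace N \<Longrightarrow> closed_csubspace (M \<inter> N)"
  by (auto simp: closed_csubspace_def complex_vector.subspace_inter)

lemma closed_csubspace_orth_compl: "closed_csubspace (orth_compl M)"
  unfolding closed_csubspace_def
proof
  show "csubspace (orth_compl M)"
    by (rule csubspaceI)
       (auto simp: orth_compl_def cinner_add_right cinner_scaleC_right)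
  have eq: "orth_compl M = (\<Inter>y\<in>M. {x. cinner y x = 0})" by (auto simp: orth_compl_def)
  show "closed (orth_compl M)" unfolding eq
    by (intro closed_INT ballI closed_Collect_eq continuous_intros)
qed

lemma orth_compl_closure_cspan: "orth_compl (closure (cspan X)) = orth_compl X"
proof
  show "orth_compl (closure (cspan X)) \<subseteq> orth_compl X"
    by (auto simp: orth_compl_def closure_cspan_base)
  show "orth_compl X \<subseteq> orth_compl (closure (cspan X))"
  proof
    fix x assume "x \<in> orth_compl X"
    then have "X \<subseteq> orth_compl {x}"
      using cinner_commute[of x] by (auto simp: orth_compl_def)
    then have "closure (cspan X) \<subseteq> orth_compl {x}"
      by (rule closure_cspan_minimal) (rule closed_csubspace_orth_compl)
    then show "x \<in> orth_compl (closure (cspan X))"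
      using cinner_commute[of _ x] by (fastforce simp: orth_compl_def)
  qed
qed

lemma orth_compl_UNIV: "orth_compl UNIV = {0}"
  by (auto simp: orth_compl_def) (metis cinner_eq_zero_iff)

lemma orth_compl_memD: "x \<in> M \<Longrightarrow> x \<in> orth_compl M \<Longrightarrow> x = 0"
  by (auto simp: orth_compl_def)

text \<open>Vectors of \<open>M\<close> whose distance to \<open>x\<close> tends to the infimum form
  a Cauchy sequence by the parallelogram law. Their limit is a nearest point, and there the residual
  cannot be shortened in any direction of \<open>M\<close>.\<close>

lemma orth_decomposition_exists:
  fixes x :: "'h::complex_hilbert"
  assumes M: "closed_csubspace M"
  shows "\<exists>y\<in>M. x - y \<in> orth_compl M"
proof -
  have sub: "csubspace M" and cl: "closed M" using M by (auto simp: closed_csubspace_def)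
  define D where "D = (\<lambda>y. (norm (x - y))\<^sup>2) ` M"
  define d where "d = Inf D"
  have "D \<noteq> {}" using csubspace_0[OF sub] by (auto simp: D_def)
  have bdd: "bdd_below D" by (auto simp: D_def intro: bdd_belowI[of _ 0])
  have d_le: "d \<le> (norm (x - y))\<^sup>2" if "y \<in> M" for y
    unfolding d_def using that bdd by (auto simp: D_def intro: cInf_lower)
  have "\<exists>y\<in>M. (norm (x - y))\<^sup>2 < d + inverse (real (Suc n))" for n
  proof -
    have "Inf D < d + inverse (real (Suc n))" by (simp add: d_def)
    then show ?thesis using cInf_lessD[OF \<open>D \<noteq> {}\<close>] by (auto simp: D_def)
  qed
  then obtain y where y: "\<And>n. y n \<in> M"
    and yd: "\<And>n. (norm (x - y n))\<^sup>2 < d + inverse (real (Suc n))" by metis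
  \<comment> \<open>The midpoint of two vectors of \<open>M\<close> is again at squared distance at
    least \<open>d\<close> from \<open>x\<close>; this turns the parallelogram law into a bound on
    the gap.\<close>
  have par: "(norm (y m - y n))\<^sup>2 \<le> 2 * inverse (real (Suc m)) + 2 * inverse (real (Suc n))" for m n
  proof -
    have mid: "(1/2) *\<^sub>R (y m + y n) \<in> M"
      unfolding scaleC_of_real[symmetric]
      by (intro csubspace_scale[OF sub] csubspace_add[OF sub] y)
    have "(norm (y m - y n))\<^sup>2 = 2 * (norm (x - y m))\<^sup>2 + 2 * (norm (x - y n))\<^sup>2
        - 4 * (norm (x - (1/2) *\<^sub>R (y m + y n)))\<^sup>2"
      by (simp add: power2_norm_eq_inner inner_diff_left inner_diff_right inner_add_left
          inner_add_right inner_commute algebra_simps)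
    then show ?thesis using d_le[OF mid] yd[of m] yd[of n] by linarith
  qed
  have "Cauchy y"
  proof (rule metric_CauchyI)
    fix e :: real assume "e > 0"
    then obtain N where N: "inverse (real (Suc N)) < e\<^sup>2 / 4"
      using reals_Archimedean[of "e\<^sup>2 / 4"] by auto
    show "\<exists>N. \<forall>m\<ge>N. \<forall>n\<ge>N. dist (y m) (y n) < e"
    proof (intro exI allI impI)
      fix m n assume "m \<ge> N" "n \<ge> N"
      then have "inverse (real (Suc m)) \<le> inverse (real (Suc N))"
        "inverse (real (Suc n)) \<le> inverse (real (Suc N))" by (auto intro: le_imp_inverse_le)
      then have "(norm (y m - y n))\<^sup>2 < e\<^sup>2" using par[of m n] N by linarith
      then show "dist (y m) (y n) < e"
        using \<open>e > 0\<close> by (simp add: dist_norm power2_less_imp_less)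
    qed
  qed
  then obtain z where z: "y \<longlonglongrightarrow> z" using Cauchy_convergent_iff convergent_def by blast
  have zM: "z \<in> M" using cl y z closed_sequentially by blast
  have zd: "(norm (x - z))\<^sup>2 \<le> d"
  proof -
    have "(\<lambda>n. (norm (x - y n))\<^sup>2) \<longlonglongrightarrow> (norm (x - z))\<^sup>2" by (intro tendsto_intros z)
    moreover have "(\<lambda>n. d + inverse (real (Suc n))) \<longlonglongrightarrow> d + 0"
      by (intro tendsto_intros LIMSEQ_inverse_real_of_nat)
    ultimately have "(norm (x - z))\<^sup>2 \<le> d + 0"
      by (rule LIMSEQ_le) (use yd less_imp_le in blast)
    then show ?thesis by simp
  qed
  have "cinner w (x - z) = 0" if w: "w \<in> M" for w
  proof (cases "w = 0")
    case False
    \<comment> \<open>\<open>scaleC c w\<close> is the projection of \<open>x - z\<close> onto the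
      line of \<open>w\<close>; adding it to \<open>z\<close> would give a point of \<open>M\<close>
      closer to \<open>x\<close> unless \<open>c = 0\<close>.\<close>
    define c where "c = cinner w (x - z) / of_real ((norm w)\<^sup>2)"
    let ?v = "x - z - scaleC c w"
    have "z + scaleC c w \<in> M"
      by (intro csubspace_add[OF sub] csubspace_scale[OF sub] zM w)
    from order.trans[OF zd d_le[OF this]] have "(norm (x - z))\<^sup>2 \<le> (norm ?v)\<^sup>2"
      by (simp only: diff_diff_eq)
    moreover have "cinner w ?v = 0"
      using False by (simp add: c_def cinner_diff_right[of _ "x - z"] cinner_scaleC_right cinner_self)
    then have "(norm (?v + scaleC c w))\<^sup>2 = (norm ?v)\<^sup>2 + (norm (scaleC c w))\<^sup>2"
      by (intro norm_add_square_orth)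
         (metis cinner_commute cinner_scaleC_right complex_cnj_zero mult_zero_right)
    ultimately have "(norm (scaleC c w))\<^sup>2 \<le> 0" by (simp del: power_mono_iff)
    then have "norm (scaleC c w) = 0" by simp
    then have "c = 0" using False by (simp add: norm_scaleC_hilbert)
    then show ?thesis using False by (simp add: c_def)
  qed simp
  then show ?thesis using zM by (auto simp: orth_compl_def)
qed

lemma orth_decomposition_unique:
  assumes "csubspace M" "y \<in> M" "x - y \<in> orth_compl M" "y' \<in> M" "x - y' \<in> orth_compl M"
  shows "y = y'"
proof -
  have "y - y' \<in> M" using assms csubspace_diff by blast
  then have "cinner (y - y') (x - y') - cinner (y - y') (x - y) = 0"
    using assms by (auto simp: orth_compl_def)
  then have "cinner (y - y') (y - y') = 0" unfolding cinner_diff_right[symmetric] by simp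
  then show ?thesis by simp
qed

section \<open>Orthogonal projections\<close>

lemma
  fixes x :: "'h::complex_hilbert"
  assumes "closed_csubspace M"
  shows orth_proj_mem: "orth_proj M x \<in> M"
    and orth_proj_compl: "x - orth_proj M x \<in> orth_compl M"
proof -
  obtain y where y: "y \<in> M" "x - y \<in> orth_compl M"
    using orth_decomposition_exists[OF assms] by blast
  have "orth_proj M x \<in> M \<and> x - orth_proj M x \<in> orth_compl M"
    unfolding orth_proj_def
    by (rule theI[of _ y])
       (use y orth_decomposition_unique assms in \<open>auto simp: closed_csubspace_def\<close>)
  then show "orth_proj M x \<in> M" "x - orth_proj M x \<in> orth_compl M" by auto
qed

lemma orth_proj_eqI:
  assumes "closed_csubspace M" "y \<in> M" "x - y \<in> orth_compl M"
  shows "orth_proj M x = y"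
  using orth_decomposition_unique[of M "orth_proj M x" x y]
    orth_proj_mem orth_proj_compl assms
  by (auto simp: closed_csubspace_def)

lemma orth_proj_id: "closed_csubspace M \<Longrightarrow> x \<in> M \<Longrightarrow> orth_proj M x = x"
  by (rule orth_proj_eqI) (auto simp: orth_compl_def)

lemma orth_compl_csubspace: "csubspace (orth_compl M)"
  using closed_csubspace_orth_compl closed_csubspace_def by blast

lemma orth_proj_add:
  assumes "closed_csubspace M"
  shows "orth_proj M (x + y) = orth_proj M x + orth_proj M y"
proof (rule orth_proj_eqI[OF assms])
  have "(x - orth_proj M x) + (y - orth_proj M y) \<in> orth_compl M"
    by (intro csubspace_add[OF orth_compl_csubspace] orth_proj_compl assms)
  then show "x + y - (orth_proj M x + orth_proj M y) \<in> orth_compl M" by (simp add: algebra_simps)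
qed (use assms orth_proj_mem[OF assms] in \<open>auto simp: closed_csubspace_def csubspace_add\<close>)

lemma orth_proj_scaleC:
  assumes "closed_csubspace M"
  shows "orth_proj M (scaleC c x) = scaleC c (orth_proj M x)"
proof (rule orth_proj_eqI[OF assms])
  have "scaleC c (x - orth_proj M x) \<in> orth_compl M"
    by (intro csubspace_scale[OF orth_compl_csubspace] orth_proj_compl assms)
  then show "scaleC c x - scaleC c (orth_proj M x) \<in> orth_compl M"
    by (simp add: complex_vector.scale_right_diff_distrib)
qed (use assms orth_proj_mem[OF assms] in \<open>auto simp: closed_csubspace_def csubspace_scale\<close>)

lemma cinner_orth_compl: "x \<in> M \<Longrightarrow> y \<in> orth_compl M \<Longrightarrow> cinner x y = 0"
  by (auto simp: orth_compl_def)

lemma cinner_orth_compl': "x \<in> orth_compl M \<Longrightarrow> y \<in> M \<Longrightarrow> cinner x y = 0"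
  using cinner_orth_compl[of y M x] cinner_commute[of x y] by simp

lemma cinner_orth_proj_right:
  assumes "closed_csubspace M" "z \<in> M"
  shows "cinner z (orth_proj M x) = cinner z x"
  using cinner_orth_compl[OF assms(2) orth_proj_compl[OF assms(1), of x]]
  by (simp add: cinner_diff_right)

lemma cinner_orth_proj_left:
  assumes "closed_csubspace M" "z \<in> M"
  shows "cinner (orth_proj M x) z = cinner x z"
  using cinner_orth_proj_right[OF assms, of x] cinner_commute by metis

text \<open>The residual is always orthogonal to the projection, so orthogonality to
  \<open>x\<close> makes it orthogonal to itself. Later proofs of membership in a closed subspace
  reduce to one inner product in this way.\<close>

lemma orth_residual_zero_mem:
  assumes "closed_csubspace M" "cinner (x - orth_proj M x) x = 0"
  shows "x \<in> M"
proof -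
  have "cinner (x - orth_proj M x) (x - orth_proj M x) = 0"
    using assms(2) cinner_orth_compl'[OF orth_proj_compl[OF assms(1)] orth_proj_mem[OF assms(1)], of x x]
    by (simp only: cinner_diff_right) simp
  then have "x - orth_proj M x = 0" by (simp only: cinner_eq_zero_iff)
  then show ?thesis using orth_proj_mem[OF assms(1), of x] by simp
qed

lemma orth_proj_selfadjoint:
  assumes "closed_csubspace M"
  shows "cinner (orth_proj M x) y = cinner x (orth_proj M y)"
  using cinner_orth_proj_left[OF assms orth_proj_mem[OF assms, of y], of x]
    cinner_orth_proj_right[OF assms orth_proj_mem[OF assms, of x], of y] by simp

lemma norm_orth_proj_pythagoras:
  assumes "closed_csubspace M"
  shows "(norm x)\<^sup>2 = (norm (orth_proj M x))\<^sup>2 + (norm (x - orth_proj M x))\<^sup>2"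
  using norm_add_square_orth[OF cinner_orth_compl[OF orth_proj_mem[OF assms] orth_proj_compl[OF assms]], of x x]
  by simp

lemma norm_orth_proj_le: "closed_csubspace M \<Longrightarrow> norm (orth_proj M x) \<le> norm x"
  using norm_orth_proj_pythagoras[of M x] by (simp add: power2_le_imp_le)

lemma norm_orth_proj_eq_imp:
  assumes "closed_csubspace M" "norm (orth_proj M x) = norm x"
  shows "x \<in> M"
  using norm_orth_proj_pythagoras[OF assms(1), of x] orth_proj_mem[OF assms(1), of x] assms(2) by simp

lemma orth_compl_orth_compl: "closed_csubspace M \<Longrightarrow> orth_compl (orth_compl M) = M"
proof
  assume M: "closed_csubspace M"
  show "M \<subseteq> orth_compl (orth_compl M)"
    using cinner_orth_compl' by (fastforce simp: orth_compl_def[of "orth_compl M"])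
  show "orth_compl (orth_compl M) \<subseteq> M"
  proof
    fix x assume "x \<in> orth_compl (orth_compl M)"
    then have "cinner (x - orth_proj M x) x = 0" by (rule cinner_orth_compl[OF orth_proj_compl[OF M]])
    then show "x \<in> M" by (rule orth_residual_zero_mem[OF M])
  qed
qed

lemma orth_compl_eq_zero_imp: "closed_csubspace M \<Longrightarrow> orth_compl M \<subseteq> {0} \<Longrightarrow> M = UNIV"
  by (metis orth_compl_orth_compl orth_compl_UNIV subset_singletonD orth_compl_csubspace
      csubspace_0 empty_iff closed_csubspace_UNIV)

section \<open>Finite dimensional subspaces\<close>

lemma finite_dim_subspace:
  fixes M N :: "'v::complex_vector set"
  assumes "finite_dim M" "csubspace N" "N \<subseteq> M"
  shows "finite_dim N"
proof -
  obtain B where B: "finite B" "M = cspan B" using assms(1) by (auto simp: finite_dim_def)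
  obtain C where C: "C \<subseteq> N" "\<not> complex_vector.dependent C" "N \<subseteq> cspan C"
    using complex_vector.maximal_independent_subset by blast
  have "finite C" using complex_vector.independent_span_bound[OF B(1) C(2)] C B assms(3) by blast
  moreover have "N = cspan C"
    using C assms(2) complex_vector.span_minimal by blast
  ultimately show ?thesis by (auto simp: finite_dim_def)
qed

text \<open>Only the part of \<open>a\<close> orthogonal to \<open>M\<close> matters. If it is
  nonzero and put in place of \<open>a\<close>, the coefficient \<open>k\<close> is a continuous
  function of \<open>x\<close>, and the set becomes a preimage of \<open>M\<close>.\<close>

lemma closed_csubspace_add_line:
  fixes M :: "'h::complex_hilbert set"
  assumes "closed_csubspace M"
  shows "closed_csubspace {x. \<exists>k. x - scaleC k a \<in> M}"
proof -
  have sub: "csubspace M" and cl: "closed M" using assms by (auto simp: closed_csubspace_def)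
  define b where "b = a - orth_proj M a"
  have b: "b \<in> orth_compl M" unfolding b_def by (rule orth_proj_compl[OF assms])
  have eq: "{x. \<exists>k. x - scaleC k a \<in> M} = {x. \<exists>k. x - scaleC k b \<in> M}"
  proof -
    have "x - scaleC k a \<in> M \<longleftrightarrow> x - scaleC k b \<in> M" for x k
    proof -
      have 1: "scaleC k (orth_proj M a) \<in> M"
        by (intro csubspace_scale[OF sub] orth_proj_mem[OF assms])
      have 2: "x - scaleC k b = (x - scaleC k a) + scaleC k (orth_proj M a)"
        by (simp add: b_def complex_vector.scale_right_diff_distrib)
      have 3: "x - scaleC k a = (x - scaleC k b) - scaleC k (orth_proj M a)"
        by (simp add: b_def complex_vector.scale_right_diff_distrib)
      show ?thesis using 1 2 3 sub by (metis csubspace_add csubspace_diff)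
    qed
    then show ?thesis by simp
  qed
  have "csubspace {x + y |x y. x \<in> M \<and> y \<in> cspan {b}}"
    by (rule complex_vector.subspace_sums[OF sub complex_vector.subspace_span])
  moreover have "{x + y |x y. x \<in> M \<and> y \<in> cspan {b}} = {x. \<exists>k. x - scaleC k b \<in> M}"
  proof (intro set_eqI iffI; clarify)
    fix x k assume "x - scaleC k b \<in> M"
    moreover have "x = (x - scaleC k b) + scaleC k b" "scaleC k b \<in> cspan {b}"
      by (auto simp: complex_vector.span_singleton)
    ultimately show "\<exists>m y. x = m + y \<and> m \<in> M \<and> y \<in> cspan {b}" by blast
  next
    fix x m y assume "m \<in> M" "y \<in> cspan {b}"
    then obtain k where "y = scaleC k b" by (auto simp: complex_vector.span_singleton)
    then show "\<exists>k. m + y - scaleC k b \<in> M" using \<open>m \<in> M\<close> by (intro exI[of _ k]) simp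
  qed
  ultimately have "csubspace {x. \<exists>k. x - scaleC k b \<in> M}" by simp
  moreover have "closed {x. \<exists>k. x - scaleC k b \<in> M}"
  proof (cases "b = 0")
    case True
    then show ?thesis using cl by simp
  next
    case False
    have *: "x - scaleC k b \<in> M \<Longrightarrow> k = cinner b x / of_real ((norm b)\<^sup>2)" for x k
    proof -
      assume "x - scaleC k b \<in> M"
      then have "cinner b (x - scaleC k b) = 0" by (rule cinner_orth_compl'[OF b])
      then show ?thesis using False
        by (simp add: cinner_diff_right cinner_scaleC_right cinner_self field_simps)
    qed
    have "{x. \<exists>k. x - scaleC k b \<in> M} = (\<lambda>x. x - scaleC (cinner b x / of_real ((norm b)\<^sup>2)) b) -` M"
      using * by blast
    moreover have "continuous_on UNIV (\<lambda>x. x - scaleC (cinner b x / of_real ((norm b)\<^sup>2)) b)"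
    proof -
      have "bounded_linear (\<lambda>c. scaleC c b)"
      proof (rule bounded_linear_intro)
        fix r :: real and c :: complex
        show "scaleC (r *\<^sub>R c) b = r *\<^sub>R scaleC c b"
          unfolding scaleC_of_real[symmetric] by (simp add: scaleC_scaleC scaleR_conv_of_real)
        show "norm (scaleC c b) \<le> norm c * norm b" by (simp add: norm_scaleC_hilbert)
      qed (simp add: scaleC_add_left)
      moreover have "continuous_on UNIV (\<lambda>x. cinner b x / of_real ((norm b)\<^sup>2))"
        using False
        by (intro continuous_on_divide continuous_on_const
            continuous_on_cinner[OF continuous_on_const continuous_on_id]) simp
      ultimately have "continuous_on UNIV (\<lambda>x. scaleC (cinner b x / of_real ((norm b)\<^sup>2)) b)"
        by (rule bounded_linear.continuous_on)
      then show ?thesis by (rule continuous_on_diff[OF continuous_on_id])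
    qed
    ultimately show ?thesis using cl by (simp only: closed_vimage)
  qed
  ultimately show ?thesis unfolding eq closed_csubspace_def by blast
qed

lemma closed_csubspace_finite_dim: 
  fixes M :: "'h::complex_hilbert set"
  assumes "finite_dim M" 
  shows "closed_csubspace M"
proof -
  have "closed_csubspace (cspan B)" if "finite B" for B :: "'h set"
    using that
  proof induction
    case empty
    then show ?case by (simp add: closed_csubspace_zero)
  next
    case (insert a B)
    then show ?case unfolding complex_vector.span_insert by (intro closed_csubspace_add_line)
  qed
  then show ?thesis using assms by (auto simp: finite_dim_def)
qed

text \<open>This replaces the compactness of the unit sphere of \<open>M\<close>.\<close>

lemma finite_dim_disjoint_gap:
  fixes M U :: "'h::complex_hilbert set"
  assumes "finite_dim M" "closed_csubspace U" "M \<inter> U = {0}"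
  obtains C where "C \<ge> 1" "\<And>m u. m \<in> M \<Longrightarrow> u \<in> U \<Longrightarrow> norm m \<le> C * norm (m - u)"
proof -
  have "\<exists>C\<ge>1. \<forall>m\<in>cspan B. \<forall>u\<in>U. norm m \<le> C * norm (m - u)"
    if "finite B" "closed_csubspace U" "cspan B \<inter> U = {0}" for B U :: "'h set"
    using that
  proof (induction B arbitrary: U)
    case empty
    then show ?case by (intro exI[of _ 1]) auto
  next
    case (insert a B)
    have subU: "csubspace U" using insert.prems by (simp add: closed_csubspace_def)
    show ?case
    proof (cases "a \<in> cspan B")
      case True
      then have "cspan (insert a B) = cspan B" by (rule complex_vector.span_redundant)
      then show ?thesis using insert by auto
    next
      case False
      have "cspan B \<subseteq> cspan (insert a B)" by (intro complex_vector.span_mono) auto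
      then have disj: "cspan B \<inter> U = {0}" 
        using insert.prems(2) complex_vector.span_zero[of B] csubspace_0[OF subU]
        by (intro equalityI) auto
      \<comment> \<open>The new spanning vector is moved from the finite dimensional side into the
        closed subspace, which is why the induction keeps \<open>U\<close> arbitrary.\<close>
      define U' where "U' = {x. \<exists>k. x - scaleC k a \<in> U}"
      have U': "closed_csubspace U'" unfolding U'_def using insert.prems(1) by (rule closed_csubspace_add_line)
      then have subU': "csubspace U'" by (simp add: closed_csubspace_def)
      have "cspan B \<inter> U' = {0}"
      proof -
        have "m = 0" if m: "m \<in> cspan B" "m - scaleC k a \<in> U" for m k
        proof -
          have "m \<in> cspan (insert a B)" using m(1) \<open>cspan B \<subseteq> _\<close> by blast
          then have "m - scaleC k a \<in> cspan (insert a B)"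
            by (intro complex_vector.span_diff complex_vector.span_scale)
               (auto intro: complex_vector.span_base)
          then have "m - scaleC k a = 0" using m(2) insert.prems(2) by blast
          then have ma: "m = scaleC k a" by simp
          show ?thesis
          proof (cases "k = 0")
            case True then show ?thesis using ma by simp
          next
            case False
            then have "a = scaleC (inverse k) m" using ma by (simp add: scaleC_scaleC)
            then have "a \<in> cspan B" using m(1) by (simp add: complex_vector.span_scale)
            then show ?thesis using \<open>a \<notin> cspan B\<close> by simp
          qed
        qed
        moreover have "0 \<in> U'" using csubspace_0[OF subU'] .
        ultimately show ?thesis using complex_vector.span_zero by (auto simp: U'_def)
      qed
      from insert.IH[OF U' this] obtain C' where "C' \<ge> 1"
        and "\<forall>m\<in>cspan B. \<forall>u\<in>U'. norm m \<le> C' * norm (m - u)" by (elim exE conjE)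
      then have C': "C' \<ge> 1"
        "\<And>m u. m \<in> cspan B \<Longrightarrow> u \<in> U' \<Longrightarrow> norm m \<le> C' * norm (m - u)" by auto
      have aU: "a \<notin> U"
      proof
        assume "a \<in> U"
        then have "a = 0" using insert.prems(2) complex_vector.span_base[of a "insert a B"] by blast
        then show False using False complex_vector.span_zero[of B] by simp
      qed
      define b where "b = a - orth_proj U a"
      have bU: "b \<in> orth_compl U" unfolding b_def by (rule orth_proj_compl[OF insert.prems(1)])
      have "b \<noteq> 0" using aU orth_proj_mem[OF insert.prems(1), of a] unfolding b_def
        by (metis eq_iff_diff_eq_0)
      \<comment> \<open>The distance of \<open>scaleC k a\<close> from \<open>U\<close> is at least
        \<open>cmod k * norm b\<close>, since \<open>b\<close> is the part of \<open>a\<close>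
        orthogonal to \<open>U\<close>. The summand 1 ensures \<open>K \<ge> 1\<close>.\<close>
      define K where "K = 1 + norm a / norm b"
      have K: "norm (scaleC k a) \<le> K * norm (scaleC k a - u)" if "u \<in> U" for k u
      proof -
        have "cinner b (scaleC k a - u) = k * of_real ((norm b)\<^sup>2)"
        proof -
          have "cinner b a = of_real ((norm b)\<^sup>2)"
            using cinner_orth_compl'[OF bU orth_proj_mem[OF insert.prems(1), of a]]
              cinner_self[of b] by (simp add: b_def cinner_diff_right)
          then show ?thesis using cinner_orth_compl'[OF bU that]
            by (simp add: cinner_diff_right cinner_scaleC_right)
        qed
        then have "cmod k * (norm b)\<^sup>2 \<le> norm b * norm (scaleC k a - u)"
          using cmod_cinner_le[of b "scaleC k a - u"] by (simp add: norm_mult norm_power)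
        then have "cmod k * norm b \<le> norm (scaleC k a - u)"
          using \<open>b \<noteq> 0\<close> by (simp add: power2_eq_square mult.assoc mult.left_commute)
        then have "cmod k * norm a \<le> norm a / norm b * norm (scaleC k a - u)"
          using \<open>b \<noteq> 0\<close> mult_left_mono[of "cmod k * norm b" "norm (scaleC k a - u)" "norm a / norm b"]
          by (simp add: field_simps)
        also have "\<dots> \<le> K * norm (scaleC k a - u)" unfolding K_def by (intro mult_right_mono) auto
        finally show ?thesis by (simp add: norm_scaleC_hilbert)
      qed
      have "K \<ge> 1" by (simp add: K_def)
      \<comment> \<open>The induction hypothesis, with \<open>u\<close> shifted by
        \<open>scaleC k a\<close>, bounds \<open>?m\<close> with the factor \<open>C'\<close>. The
        triangle inequality then leads from \<open>m - u\<close> to \<open>scaleC k a - u\<close>,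
        at the cost of the factor \<open>1 + C'\<close>.\<close>
      have "norm m \<le> (C' + K * (1 + C')) * norm (m - u)"
        if m: "m \<in> cspan (insert a B)" and u: "u \<in> U" for m u
      proof -
        obtain k where k: "m - scaleC k a \<in> cspan B"
          using m by (auto simp: complex_vector.span_insert)
        let ?m = "m - scaleC k a"
        have "u - scaleC k a \<in> U'"
          using u unfolding U'_def by (auto intro!: exI[of _ "- k"])
        from C'(2)[OF k this] have 1: "norm ?m \<le> C' * norm (m - u)" by simp
        have "norm (scaleC k a) \<le> K * norm (scaleC k a - u)" using K[OF u] .
        also have "norm (scaleC k a - u) \<le> norm (m - u) + norm ?m"
          using norm_triangle_ineq4[of "m - u" ?m] by simp
        also have "\<dots> \<le> (1 + C') * norm (m - u)" using 1 by (simp add: algebra_simps)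
        finally have 2: "norm (scaleC k a) \<le> K * ((1 + C') * norm (m - u))"
          using \<open>K \<ge> 1\<close> by simp
        have "norm m \<le> norm ?m + norm (scaleC k a)" using norm_triangle_ineq[of ?m "scaleC k a"] by simp
        then show ?thesis using 1 2 by (simp add: algebra_simps)
      qed
      moreover have "1 \<le> C' + K * (1 + C')"
        using C'(1) mult_nonneg_nonneg[of K "1 + C'"] \<open>K \<ge> 1\<close> by linarith
      ultimately show ?thesis by blast
    qed
  qed
  moreover obtain B where "finite B" "M = cspan B" using assms(1) by (auto simp: finite_dim_def)
  ultimately obtain C where "C \<ge> 1" "\<forall>m\<in>M. \<forall>u\<in>U. norm m \<le> C * norm (m - u)"
    using assms(2,3) by (metis (no_types, lifting))
  then show ?thesis using that by auto
qed

section \<open>Bounded operators and the weak operator topology\<close>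

lemma bounded_ops_UNIV_iff:
  "T \<in> bounded_ops UNIV \<longleftrightarrow> (\<forall>x y. T (x + y) = T x + T y) \<and>
     (\<forall>c x. T (scaleC c x) = scaleC c (T x)) \<and> (\<exists>K. \<forall>x. norm (T x) \<le> K * norm x)"
  by (simp add: bounded_ops_def)

lemma
  assumes "T \<in> bounded_ops UNIV"
  shows bop_add: "T (x + y) = T x + T y"
    and bop_scaleC: "T (scaleC c x) = scaleC c (T x)"
    and bop_bounded: "\<exists>K. \<forall>x. norm (T x) \<le> K * norm x"
    and bop_zero: "T 0 = 0"
  using assms complex_vector.scale_zero_left[of "0::'a"]
  by (auto simp: bounded_ops_UNIV_iff) (metis complex_vector.scale_zero_left)

lemma bop_bounded_linear:
  assumes "T \<in> bounded_ops UNIV"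
  shows "bounded_linear T"
proof -
  obtain K where K: "\<And>x. norm (T x) \<le> K * norm x" using bop_bounded[OF assms] by blast
  show ?thesis
  proof (rule bounded_linear_intro)
    show "T (r *\<^sub>R x) = r *\<^sub>R T x" for r x
      unfolding scaleC_of_real[symmetric] by (rule bop_scaleC[OF assms])
    show "norm (T x) \<le> norm x * K" for x using K[of x] by (simp add: mult.commute)
  qed (rule bop_add[OF assms])
qed

lemma bop_diff: "T \<in> bounded_ops UNIV \<Longrightarrow> T (x - y) = T x - T y"
  by (rule linear_diff[OF bounded_linear.linear[OF bop_bounded_linear]])

lemma bop_bounded_pos:
  assumes "T \<in> bounded_ops UNIV"
  obtains K where "K \<ge> 0" "\<And>x. norm (T x) \<le> K * norm x"
  using bounded_linear.nonneg_bounded[OF bop_bounded_linear[OF assms]]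
  by (auto simp: mult.commute)

lemma bop_id [simp]: "(\<lambda>x. x) \<in> bounded_ops UNIV"
  by (auto simp: bounded_ops_UNIV_iff intro: exI[of _ 1])

lemma bop_compose:
  assumes "S \<in> bounded_ops UNIV" "T \<in> bounded_ops UNIV"
  shows "(\<lambda>x. S (T x)) \<in> bounded_ops UNIV"
proof -
  obtain K where K: "K \<ge> 0" "\<And>x. norm (S x) \<le> K * norm x" using bop_bounded_pos[OF assms(1)] by blast
  obtain L where L: "L \<ge> 0" "\<And>x. norm (T x) \<le> L * norm x" using bop_bounded_pos[OF assms(2)] by blast
  have "norm (S (T x)) \<le> (K * L) * norm x" for x
    using order.trans[OF K(2)[of "T x"] mult_left_mono[OF L(2)[of x] K(1)]] by (simp add: mult.assoc)
  then show ?thesis using assms by (auto simp: bounded_ops_UNIV_iff)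
qed

lemma bop_orth_proj: "closed_csubspace M \<Longrightarrow> orth_proj M \<in> bounded_ops UNIV"
  unfolding bounded_ops_UNIV_iff
  by (auto simp: orth_proj_add orth_proj_scaleC norm_orth_proj_le intro!: exI[of _ 1])

lemma bop_restrict:
  assumes "T \<in> bounded_ops UNIV" "csubspace V" "\<And>x. x \<in> V \<Longrightarrow> T x \<in> V"
  shows "restrict T V \<in> bounded_ops V"
  using assms
  by (auto simp: bounded_ops_def csubspace_add csubspace_scale)

lemma closed_csubspace_vimage:
  assumes "T \<in> bounded_ops UNIV" "closed_csubspace N"
  shows "closed_csubspace {x. T x \<in> N}"
proof -
  have "csubspace {x. T x \<in> N}"
    using assms by (intro csubspaceI)
      (auto simp: closed_csubspace_def bop_add bop_scaleC bop_zero csubspace_0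
        csubspace_add csubspace_scale)
  moreover have "closed (T -` N)"
    by (rule closed_vimage)
       (use assms in \<open>auto simp: closed_csubspace_def intro: linear_continuous_on bop_bounded_linear\<close>)
  ultimately show ?thesis by (simp add: closed_csubspace_def vimage_def)
qed

lemma bop_closure_cspan_mem:
  assumes "T \<in> bounded_ops UNIV" "closed_csubspace N" "\<And>x. x \<in> X \<Longrightarrow> T x \<in> N"
    and "y \<in> closure (cspan X)"
  shows "T y \<in> N"
  using closure_cspan_minimal[OF _ closed_csubspace_vimage[OF assms(1,2)], of X] assms(3,4) by blast

text \<open>If the functional is nonzero, its kernel has a nonzero orthogonal vector
  \<open>w\<close>. Every \<open>x\<close> differs from a multiple of \<open>w\<close> by an element
  of the kernel, so the inner product with \<open>w\<close> determines \<open>f x\<close>.\<close>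

lemma riesz_representation:
  fixes f :: "'h::complex_hilbert \<Rightarrow> complex"
  assumes add: "\<And>x y. f (x + y) = f x + f y" and scale: "\<And>c x. f (scaleC c x) = c * f x"
    and bdd: "\<And>x. cmod (f x) \<le> K * norm x"
  shows "\<exists>z. \<forall>x. f x = cinner z x"
proof -
  have "bounded_linear f"
  proof (rule bounded_linear_intro)
    show "f (r *\<^sub>R x) = r *\<^sub>R f x" for r x
      unfolding scaleC_of_real[symmetric] by (simp add: scale scaleR_conv_of_real)
    show "norm (f x) \<le> norm x * K" for x using bdd[of x] by (simp add: mult.commute)
  qed (rule add)
  define N where "N = {x. f x = 0}"
  have f0: "f 0 = 0" using scale[of 0 0] by simp
  have N: "closed_csubspace N"
    unfolding closed_csubspace_def
  proof
    show "csubspace N" by (rule csubspaceI) (auto simp: N_def add scale f0)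
    show "closed N" unfolding N_def
      by (intro closed_Collect_eq continuous_on_const linear_continuous_on \<open>bounded_linear f\<close>)
  qed
  show ?thesis
  proof (cases "orth_compl N \<subseteq> {0}")
    case True
    then have "N = UNIV" by (rule orth_compl_eq_zero_imp[OF N])
    then show ?thesis by (intro exI[of _ 0]) (auto simp: N_def)
  next
    case False
    then obtain w where w: "w \<in> orth_compl N" "w \<noteq> 0" by blast
    have fw: "f w \<noteq> 0"
      using w orth_compl_memD[of w N] by (auto simp: N_def)
    have "f x = cinner (scaleC (cnj (f w) / of_real ((norm w)\<^sup>2)) w) x" for x
    proof -
      have "f (x - scaleC (f x / f w) w) = 0"
        using add[of "x - scaleC (f x / f w) w" "scaleC (f x / f w) w"] fw by (simp add: scale)
      then have "cinner w (x - scaleC (f x / f w) w) = 0"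
        using cinner_orth_compl'[OF w(1)] by (simp add: N_def)
      then show ?thesis using fw w(2)
        by (simp add: cinner_diff_right cinner_scaleC_left cinner_scaleC_right cinner_self field_simps)
    qed
    then show ?thesis by blast
  qed
qed

lemma adjoint_exists:
  assumes T: "T \<in> bounded_ops UNIV"
  shows "\<exists>R\<in>bounded_ops UNIV. \<forall>x y. cinner (T x) y = cinner x (R y)"
proof -
  obtain K where K: "K \<ge> 0" "\<And>x. norm (T x) \<le> K * norm x" using bop_bounded_pos[OF T] by blast
  have "\<exists>z. \<forall>x. cinner y (T x) = cinner z x" for y
  proof (rule riesz_representation)
    show "cmod (cinner y (T x)) \<le> (norm y * K) * norm x" for x
      using order.trans[OF cmod_cinner_le[of y "T x"] mult_left_mono[OF K(2)[of x], of "norm y"]]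
      by (simp add: mult.assoc)
  qed (simp_all add: bop_add[OF T] bop_scaleC[OF T] cinner_add_right cinner_scaleC_right)
  then obtain R where "\<And>y x. cinner y (T x) = cinner (R y) x" by metis
  then have R: "cinner (T x) y = cinner x (R y)" for x y by (metis cinner_commute)
  have eqI: "u = v" if "\<And>x. cinner x u = cinner x v" for u v :: 'a
    using that[of "u - v"] by (metis cinner_diff_right cinner_eq_zero_iff right_minus_eq)
  have "R \<in> bounded_ops UNIV"
    unfolding bounded_ops_UNIV_iff
  proof (intro conjI allI exI)
    show "R (x + y) = R x + R y" for x y
      by (rule eqI) (simp add: R[symmetric] cinner_add_right)
    show "R (scaleC c x) = scaleC c (R x)" for c x
      by (rule eqI) (simp add: R[symmetric] cinner_scaleC_right)
    show "norm (R y) \<le> K * norm y" for y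
    proof (cases "R y = 0")
      case False
      have "(norm (R y))\<^sup>2 = cmod (cinner (R y) (R y))" by (simp add: cinner_self norm_power)
      also have "\<dots> \<le> norm (T (R y)) * norm y" unfolding R[symmetric] by (rule cmod_cinner_le)
      also have "\<dots> \<le> K * norm (R y) * norm y" using K(2)[of "R y"] by (rule mult_right_mono) simp
      finally show ?thesis using False by (simp add: power2_eq_square mult_ac)
    qed (simp add: K(1))
  qed
  then show ?thesis using R by blast
qed

lemma adjoint_on_eqI:
  assumes V: "csubspace V" and R: "R \<in> bounded_ops V"
    and adj: "\<And>x y. x \<in> V \<Longrightarrow> y \<in> V \<Longrightarrow> cinner (T x) y = cinner x (R y)"
  shows "adjoint_on V T = R"
  unfolding adjoint_on_def
proof (rule the_equality)
  show "R \<in> bounded_ops V \<and> (\<forall>x\<in>V. \<forall>y\<in>V. cinner (T x) y = cinner x (R y))" using R adj by blast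
  fix R' assume R': "R' \<in> bounded_ops V \<and> (\<forall>x\<in>V. \<forall>y\<in>V. cinner (T x) y = cinner x (R' y))"
  have "R' y = R y" for y
  proof (cases "y \<in> V")
    case True
    then have "R' y - R y \<in> V"
      using R R' V by (intro csubspace_diff) (auto simp: bounded_ops_def)
    then have "cinner (R' y - R y) (R' y - R y) = 0"
      using adj R' True by (simp add: cinner_diff_right) 
    then show ?thesis by simp
  next
    case False
    then show ?thesis using R R' by (auto simp: bounded_ops_def PiE_def extensional_def)
  qed
  then show "R' = R" by blast
qed

lemma
  assumes "T \<in> bounded_ops UNIV"
  shows bop_adjoint: "adjoint_on UNIV T \<in> bounded_ops UNIV"
    and cinner_adjoint: "cinner (T x) y = cinner x (adjoint_on UNIV T y)"
proof -
  obtain R where R: "R \<in> bounded_ops UNIV" "\<forall>x y. cinner (T x) y = cinner x (R y)"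
    using adjoint_exists[OF assms] by blast
  then have "adjoint_on UNIV T = R" by (intro adjoint_on_eqI) auto
  then show "adjoint_on UNIV T \<in> bounded_ops UNIV" "cinner (T x) y = cinner x (adjoint_on UNIV T y)"
    using R by auto
qed

lemma cinner_adjoint':
  assumes "T \<in> bounded_ops UNIV"
  shows "cinner (adjoint_on UNIV T x) y = cinner x (T y)"
  using cinner_adjoint[OF assms, of y x] cinner_commute by metis

lemma restrict_UNIV [simp]: "restrict f UNIV = f"
  by (simp add: fun_eq_iff)

lemma compose_UNIV [simp]: "compose UNIV S T = (\<lambda>x. S (T x))"
  by (simp add: compose_def)

lemma op_add_UNIV [simp]: "op_add UNIV S T = (\<lambda>x. S x + T x)"
  by (simp add: op_add_def)

lemma op_scale_UNIV [simp]: "op_scale UNIV c T = (\<lambda>x. scaleC c (T x))"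
  by (simp add: op_scale_def)

lemma op_id_UNIV [simp]: "op_id UNIV = (\<lambda>x. x)"
  by (simp add: op_id_def)

lemma bounded_opsI:
  assumes "T \<in> extensional V" "\<And>x. x \<in> V \<Longrightarrow> T x \<in> V"
    and "\<And>x y. x \<in> V \<Longrightarrow> y \<in> V \<Longrightarrow> T (x + y) = T x + T y"
    and "\<And>c x. x \<in> V \<Longrightarrow> T (scaleC c x) = scaleC c (T x)"
    and "\<And>x. x \<in> V \<Longrightarrow> norm (T x) \<le> K * norm x"
  shows "T \<in> bounded_ops V"
  unfolding bounded_ops_def PiE_def Pi_def using assms by blast

lemma
  assumes "T \<in> bounded_ops V" "x \<in> V"
  shows bounded_ops_mem: "T x \<in> V"
    and bounded_ops_add: "y \<in> V \<Longrightarrow> T (x + y) = T x + T y"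
    and bounded_ops_scale: "T (scaleC c x) = scaleC c (T x)"
  using assms by (auto simp: bounded_ops_def)

lemma bounded_ops_bound: "T \<in> bounded_ops V \<Longrightarrow> \<exists>K. \<forall>x\<in>V. norm (T x) \<le> K * norm x"
  by (simp add: bounded_ops_def)

lemma bounded_ops_op_id: "op_id V \<in> bounded_ops V" if "csubspace V"
  unfolding op_id_def
  by (rule bounded_opsI[where K = 1])
     (use that in \<open>auto simp: csubspace_add csubspace_scale\<close>)

lemma bounded_ops_op_add:
  assumes V: "csubspace V" and S: "S \<in> bounded_ops V" and T: "T \<in> bounded_ops V"
  shows "op_add V S T \<in> bounded_ops V"
proof -
  obtain K L where K: "\<And>x. x \<in> V \<Longrightarrow> norm (S x) \<le> K * norm x"
    and L: "\<And>x. x \<in> V \<Longrightarrow> norm (T x) \<le> L * norm x"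
    using bounded_ops_bound S T by metis
  have "norm (S x + T x) \<le> (K + L) * norm x" if "x \<in> V" for x
    using norm_triangle_mono[OF K[OF that] L[OF that]] by (simp add: distrib_right)
  then show ?thesis
    unfolding op_add_def
    by (intro bounded_opsI[where K = "K + L"])
       (use V in \<open>auto simp: csubspace_add csubspace_scale scaleC_add_right
         bounded_ops_mem[OF S] bounded_ops_mem[OF T] bounded_ops_add[OF S] bounded_ops_add[OF T]
         bounded_ops_scale[OF S] bounded_ops_scale[OF T]\<close>)
qed

lemma bounded_ops_op_scale:
  assumes V: "csubspace V" and T: "T \<in> bounded_ops V"
  shows "op_scale V c T \<in> bounded_ops V"
proof -
  obtain L where L: "\<And>x. x \<in> V \<Longrightarrow> norm (T x) \<le> L * norm x"
    using bounded_ops_bound T by metis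
  have "norm (scaleC c (T x)) \<le> (cmod c * L) * norm x" if "x \<in> V" for x
    using mult_left_mono[OF L[OF that], of "cmod c"] by (simp add: norm_scaleC_hilbert mult.assoc)
  then show ?thesis
    unfolding op_scale_def
    by (intro bounded_opsI[where K = "cmod c * L"])
       (use V in \<open>auto simp: csubspace_add csubspace_scale scaleC_add_right
         scaleC_scaleC mult.commute bounded_ops_mem[OF T] bounded_ops_add[OF T] bounded_ops_scale[OF T]\<close>)
qed

lemma bounded_ops_compose:
  assumes V: "csubspace V" and S: "S \<in> bounded_ops V" and T: "T \<in> bounded_ops V"
  shows "compose V S T \<in> bounded_ops V"
proof -
  obtain K L where K: "\<And>x. x \<in> V \<Longrightarrow> norm (S x) \<le> K * norm x"
    and L: "\<And>x. x \<in> V \<Longrightarrow> norm (T x) \<le> L * norm x"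
    using bounded_ops_bound S T by metis
  \<comment> \<open>A bound valid on the zero subspace may be negative, hence the absolute
    value.\<close>
  have "norm (S (T x)) \<le> (\<bar>K\<bar> * L) * norm x" if "x \<in> V" for x
  proof -
    have "norm (S (T x)) \<le> K * norm (T x)" by (rule K[OF bounded_ops_mem[OF T that]])
    also have "\<dots> \<le> \<bar>K\<bar> * norm (T x)" by (rule mult_right_mono) auto
    also have "\<dots> \<le> \<bar>K\<bar> * (L * norm x)" using L[OF that] by (rule mult_left_mono) simp
    finally show ?thesis by (simp add: mult.assoc)
  qed
  then show ?thesis
    unfolding compose_def
    by (intro bounded_opsI[where K = "\<bar>K\<bar> * L"])
       (use V in \<open>auto simp: csubspace_add csubspace_scale
         bounded_ops_mem[OF S] bounded_ops_mem[OF T] bounded_ops_add[OF S] bounded_ops_add[OF T]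
         bounded_ops_scale[OF S] bounded_ops_scale[OF T]\<close>)
qed

lemma generated_algebra_bounded:
  assumes "csubspace V" "G \<subseteq> bounded_ops V" "T \<in> generated_algebra V G"
  shows "T \<in> bounded_ops V"
  using assms(3)
  by induction
     (use assms in \<open>auto intro: bounded_ops_op_id bounded_ops_op_add bounded_ops_op_scale bounded_ops_compose\<close>)

section \<open>Weak operator topology\<close>

lemma topspace_weak_op: "topspace (weak_op_topology UNIV) = bounded_ops (UNIV :: 'h::complex_hilbert set)"
proof -
  have "bounded_ops UNIV = {T \<in> bounded_ops UNIV. cinner (0::'h) (T 0) \<in> UNIV}" by simp
  then have "bounded_ops (UNIV :: 'h set) \<in>
      {{T \<in> bounded_ops UNIV. cinner x (T y) \<in> U} |x y U. x \<in> UNIV \<and> y \<in> UNIV \<and> open U}" by blast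
  then show ?thesis unfolding weak_op_topology_def by auto
qed

lemma continuous_map_weak_op:
  "continuous_map (weak_op_topology UNIV) euclidean (\<lambda>T. cinner x (T y))"
  unfolding continuous_map topspace_weak_op
proof (intro conjI allI impI)
  fix U :: "complex set" assume "openin euclidean U"
  then show "openin (weak_op_topology UNIV) {T \<in> bounded_ops UNIV. cinner x (T y) \<in> U}"
    unfolding weak_op_topology_def by (intro topology_generated_by_Basis) auto
qed auto

text \<open>A finite sum of matrix coefficients is continuous in the weak operator topology, so its
  zeros form a closed set. Sums, rather than single coefficients, are needed for inner products of
  tuples in the amplification.\<close>

lemma weak_op_closure_sum_zero:
  fixes x y :: "nat \<Rightarrow> 'h::complex_hilbert"
  assumes T: "T \<in> weak_op_topology UNIV closure_of G"
    and 0: "\<And>R. R \<in> G \<Longrightarrow> R \<in> bounded_ops UNIV \<Longrightarrow> (\<Sum>i<d. cinner (x i) (R (y i))) = 0"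
  shows "(\<Sum>i<d. cinner (x i) (T (y i))) = 0"
proof -
  let ?f = "\<lambda>T. \<Sum>i<d. cinner (x i) (T (y i))"
  have "continuous_map (weak_op_topology UNIV) euclidean ?f"
    by (intro continuous_map_sum continuous_map_weak_op) auto
  then have "closedin (weak_op_topology UNIV) {T \<in> topspace (weak_op_topology UNIV). ?f T \<in> {0}}"
    by (rule closedin_continuous_map_preimage) simp
  then have "weak_op_topology UNIV closure_of (topspace (weak_op_topology UNIV) \<inter> G)
      \<subseteq> {T \<in> topspace (weak_op_topology UNIV). ?f T \<in> {0}}"
    by (rule closure_of_minimal[rotated]) (auto simp: 0 topspace_weak_op)
  then show ?thesis using T closure_of_restrict[of "weak_op_topology UNIV" G] by auto
qed

lemma weak_op_closure_bounded:
  "T \<in> weak_op_topology UNIV closure_of G \<Longrightarrow> T \<in> bounded_ops UNIV"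
  using closure_of_subset_topspace[of "weak_op_topology UNIV" G] topspace_weak_op by blast

lemma subset_weak_op_closure:
  "G \<subseteq> bounded_ops UNIV \<Longrightarrow> G \<subseteq> weak_op_topology UNIV closure_of G"
  by (rule closure_of_subset) (simp add: topspace_weak_op)

text \<open>A closed subspace is cut out by matrix coefficients: it is enough to test against the
  residual of \<open>T x\<close>.\<close>

lemma weak_op_closure_mem:
  assumes M: "closed_csubspace M" and T: "T \<in> weak_op_topology UNIV closure_of G"
    and G: "\<And>R. R \<in> G \<Longrightarrow> R x \<in> M"
  shows "T x \<in> M"
proof -
  let ?y = "T x - orth_proj M (T x)"
  have y: "?y \<in> orth_compl M" by (rule orth_proj_compl[OF M])
  have "(\<Sum>i<1::nat. cinner ?y (T x)) = 0"
    by (rule weak_op_closure_sum_zero[OF T, where d = 1 and x = "\<lambda>_. ?y" and y = "\<lambda>_. x"])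
       (use G y cinner_orth_compl' in auto)
  then show ?thesis by (intro orth_residual_zero_mem[OF M]) simp
qed

section \<open>Isometric representations\<close>

definition fsum_val :: "('x \<Rightarrow> 'h \<Rightarrow> 'h) \<Rightarrow> ('x, 'h::complex_hilbert) fsum \<Rightarrow> 'h" where
  "fsum_val B u = (\<Sum>(x, h)\<leftarrow>u. B x h)"

lemma fsum_val_simps [simp]:
  "fsum_val B [] = 0"
  "fsum_val B ((x, h) # u) = B x h + fsum_val B u"
  "fsum_val B (u @ v) = fsum_val B u + fsum_val B v"
  by (simp_all add: fsum_val_def)

text \<open>Scalars are absorbed into the vector \<open>h\<close>, so linear combinations are plain
  sums. No linear structure on the indices \<open>x\<close>, which may be formal words,
  enters.\<close>

lemma cspan_fsum_val:
  fixes B :: "'x \<Rightarrow> 'h \<Rightarrow> 'h::complex_hilbert"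
  assumes M: "csubspace M" and scale: "\<And>x h c. x \<in> D \<Longrightarrow> h \<in> M \<Longrightarrow> scaleC c (B x h) = B x (scaleC c h)"
  shows "cspan {B x h |x h. x \<in> D \<and> h \<in> M} = {fsum_val B u |u. set u \<subseteq> D \<times> M}" (is "?L = ?R")
proof
  have "csubspace ?R"
  proof (rule csubspaceI)
    show "0 \<in> ?R" by (auto intro!: exI[of _ "[]"])
    show "x + y \<in> ?R" if xy: "x \<in> ?R" "y \<in> ?R" for x y
    proof -
      obtain u v where "set u \<subseteq> D \<times> M" "x = fsum_val B u" "set v \<subseteq> D \<times> M" "y = fsum_val B v"
        using xy by auto
      then show ?thesis by (auto intro!: exI[of _ "u @ v"])
    qed
    show "scaleC c x \<in> ?R" if x: "x \<in> ?R" for c x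
    proof -
      obtain u where u: "set u \<subseteq> D \<times> M" "x = fsum_val B u" using x by auto
      from u(1) have "fsum_val B (map (\<lambda>(x, h). (x, scaleC c h)) u) = scaleC c (fsum_val B u)"
        by (induction u) (auto simp: scaleC_add_right scale)
      moreover have "set (map (\<lambda>(x, h). (x, scaleC c h)) u) \<subseteq> D \<times> M"
        using u(1) csubspace_scale[OF M] by auto
      ultimately show ?thesis using u(2) by (metis (mono_tags, lifting) mem_Collect_eq)
    qed
  qed
  moreover have "{B x h |x h. x \<in> D \<and> h \<in> M} \<subseteq> ?R"
  proof clarify
    fix x h assume "x \<in> D" "h \<in> M"
    then show "\<exists>u. B x h = fsum_val B u \<and> set u \<subseteq> D \<times> M" by (intro exI[of _ "[(x, h)]"]) simp
  qed
  ultimately show "?L \<subseteq> ?R" by (rule complex_vector.span_minimal[rotated])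
  have "fsum_val B u \<in> ?L" if "set u \<subseteq> D \<times> M" for u
    using that
  proof (induction u)
    case (Cons p u)
    obtain x h where p: "p = (x, h)" by force
    have "B x h \<in> ?L" using Cons.prems p by (intro complex_vector.span_base) auto
    then show ?case using Cons p by (auto intro: complex_vector.span_add)
  qed (simp add: complex_vector.span_zero)
  then show "?R \<subseteq> ?L" by auto
qed

lemma cinner_fsum_val:
  assumes "\<And>x h y k. (x, h) \<in> set u \<Longrightarrow> (y, k) \<in> set v \<Longrightarrow>
      cinner (B x h) (B y k) = cinner h (\<sigma> (ip x y) k)"
  shows "cinner (fsum_val B u) (fsum_val B v) = fsum_inner ip \<sigma> u v"
  using assms
proof (induction u)
  case (Cons p u)
  obtain x h where p: "p = (x, h)" by force
  have "cinner (B x h) (fsum_val B w) = (\<Sum>(y, k)\<leftarrow>w. cinner h (\<sigma> (ip x y) k))"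
    if "set w \<subseteq> set v" for w
    using that by (induction w) (use Cons.prems p in \<open>auto simp: cinner_add_right\<close>)
  then show ?case using Cons p by (simp add: cinner_add_left fsum_inner_def)
qed (simp add: fsum_inner_def)

text \<open>For \<open>b N = norm ((I \<otimes> D)\<^sup>N x)\<close> with \<open>D\<close> positive, this bounds \<open>norm (I \<otimes> D)\<close> by \<open>norm D\<close>
  without square roots of operators.\<close>

lemma log_convex_moment_bound:
  fixes b :: "nat \<Rightarrow> real"
  assumes nonneg: "\<And>n. b n \<ge> 0" and convex: "\<And>n. (b n)\<^sup>2 \<le> b 0 * b (2 * n)"
    and bound: "\<And>n. b n \<le> K * c ^ n" and "c > 0"
  shows "b 1 \<le> c * b 0"
proof (rule ccontr)
  assume "\<not> ?thesis"
  then have less: "c * b 0 < b 1" by simp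
  have b0: "b 0 > 0"
  proof (rule ccontr)
    assume "\<not> b 0 > 0"
    then have "b 0 = 0" using nonneg[of 0] by simp
    then show False using convex[of 1] less by simp
  qed
  define r where "r = b 1 / b 0"
  have r: "r > c" using less b0 by (simp add: r_def field_simps)
  \<comment> \<open>Convexity compares only \<open>n\<close> with \<open>2 * n\<close>, so the
    initial ratio \<open>r\<close> is propagated along powers of two.\<close>
  have pow: "b 0 * r ^ (2 ^ k) \<le> b (2 ^ k)" for k
  proof (induction k)
    case 0
    then show ?case using b0 by (simp add: r_def)
  next
    case (Suc k)
    have "(b 0 * r ^ (2 ^ k))\<^sup>2 \<le> (b (2 ^ k))\<^sup>2"
      using Suc r b0 \<open>c > 0\<close> by (intro power_mono) auto
    also have "\<dots> \<le> b 0 * b (2 ^ Suc k)" using convex[of "2 ^ k"] by simp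
    also have "(b 0 * r ^ (2 ^ k))\<^sup>2 = b 0 * (b 0 * r ^ (2 ^ Suc k))"
      by (simp add: power_mult_distrib power2_eq_square power_mult[symmetric] mult.commute[of _ 2])
         (simp add: power_add[symmetric] mult_2)
    finally show ?case using b0 by simp
  qed
  have gt: "1 < r / c" using r \<open>c > 0\<close> by simp
  obtain n where n: "K / b 0 < (r / c) ^ n" using real_arch_pow[OF gt] by blast
  \<comment> \<open>The Archimedean exponent is replaced by a larger power of two, where the lower
    bound \<open>pow\<close> is available.\<close>
  have "n \<le> 2 ^ n" by (rule less_imp_le) (rule less_exp)
  then have "(r / c) ^ n \<le> (r / c) ^ (2 ^ n)" using gt by (intro power_increasing) auto
  also have "\<dots> \<le> K / b 0"
    using order.trans[OF pow[of n] bound] b0 \<open>c > 0\<close> by (simp add: power_divide field_simps)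
  finally show False using n by simp
qed

text \<open>Complete contractivity is left out, so that the axioms visibly pass to the amplification below.\<close>

locale isometric_system =
  fixes S Sa :: "'e \<Rightarrow> 'h \<Rightarrow> 'h::complex_hilbert"
    and \<rho> :: "'a::cstar_algebra \<Rightarrow> 'h \<Rightarrow> 'h"
    and lact :: "'a \<Rightarrow> 'e \<Rightarrow> 'e" and ip :: "'e \<Rightarrow> 'e \<Rightarrow> 'a"
  assumes S_bop: "S \<xi> \<in> bounded_ops UNIV" and Sa_bop: "Sa \<xi> \<in> bounded_ops UNIV"
    and rho_bop: "\<rho> a \<in> bounded_ops UNIV"
    and S_adj: "cinner (S \<xi> h) k = cinner h (Sa \<xi> k)"
    and rho_adj: "cinner (\<rho> a h) k = cinner h (\<rho> (cstar a) k)"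
    and rho_mult: "\<rho> (a * b) h = \<rho> a (\<rho> b h)"
    and rho_one: "\<rho> 1 h = h" and rho_zero: "\<rho> 0 h = 0"
    and S_lact: "S (lact a \<xi>) h = \<rho> a (S \<xi> h)"
    and S_isom: "Sa \<xi> (S \<eta> h) = \<rho> (ip \<xi> \<eta>) h"
begin

abbreviation "wop \<equiv> word_op S \<rho>"

abbreviation words :: "nat \<Rightarrow> ('a, 'e) word set" where
  "words n \<equiv> {x. word_degree x = n}"

definition rho_inv :: "'h set \<Rightarrow> bool" where
  "rho_inv M \<longleftrightarrow> (\<forall>a. \<forall>h\<in>M. \<rho> a h \<in> M)"

definition coinv :: "'h set \<Rightarrow> bool" where
  "coinv M \<longleftrightarrow> closed_csubspace M \<and> rho_inv M \<and> (\<forall>\<xi>. \<forall>h\<in>M. Sa \<xi> h \<in> M)"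

text \<open>The space written \<open>[S(E)M]\<close> in the overview.\<close>

definition sspan :: "'h set \<Rightarrow> 'h set" where
  "sspan M = closure (cspan {S \<xi> h |\<xi> h. h \<in> M})"

text \<open>For \<open>D = words n\<close> and \<open>M\<close> invariant under \<rho> this is
  \<open>[S(E)^n M]\<close>, the innermost letter of a word acting through \<rho>. For
  \<open>D = UNIV\<close> it is \<open>\<SS>[M]\<close>, by
  \<open>closed_image_span_wot_alg\<close>.\<close>

definition wspan :: "('a, 'e) word set \<Rightarrow> 'h set \<Rightarrow> 'h set" where
  "wspan D M = closure (cspan {wop x h |x h. x \<in> D \<and> h \<in> M})"

lemma rho_adj': "cinner h (\<rho> a k) = cinner (\<rho> (cstar a) h) k"
  by (simp add: rho_adj cstar_cstar)

lemma S_adj': "cinner k (S \<xi> h) = cinner (Sa \<xi> k) h"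
  using S_adj[of \<xi> h k] cinner_commute by metis

lemma wop_bop: "wop x \<in> bounded_ops UNIV"
proof (induction x)
  case (Scal a)
  then show ?case using rho_bop by simp
next
  case (Tens \<xi> x)
  then show ?case using bop_compose[OF S_bop Tens] by (simp add: fun_eq_iff)
qed

lemma wop_act: "wop (word_act lact a x) h = \<rho> a (wop x h)"
  by (cases x) (simp_all add: rho_mult S_lact)

text \<open>Each \<open>S(\<xi>)^* S(\<eta>)\<close> collapses to \<rho> of the inner product, which
  is absorbed into the next letter. Words of degree \<open>n\<close> thus span a copy of
  \<open>E^n\<close> tensored with the space. Equality of degrees matters: words of different degree
  are orthogonal in the Fock space, but in general not here.\<close>

lemma wop_gram:
  assumes "word_degree x = word_degree y"
  shows "cinner (wop x h) (wop y k) = cinner h (\<rho> (word_inner lact ip x y) k)"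
  using assms
proof (induction x arbitrary: y)
  case (Scal a)
  then obtain b where "y = Scal b" by (cases y) auto
  then show ?case by (simp add: rho_adj rho_mult)
next
  case (Tens \<xi> x)
  then obtain \<eta> z where y: "y = Tens \<eta> z" "word_degree x = word_degree z" by (cases y) auto
  have "word_degree (word_act lact (ip \<xi> \<eta>) z) = word_degree z" by (cases z) auto
  then show ?case using Tens.IH[of "word_act lact (ip \<xi> \<eta>) z"] y
    by (simp add: S_adj S_isom wop_act)
qed

lemma closed_wspan: "closed_csubspace (wspan D M)"
  unfolding wspan_def by (rule closed_csubspace_closure_cspan)

lemma wspan_base: "x \<in> D \<Longrightarrow> h \<in> M \<Longrightarrow> wop x h \<in> wspan D M"
  unfolding wspan_def by (rule closure_cspan_base) auto

lemma wspan_minimal: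
  "closed_csubspace N \<Longrightarrow> (\<And>x h. x \<in> D \<Longrightarrow> h \<in> M \<Longrightarrow> wop x h \<in> N) \<Longrightarrow> wspan D M \<subseteq> N"
  unfolding wspan_def by (rule closure_cspan_minimal) auto

lemma wspan_mono: "M \<subseteq> N \<Longrightarrow> wspan D M \<subseteq> wspan D N"
  by (rule wspan_minimal[OF closed_wspan]) (auto intro: wspan_base)

lemma closed_sspan: "closed_csubspace (sspan M)"
  unfolding sspan_def by (rule closed_csubspace_closure_cspan)

lemma sspan_base: "h \<in> M \<Longrightarrow> S \<xi> h \<in> sspan M"
  unfolding sspan_def by (rule closure_cspan_base) auto

lemma sspan_minimal:
  "closed_csubspace N \<Longrightarrow> (\<And>\<xi> h. h \<in> M \<Longrightarrow> S \<xi> h \<in> N) \<Longrightarrow> sspan M \<subseteq> N"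
  unfolding sspan_def by (rule closure_cspan_minimal) auto

lemma sspan_mono: "M \<subseteq> N \<Longrightarrow> sspan M \<subseteq> sspan N"
  by (rule sspan_minimal[OF closed_sspan]) (auto intro: sspan_base)

lemma coinvD:
  assumes "coinv M"
  shows "closed_csubspace M" "csubspace M" "rho_inv M" "h \<in> M \<Longrightarrow> \<rho> a h \<in> M" "h \<in> M \<Longrightarrow> Sa \<xi> h \<in> M"
  using assms by (auto simp: coinv_def rho_inv_def closed_csubspace_def)

lemma coinvI:
  "closed_csubspace M \<Longrightarrow> (\<And>a h. h \<in> M \<Longrightarrow> \<rho> a h \<in> M) \<Longrightarrow> (\<And>\<xi> h. h \<in> M \<Longrightarrow> Sa \<xi> h \<in> M) \<Longrightarrow> coinv M"
  by (auto simp: coinv_def rho_inv_def)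

lemma coinv_Int: "coinv M \<Longrightarrow> coinv N \<Longrightarrow> coinv (M \<inter> N)"
  by (auto intro!: coinvI closed_csubspace_Int dest: coinvD)

lemma rho_inv_orth_compl: "rho_inv M \<Longrightarrow> rho_inv (orth_compl M)"
  by (auto simp: rho_inv_def orth_compl_def rho_adj')

lemma orth_proj_rho:
  assumes "closed_csubspace M" "rho_inv M"
  shows "orth_proj M (\<rho> a h) = \<rho> a (orth_proj M h)"
proof (rule orth_proj_eqI[OF assms(1)])
  show "\<rho> a (orth_proj M h) \<in> M" using assms orth_proj_mem by (auto simp: rho_inv_def)
  show "\<rho> a h - \<rho> a (orth_proj M h) \<in> orth_compl M"
    using rho_inv_orth_compl[OF assms(2)] orth_proj_compl[OF assms(1), of h]
    by (simp add: bop_diff[OF rho_bop, symmetric] rho_inv_def)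
qed

abbreviation "wval \<equiv> fsum_val wop"

text \<open>The operator \<open>I \<otimes> f\<close> on formal sums. Working with lists avoids
  having to show that it is well defined on the vectors \<open>wval u\<close>.\<close>

definition emap :: "('h \<Rightarrow> 'h) \<Rightarrow> ('x \<times> 'h) list \<Rightarrow> ('x \<times> 'h) list" where
  "emap f u = map (\<lambda>(x, h). (x, f h)) u"

lemma emap_simps [simp]:
  "emap f [] = []" "emap f ((x, h) # u) = (x, f h) # emap f u"
  by (simp_all add: emap_def)

lemma emap_emap: "emap f (emap g u) = emap (\<lambda>h. f (g h)) u"
  by (induction u) auto

lemma emap_id: "(\<And>x h. (x, h) \<in> set u \<Longrightarrow> f h = h) \<Longrightarrow> emap f u = u"
  unfolding emap_def by (rule map_idI) auto

lemma set_emap: "set u \<subseteq> D \<times> UNIV \<Longrightarrow> set (emap f u) \<subseteq> D \<times> UNIV"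
  by (auto simp: emap_def)

text \<open>In the Gram form the coefficients act through \<rho>, so an operator commuting with
  \<rho> can pass from one side to the other.\<close>

lemma emap_selfadjoint:
  assumes "\<And>h k. cinner (f h) k = cinner h (f k)" "\<And>a h. f (\<rho> a h) = \<rho> a (f h)"
    and "set u \<subseteq> words n \<times> UNIV" "set v \<subseteq> words n \<times> UNIV"
  shows "cinner (wval (emap f u)) (wval v) =
    cinner (wval u) (wval (emap f v))"
proof -
  have g: "cinner (wval u) (wval v) = fsum_inner (word_inner lact ip) \<rho> u v"
    if "set u \<subseteq> words n \<times> UNIV" "set v \<subseteq> words n \<times> UNIV" for u v
    by (rule cinner_fsum_val, rule wop_gram) (use that in fastforce)
  have "fsum_inner (word_inner lact ip) \<rho> (emap f u) v = fsum_inner (word_inner lact ip) \<rho> u (emap f v)"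
    unfolding fsum_inner_def emap_def
    by (simp add: assms(1,2) split_def o_def)
  then show ?thesis using g assms(3,4) set_emap by metis
qed

text \<open>This is a crude triangle inequality; the point is that \<open>K\<close> depends on
  \<open>u\<close> alone. Applied to all powers of one operator, it gives the growth bound required
  by \<open>log_convex_moment_bound\<close>.\<close>

lemma fsum_val_emap_bound:
  "\<exists>K\<ge>0. \<forall>f t. t \<ge> 0 \<longrightarrow> (\<forall>h. norm (f h) \<le> t * norm h) \<longrightarrow> norm (wval (emap f u)) \<le> K * t"
proof (induction u)
  case Nil
  then show ?case by (intro exI[of _ 0]) auto
next
  case (Cons p u)
  obtain x h where p: "p = (x, h)" by force
  obtain K where K: "K \<ge> 0" "\<And>f t. t \<ge> 0 \<Longrightarrow> (\<And>h. norm (f h) \<le> t * norm h) \<Longrightarrow> norm (wval (emap f u)) \<le> K * t"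
    using Cons by blast
  obtain L where L: "L \<ge> 0" "\<And>k. norm (wop x k) \<le> L * norm k" using bop_bounded_pos[OF wop_bop] by blast
  have "norm (wval (emap f (p # u))) \<le> (L * norm h + K) * t"
    if f: "t \<ge> 0" "\<And>h. norm (f h) \<le> t * norm h" for f t
  proof -
    have "norm (wop x (f h)) \<le> L * (t * norm h)"
      using order.trans[OF L(2)[of "f h"] mult_left_mono[OF f(2)[of h] L(1)]] .
    then show ?thesis
      using norm_triangle_mono[OF _ K(2)[OF f], of "wop x (f h)" "L * (t * norm h)"] p
      by (simp add: algebra_simps)
  qed
  then show ?case using L K by (intro exI[of _ "L * norm h + K"]) auto
qed

text \<open>The gap between \<open>M\<close> and \<open>U\<close> makes the projection onto
  \<open>U\<close> a strict contraction on \<open>M\<close>. To carry this over to sums of words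
  with one constant for all degrees, the moment estimate is applied to the powers of the compression
  of this projection to \<open>M\<close>.\<close>

lemma emap_orth_proj_contraction:
  assumes M: "closed_csubspace M" "rho_inv M" "finite_dim M"
    and U: "closed_csubspace U" "rho_inv U" and disj: "M \<inter> U = {0}"
  obtains c where "0 \<le> c" "c < 1"
    "\<And>n u. set u \<subseteq> words n \<times> M \<Longrightarrow>
       norm (wval (emap (orth_proj U) u)) \<le> c * norm (wval u)"
proof -
  let ?P = "orth_proj M" and ?Q = "orth_proj U"
  obtain C0 where C0: "C0 \<ge> 1" "\<And>m u. m \<in> M \<Longrightarrow> u \<in> U \<Longrightarrow> norm m \<le> C0 * norm (m - u)"
    using finite_dim_disjoint_gap[OF M(3) U(1) disj] by blast
  \<comment> \<open>Enlarging the constant makes \<open>C > 1\<close>, hence \<open>c > 0\<close> as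
    the moment estimate demands.\<close>
  define C where "C = C0 + 1"
  have C1: "C > 1" using C0(1) by (simp add: C_def)
  have C: "norm m \<le> C * norm (m - u)" if "m \<in> M" "u \<in> U" for m u
    using C0(2)[OF that] norm_ge_zero[of "m - u"] unfolding C_def distrib_right by linarith
  \<comment> \<open>From Pythagoras: the distance of \<open>m\<close> from \<open>U\<close> is at
    least \<open>norm m / C\<close>.\<close>
  define c where "c = sqrt (1 - 1 / C\<^sup>2)"
  have C2: "C\<^sup>2 > 1" using C1 by (simp add: one_less_power)
  have C3: "0 < 1 / C\<^sup>2" "1 / C\<^sup>2 < 1" 
    using C1 C2 divide_less_eq_1_pos[of "C\<^sup>2" 1] by auto
  have c: "0 < c" "c < 1" using C3 by (auto simp: c_def)
  have c2: "c\<^sup>2 = 1 - 1 / C\<^sup>2" using C3 by (simp add: c_def)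
  have Qbound: "norm (?Q m) \<le> c * norm m" if m: "m \<in> M" for m
  proof -
    have "(norm m)\<^sup>2 \<le> C\<^sup>2 * (norm (m - ?Q m))\<^sup>2"
      using power_mono[OF C[OF m orth_proj_mem[OF U(1), of m]], of 2] by (simp add: power_mult_distrib)
    then have "(norm m)\<^sup>2 / C\<^sup>2 \<le> (norm (m - ?Q m))\<^sup>2"
      using C1 by (simp add: pos_divide_le_eq mult.commute)
    then have "(norm (?Q m))\<^sup>2 \<le> (norm m)\<^sup>2 - (norm m)\<^sup>2 / C\<^sup>2"
      using norm_orth_proj_pythagoras[OF U(1), of m] by linarith
    also have "\<dots> = (c * norm m)\<^sup>2" unfolding power_mult_distrib c2 by (simp add: left_diff_distrib)
    finally show ?thesis by (rule power2_le_imp_le) (use c in simp)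
  qed
  \<comment> \<open>\<open>?Q\<close> need not shrink vectors outside \<open>M\<close>. The
    compression shrinks all vectors and is still self-adjoint and commuting with \<rho>.\<close>
  define D where "D h = ?P (?Q (?P h))" for h
  have Dsa: "cinner (D h) k = cinner h (D k)" for h k
    by (simp add: D_def orth_proj_selfadjoint[OF M(1)] orth_proj_selfadjoint[OF U(1)])
  have Drho: "D (\<rho> a h) = \<rho> a (D h)" for a h
    by (simp add: D_def orth_proj_rho M U)
  have Dbound: "norm (D h) \<le> c * norm h" for h
  proof -
    have "norm (D h) \<le> norm (?Q (?P h))" unfolding D_def by (rule norm_orth_proj_le[OF M(1)])
    also have "\<dots> \<le> c * norm (?P h)" by (rule Qbound[OF orth_proj_mem[OF M(1)]])
    also have "\<dots> \<le> c * norm h" using norm_orth_proj_le[OF M(1)] c by simp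
    finally show ?thesis .
  qed
  have Dn1: "cinner ((D ^^ n) h) k = cinner h ((D ^^ n) k)" for n h k
    by (induction n arbitrary: h k) (simp_all add: Dsa funpow_swap1)
  have Dn2: "(D ^^ n) (\<rho> a h) = \<rho> a ((D ^^ n) h)" for n h a
    by (induction n) (simp_all add: Drho)
  have Dn3: "norm ((D ^^ n) h) \<le> c ^ n * norm h" for n h
  proof (induction n)
    case (Suc n)
    have "norm ((D ^^ Suc n) h) \<le> c * (c ^ n * norm h)"
      using order.trans[OF Dbound[of "(D ^^ n) h"] mult_left_mono[OF Suc]] c by simp
    then show ?case by (simp add: mult.assoc)
  qed simp
  note Dn = Dn1 Dn2 Dn3
  \<comment> \<open>The squared norm of \<open>(I \<otimes> Q) u\<close> is the pairing of
    \<open>u\<close> with \<open>(I \<otimes> D) u\<close>, so the factor \<open>c\<close> for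
    \<open>D\<close> yields \<open>sqrt c\<close> for \<open>Q\<close>.\<close>
  have main: "norm (wval (emap ?Q u)) \<le> sqrt c * norm (wval u)"
    if u: "set u \<subseteq> words n \<times> M" for u n
  proof -
    have u': "set u \<subseteq> words n \<times> UNIV" using u by auto
    note eu = set_emap[OF u']
    define b where "b N = norm (wval (emap (D ^^ N) u))" for N
    have b0: "b 0 = norm (wval u)" by (simp add: b_def emap_id)
    have "(b N)\<^sup>2 \<le> b 0 * b (2 * N)" for N
    proof -
      have "complex_of_real ((b N)\<^sup>2) =
          cinner (wval (emap (D ^^ N) u)) (wval (emap (D ^^ N) u))"
        by (simp add: b_def cinner_self)
      also have "\<dots> = cinner (wval u) (wval (emap (D ^^ N) (emap (D ^^ N) u)))"
        by (rule emap_selfadjoint[OF Dn(1,2) u' eu])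
      also have "emap (D ^^ N) (emap (D ^^ N) u) = emap (D ^^ (2 * N)) u"
        by (simp add: emap_emap mult_2 funpow_add o_def)
      finally have "(b N)\<^sup>2 = cmod (cinner (wval u) (wval (emap (D ^^ (2 * N)) u)))"
        by (metis norm_of_real abs_of_nonneg zero_le_power2)
      also have "\<dots> \<le> b 0 * b (2 * N)" unfolding b0 unfolding b_def by (rule cmod_cinner_le)
      finally show ?thesis .
    qed
    moreover obtain K where "K \<ge> 0" "\<And>N. b N \<le> K * c ^ N"
      using fsum_val_emap_bound[of u] Dn(3) c unfolding b_def
      by (metis less_imp_le zero_le_power)
    ultimately have b1: "b 1 \<le> c * b 0"
      using log_convex_moment_bound[of b K c] c by (simp add: b_def)
    have Pu: "emap ?P u = u" by (rule emap_id) (use u orth_proj_id[OF M(1)] in auto)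
    have "complex_of_real ((norm (wval (emap ?Q u)))\<^sup>2) =
        cinner (wval (emap ?Q u)) (wval (emap ?Q u))" by (simp add: cinner_self)
    also have "\<dots> = cinner (wval u) (wval (emap ?Q (emap ?Q u)))"
      by (rule emap_selfadjoint[OF orth_proj_selfadjoint orth_proj_rho u' eu]) (rule U)+
    also have "emap ?Q (emap ?Q u) = emap ?Q u"
      by (simp add: emap_emap orth_proj_id[OF U(1)] orth_proj_mem[OF U(1)])
    also have "cinner (wval u) (wval (emap ?Q u)) =
        cinner (wval (emap ?P u)) (wval (emap ?Q (emap ?P u)))" by (simp add: Pu)
    also have "\<dots> = cinner (wval u) (wval (emap ?P (emap ?Q (emap ?P u))))"
      by (rule emap_selfadjoint[OF orth_proj_selfadjoint orth_proj_rho u']) (use M u' set_emap in blast)+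
    also have "emap ?P (emap ?Q (emap ?P u)) = emap (D ^^ 1) u"
      by (simp add: emap_emap D_def[abs_def])
    finally have "(norm (wval (emap ?Q u)))\<^sup>2 =
        cmod (cinner (wval u) (wval (emap (D ^^ 1) u)))"
      by (metis norm_of_real abs_of_nonneg zero_le_power2)
    also have "\<dots> \<le> b 0 * b 1" unfolding b0 unfolding b_def by (rule cmod_cinner_le)
    also have "\<dots> \<le> b 0 * (c * b 0)" using b1 b0 by (intro mult_left_mono) auto
    also have "\<dots> = (sqrt c * norm (wval u))\<^sup>2"
      using c by (simp add: b0 power_mult_distrib power2_eq_square mult_ac)
    finally show ?thesis by (rule power2_le_imp_le) (use c in simp)
  qed
  show ?thesis by (rule that[of "sqrt c"]) (use c main in auto)
qed

end

section \<open>Coinvariant subspaces\<close>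

text \<open>The induction runs over the size of a spanning set. A vector of \<open>M\<close> outside
  \<open>N\<close> extends a basis of \<open>N\<close> to an independent set, so this basis is
  strictly smaller than any finite spanning set of \<open>M\<close>.\<close>

lemma finite_dim_psubset_induct [consumes 1, case_names less]:
  assumes "finite_dim M"
    and step: "\<And>M. finite_dim M \<Longrightarrow> (\<And>N. csubspace N \<Longrightarrow> N \<subset> M \<Longrightarrow> P N) \<Longrightarrow> P M"
  shows "P (M :: 'v::complex_vector set)"
proof -
  obtain B where B: "finite B" "M = cspan B" using assms(1) by (auto simp: finite_dim_def)
  then show ?thesis
  proof (induction "card B" arbitrary: B M rule: less_induct)
    case less
    show ?case
    proof (rule step)
      show "finite_dim M" using less.prems by (auto simp: finite_dim_def)
      fix N assume N: "csubspace N" "N \<subset> M"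
      obtain C where C: "C \<subseteq> N" "\<not> complex_vector.dependent C" "N \<subseteq> cspan C"
        using complex_vector.maximal_independent_subset by blast
      have NC: "N = cspan C" using C N(1) complex_vector.span_minimal by blast
      obtain x where x: "x \<in> M" "x \<notin> N" using N(2) by blast
      have "\<not> complex_vector.dependent (insert x C)"
        using x C(2) NC complex_vector.independent_insertI by blast
      then have "finite (insert x C) \<and> card (insert x C) \<le> card B"
        by (rule complex_vector.independent_span_bound[OF less.prems(1)])
           (use C(1) N(2) x(1) less.prems(2) in auto)
      moreover have "x \<notin> C" using C(1) x(2) by blast
      ultimately have "finite C" "card C < card B" by auto
      then show "P N" using less.hyps[of C N] NC by blast
    qed
  qed
qed

context isometric_system
begin

text \<open>The adjoints of the letters move onto \<open>z\<close> one at a time, and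
  \<open>z\<close> stays in \<open>U\<close>. At the end \<open>U\<close> sees only the projection
  of \<open>h\<close>.\<close>

lemma cinner_coinv_wop:
  assumes "coinv U" "z \<in> U"
  shows "cinner z (wop x h) = cinner z (wop x (orth_proj U h))"
  using assms(2)
proof (induction x arbitrary: z)
  case (Scal a)
  then have "\<rho> (cstar a) z \<in> U" using coinvD(4)[OF assms(1)] by blast
  then show ?case by (simp add: rho_adj' cinner_orth_proj_right[OF coinvD(1)[OF assms(1)]])
next
  case (Tens \<xi> x)
  then have "Sa \<xi> z \<in> U" using coinvD(5)[OF assms(1)] by blast
  then show ?case using Tens.IH by (simp add: S_adj')
qed

lemma wspan_fsum_val:
  assumes "csubspace M"
  shows "wspan D M = closure {wval u |u. set u \<subseteq> D \<times> M}"
  unfolding wspan_def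
  by (subst cspan_fsum_val[OF assms]) (simp_all add: bop_scaleC[OF wop_bop])

text \<open>The constant is fixed before \<open>n\<close>. The estimate holds for finite sums of
  words and is a closed condition on \<open>y\<close>.\<close>

lemma coinv_wspan_angle:
  assumes M: "finite_dim M" "rho_inv M" and U: "coinv U" and disj: "M \<inter> U = {0}"
  obtains c where "0 \<le> c" "c < 1"
    "\<And>n y z. y \<in> wspan (words n) M \<Longrightarrow> z \<in> U \<Longrightarrow> cmod (cinner z y) \<le> c * norm z * norm y"
proof -
  have M': "closed_csubspace M" by (rule closed_csubspace_finite_dim[OF M(1)])
  then have subM: "csubspace M" by (simp add: closed_csubspace_def)
  obtain c where c: "0 \<le> c" "c < 1"
    and contr: "\<And>n u. set u \<subseteq> words n \<times> M \<Longrightarrow>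
       norm (wval (emap (orth_proj U) u)) \<le> c * norm (wval u)"
    using emap_orth_proj_contraction[OF M' M(2,1) coinvD(1,3)[OF U] disj] by blast
  have "cmod (cinner z y) \<le> c * norm z * norm y" if y: "y \<in> wspan (words n) M" and z: "z \<in> U" for n y z
  proof -
    have "{wval u |u. set u \<subseteq> words n \<times> M} \<subseteq> {y. cmod (cinner z y) \<le> c * norm z * norm y}"
    proof clarify
      fix u assume u: "set u \<subseteq> words n \<times> M"
      have "cinner z (wval u) = cinner z (wval (emap (orth_proj U) u))"
        by (induction u) (auto simp: cinner_add_right cinner_coinv_wop[OF U z, symmetric])
      then have "cmod (cinner z (wval u)) \<le> norm z * norm (wval (emap (orth_proj U) u))"
        using cmod_cinner_le by metis
      also have "\<dots> \<le> norm z * (c * norm (wval u))"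
        using contr[OF u] by (rule mult_left_mono) simp
      finally show "cmod (cinner z (wval u)) \<le> c * norm z * norm (wval u)"
        by (simp add: mult_ac)
    qed
    moreover have "closed {y. cmod (cinner z y) \<le> c * norm z * norm y}"
      by (intro closed_Collect_le continuous_intros)
    ultimately show ?thesis
      using y closure_minimal unfolding wspan_fsum_val[OF subM] by blast
  qed
  then show ?thesis using that c by blast
qed

text \<open>A letter is added at the inner end of the word: the old end \<open>Scal a\<close> is
  absorbed into \<open>\<xi>\<close> by the left action, and \<open>Scal 1\<close> becomes the new
  end.\<close>

lemma word_append_exists:
  "\<exists>z. word_degree z = Suc (word_degree x) \<and> (\<forall>h. wop z h = wop x (S \<xi> h))"
proof (induction x)
  case (Scal a)
  show ?case by (intro exI[of _ "Tens (lact a \<xi>) (Scal 1)"]) (simp add: S_lact rho_one)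
next
  case (Tens \<eta> x)
  then obtain z where "word_degree z = Suc (word_degree x)" "\<And>h. wop z h = wop x (S \<xi> h)" by blast
  then show ?case by (intro exI[of _ "Tens \<eta> z"]) simp
qed

text \<open>Each vector of \<open>M\<close> is a limit of sums of vectors \<open>S \<xi> h'\<close>
  with \<open>h'\<close> in \<open>M\<close>, so words can be lengthened at their inner end.\<close>

lemma wspan_Suc:
  assumes full: "M \<subseteq> sspan M"
  shows "wspan (words n) M \<subseteq> wspan (words (Suc n)) M"
proof (rule wspan_minimal[OF closed_wspan])
  fix x h assume x: "x \<in> words n" and h: "h \<in> M"
  show "wop x h \<in> wspan (words (Suc n)) M"
  proof (rule bop_closure_cspan_mem[OF wop_bop closed_wspan])
    show "h \<in> closure (cspan {S \<xi> h |\<xi> h. h \<in> M})" using h full unfolding sspan_def by blast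
    fix k assume "k \<in> {S \<xi> h |\<xi> h. h \<in> M}"
    then obtain \<xi> h' where k: "k = S \<xi> h'" "h' \<in> M" by blast
    obtain z where "word_degree z = Suc (word_degree x)" "wop z h' = wop x (S \<xi> h')"
      using word_append_exists[of x \<xi>] by blast
    then show "wop x k \<in> wspan (words (Suc n)) M"
      using wspan_base[of z "words (Suc n)" h' M] x k by simp
  qed
qed

lemma wspan_words_mono: "M \<subseteq> sspan M \<Longrightarrow> m \<le> n \<Longrightarrow> wspan (words m) M \<subseteq> wspan (words n) M"
  by (rule lift_Suc_mono_le[of "\<lambda>n. wspan (words n) M"]) (auto dest: wspan_Suc)

lemma wspan_UNIV_subset:
  assumes full: "M \<subseteq> sspan M"
  shows "wspan UNIV M \<subseteq> closure (\<Union>n. wspan (words n) M)"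
proof (rule wspan_minimal)
  let ?W = "\<Union>n. wspan (words n) M"
  have W: "csubspace (wspan (words n) M)" for n using closed_wspan closed_csubspace_def by blast
  \<comment> \<open>The spaces increase, so two elements lie in a common one.\<close>
  have "csubspace ?W"
  proof (rule csubspaceI)
    show "0 \<in> ?W" using csubspace_0[OF W] by blast
    show "scaleC c x \<in> ?W" if "x \<in> ?W" for c x
      using that csubspace_scale[OF W] by blast
    show "x + y \<in> ?W" if xy: "x \<in> ?W" "y \<in> ?W" for x y
    proof -
      obtain m n where "x \<in> wspan (words m) M" "y \<in> wspan (words n) M" using xy by blast
      then have "x \<in> wspan (words (max m n)) M" "y \<in> wspan (words (max m n)) M"
        using wspan_words_mono[OF full] by (meson max.cobounded1 max.cobounded2 subsetD)+
      then show ?thesis using csubspace_add[OF W] by blast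
    qed
  qed
  then show "closed_csubspace (closure ?W)" by (simp add: closed_csubspace_def csubspace_closure)
  show "wop x h \<in> closure ?W" if "h \<in> M" for x h
    using that wspan_base[of x "words (word_degree x)" h M] closure_subset[of ?W] by blast
qed

text \<open>The vectors generated by \<open>M\<close> are limits of vectors in the increasing spaces
  \<open>wspan (words n) M\<close>. If \<open>M \<inter> U = 0\<close>, these stay at a positive angle to \<open>U\<close>, uniformly in \<open>n\<close>.\<close>

lemma finite_dim_meets_coinv:
  assumes M: "finite_dim M" "rho_inv M" "M \<subseteq> sspan M" and U: "coinv U"
    and z: "z \<in> U" "z \<in> wspan UNIV M" "z \<noteq> 0"
  shows "M \<inter> U \<noteq> {0}"
proof
  assume disj: "M \<inter> U = {0}"
  obtain c where c: "0 \<le> c" "c < 1"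
    "\<And>n y z. y \<in> wspan (words n) M \<Longrightarrow> z \<in> U \<Longrightarrow> cmod (cinner z y) \<le> c * norm z * norm y"
    using coinv_wspan_angle[OF M(1,2) U disj] by blast
  have "closed {y. cmod (cinner z y) \<le> c * norm z * norm y}"
    by (intro closed_Collect_le continuous_intros)
  then have "closure (\<Union>n. wspan (words n) M) \<subseteq> {y. cmod (cinner z y) \<le> c * norm z * norm y}"
    by (rule closure_minimal[rotated]) (use c(3) z(1) in blast)
  \<comment> \<open>The angle bound holds on the closure, where \<open>y = z\<close> is
    allowed.\<close>
  then have "cmod (cinner z z) \<le> c * norm z * norm z"
    using wspan_UNIV_subset[OF M(3)] z(2) by blast
  then have "(norm z)\<^sup>2 \<le> c * (norm z)\<^sup>2"
    by (simp add: cinner_self norm_power power2_eq_square mult.assoc norm_mult)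
  then show False using c(2) z(3) by simp
qed

section \<open>The reducing subspace generated by a coinvariant subspace\<close>

lemma subset_wspan_UNIV: "M \<subseteq> wspan UNIV M"
  using wspan_base[of "Scal 1" UNIV _ M] by (auto simp: rho_one)

lemma wspan_UNIV_S: "h \<in> wspan UNIV M \<Longrightarrow> S \<xi> h \<in> wspan UNIV M"
proof (rule bop_closure_cspan_mem[OF S_bop closed_wspan])
  show "S \<xi> k \<in> wspan UNIV M" if k: "k \<in> {wop x h |x h. x \<in> UNIV \<and> h \<in> M}" for k
  proof -
    obtain x h where "k = wop x h" "h \<in> M" using k by blast
    then show ?thesis using wspan_base[of "Tens \<xi> x" UNIV h M] by simp
  qed
qed (simp add: wspan_def)

lemma wspan_UNIV_rho: "h \<in> wspan UNIV M \<Longrightarrow> \<rho> a h \<in> wspan UNIV M"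
proof (rule bop_closure_cspan_mem[OF rho_bop closed_wspan])
  show "\<rho> a k \<in> wspan UNIV M" if k: "k \<in> {wop x h |x h. x \<in> UNIV \<and> h \<in> M}" for k
  proof -
    obtain x h where "k = wop x h" "h \<in> M" using k by blast
    then show ?thesis using wspan_base[of "word_act lact a x" UNIV h M] by (simp add: wop_act)
  qed
qed (simp add: wspan_def)

text \<open>An adjoint letter either cancels the first letter of a word by isometry, or meets a word
  of degree 0 and is absorbed by \<open>M\<close>. With \<open>wspan_UNIV_S\<close> and
  \<open>wspan_UNIV_rho\<close> this makes the space reducing.\<close>

lemma coinv_wspan_UNIV:
  assumes M: "coinv M"
  shows "coinv (wspan UNIV M)"
proof (rule coinvI[OF closed_wspan])
  show "\<rho> a h \<in> wspan UNIV M" if "h \<in> wspan UNIV M" for a h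
    using that by (rule wspan_UNIV_rho)
  show "Sa \<xi> h \<in> wspan UNIV M" if h: "h \<in> wspan UNIV M" for \<xi> h
  proof (rule bop_closure_cspan_mem[OF Sa_bop closed_wspan])
    show "h \<in> closure (cspan {wop x h |x h. x \<in> UNIV \<and> h \<in> M})" using h by (simp add: wspan_def)
    fix k assume "k \<in> {wop x h |x h. x \<in> UNIV \<and> h \<in> M}"
    then obtain x h where k: "k = wop x h" "h \<in> M" by blast
    show "Sa \<xi> k \<in> wspan UNIV M"
    proof (cases x)
      case (Scal a)
      then have "Sa \<xi> k \<in> M" using k coinvD[OF M] by simp
      then show ?thesis using subset_wspan_UNIV by blast
    next
      case (Tens \<eta> y)
      then show ?thesis using k wspan_base[of y UNIV h M] by (simp add: S_isom wspan_UNIV_rho)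
    qed
  qed
qed

lemma coinv_orth_compl:
  assumes "rho_inv N" "\<And>\<xi> h. h \<in> N \<Longrightarrow> S \<xi> h \<in> N"
  shows "coinv (orth_compl N)"
proof (rule coinvI[OF closed_csubspace_orth_compl])
  show "\<rho> a h \<in> orth_compl N" if "h \<in> orth_compl N" for a h
    using that rho_inv_orth_compl[OF assms(1)] by (auto simp: rho_inv_def)
  show "Sa \<xi> h \<in> orth_compl N" if "h \<in> orth_compl N" for \<xi> h
    using that assms(2) by (auto simp: orth_compl_def S_adj[symmetric])
qed

lemma orth_compl_coinv_S:
  assumes "coinv M" "h \<in> orth_compl M"
  shows "S \<xi> h \<in> orth_compl M"
  using assms coinvD(5)[OF assms(1)] by (auto simp: orth_compl_def S_adj')

lemma coinv_orth_compl_wspan: "coinv (orth_compl (wspan UNIV M))"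
  by (rule coinv_orth_compl) (auto simp: rho_inv_def wspan_UNIV_rho wspan_UNIV_S)

text \<open>Moving letters onto \<open>N\<close> shows that \<open>N\<close> is orthogonal to
  everything generated by \<open>M\<close>. That space is coinvariant, so its complement is
  invariant under all words and contains everything generated by \<open>N\<close>.\<close>

lemma wspan_orthogonal:
  assumes "coinv M" "coinv N" "orthogonal_sets M N"
  shows "orthogonal_sets (wspan UNIV M) (wspan UNIV N)"
proof -
  have "N \<subseteq> orth_compl (wspan UNIV M)"
  proof
    fix z assume z: "z \<in> N"
    have "cinner z (wop x h) = 0" if "h \<in> M" for x h
      using z
    proof (induction x arbitrary: z)
      case (Scal a)
      have "cinner (\<rho> a h) z = 0"
        using assms(3) coinvD(4)[OF assms(1) that] Scal by (auto simp: orthogonal_sets_def)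
      then show ?case using cinner_commute[of z "\<rho> a h"] by simp
    next
      case (Tens \<xi> x)
      then show ?case using coinvD(5)[OF assms(2)] by (simp add: S_adj')
    qed
    then have "z \<in> orth_compl {wop x h |x h. x \<in> UNIV \<and> h \<in> M}"
      by (auto simp: orth_compl_def) (metis cinner_commute complex_cnj_zero)
    then show "z \<in> orth_compl (wspan UNIV M)" by (simp add: wspan_def orth_compl_closure_cspan)
  qed
  moreover have "wop x h \<in> orth_compl (wspan UNIV M)" if "h \<in> orth_compl (wspan UNIV M)" for x h
  proof (induction x)
    case (Scal a)
    then show ?case using that coinvD(4)[OF coinv_orth_compl_wspan] by simp
  next
    case (Tens \<xi> x)
    then show ?case using orth_compl_coinv_S[OF coinv_wspan_UNIV[OF assms(1)]] by simp
  qed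
  ultimately have "wspan UNIV N \<subseteq> orth_compl (wspan UNIV M)"
    by (intro wspan_minimal closed_csubspace_orth_compl) blast
  then show ?thesis by (auto simp: orthogonal_sets_def orth_compl_def)
qed

text \<open>As \<open>S(\<xi>)^* S(\<eta>)\<close> acts through \<rho>, the spaces
  \<open>[S(E)M1]\<close> and \<open>[S(E)M2]\<close> are orthogonal. Together they fill
  \<open>sspan N\<close>, so a vector orthogonal to the second lies in the first.\<close>

lemma sspan_orth_part:
  assumes rho: "rho_inv M1" and orth: "orthogonal_sets M1 M2"
    and N: "\<And>h. h \<in> N \<Longrightarrow> \<exists>h1\<in>M1. \<exists>h2\<in>M2. h = h1 + h2" and M1N: "M1 \<subseteq> N"
    and k: "k \<in> sspan N" "\<And>\<xi> h. h \<in> M2 \<Longrightarrow> cinner k (S \<xi> h) = 0"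
  shows "k \<in> sspan M1"
proof -
  let ?q = "orth_proj (sspan M1) k"
  note q = orth_proj_mem[OF closed_sspan, of M1 k] orth_proj_compl[OF closed_sspan, of k M1]
  have q2: "?q \<in> orth_compl {S \<xi> h |\<xi> h. h \<in> M2}"
  proof -
    have "sspan M1 \<subseteq> orth_compl {S \<xi> h |\<xi> h. h \<in> M2}"
    proof (rule sspan_minimal[OF closed_csubspace_orth_compl])
      fix \<eta> h assume h: "h \<in> M1"
      have "cinner (S \<xi> k) (S \<eta> h) = 0" if "k \<in> M2" for \<xi> k
      proof -
        have "cinner (\<rho> (ip \<xi> \<eta>) h) k = 0"
          using h that rho orth by (auto simp: rho_inv_def orthogonal_sets_def)
        then show ?thesis using cinner_commute[of k] by (simp add: S_adj S_isom)
      qed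
      then show "S \<eta> h \<in> orth_compl {S \<xi> h |\<xi> h. h \<in> M2}" by (auto simp: orth_compl_def)
    qed
    then show ?thesis using q(1) by blast
  qed
  have k2: "k \<in> orth_compl {S \<xi> h |\<xi> h. h \<in> M2}"
    using k(2) cinner_commute[of _ k] by (auto simp: orth_compl_def)
  have r: "k - ?q \<in> orth_compl {S \<xi> h |\<xi> h. h \<in> M2}"
    using k2 q2 by (intro csubspace_diff orth_compl_csubspace)
  have "sspan N \<subseteq> orth_compl {k - ?q}"
  proof (rule sspan_minimal[OF closed_csubspace_orth_compl])
    fix \<xi> h assume "h \<in> N"
    then obtain h1 h2 where h: "h1 \<in> M1" "h2 \<in> M2" "h = h1 + h2" using N by blast
    have "cinner (k - ?q) (S \<xi> h1) = 0"
      using cinner_orth_compl'[OF q(2) sspan_base[OF h(1)]] .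
    moreover have "cinner (k - ?q) (S \<xi> h2) = 0"
      using cinner_orth_compl'[OF r] h(2) by blast
    ultimately show "S \<xi> h \<in> orth_compl {k - ?q}"
      by (simp add: orth_compl_def h(3) bop_add[OF S_bop] cinner_add_right)
  qed
  moreover have "k - ?q \<in> sspan N"
    using k(1) q(1) sspan_mono[OF M1N] closed_sspan[of N]
    by (auto simp: closed_csubspace_def intro: csubspace_diff)
  ultimately have "cinner (k - ?q) (k - ?q) = 0" by (auto simp: orth_compl_def)
  then have "k - ?q = 0" by (simp only: cinner_eq_zero_iff)
  then show ?thesis using q(1) by simp
qed

text \<open>Coinvariance makes \<open>M\<close> orthogonal to \<open>S(E)\<close> applied to its
  complement, so only \<open>[S(E)M]\<close> remains. In this way the fullness of \<open>V\<close>
  is inherited by all its coinvariant subspaces.\<close>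

lemma coinv_subset_sspan:
  assumes M: "coinv M" and full: "M \<subseteq> sspan UNIV"
  shows "M \<subseteq> sspan M"
proof
  fix k assume k: "k \<in> M"
  show "k \<in> sspan M"
  proof (rule sspan_orth_part[where N = UNIV and ?M2.0 = "orth_compl M"])
    show "orthogonal_sets M (orth_compl M)" by (auto simp: orthogonal_sets_def orth_compl_def)
    show "\<exists>h1\<in>M. \<exists>h2\<in>orth_compl M. h = h1 + h2" for h
      using orth_proj_mem[OF coinvD(1)[OF M], of h] orth_proj_compl[OF coinvD(1)[OF M], of h]
      by (intro bexI[of _ "orth_proj M h"] bexI[of _ "h - orth_proj M h"]) auto
    show "cinner k (S \<xi> h) = 0" if "h \<in> orth_compl M" for \<xi> h
      using that coinvD(5)[OF M k] by (simp add: S_adj' orth_compl_def)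
  qed (use k full coinvD(3)[OF M] in auto)
qed

definition minimal_coinv :: "'h set \<Rightarrow> bool" where
  "minimal_coinv Z \<longleftrightarrow> coinv Z \<and> Z \<noteq> {0} \<and> (\<forall>N. coinv N \<and> N \<subseteq> Z \<and> N \<noteq> {0} \<longrightarrow> N = Z)"

lemma minimal_coinv_Int:
  assumes "minimal_coinv Z" "coinv M" "M \<inter> Z \<noteq> {0}"
  shows "Z \<subseteq> M"
  using assms coinv_Int[of M Z] unfolding minimal_coinv_def by blast

lemma minimal_coinv_exists:
  assumes "finite_dim M" "coinv M" "M \<noteq> {0}"
  shows "\<exists>Z\<subseteq>M. minimal_coinv Z"
  using assms
proof (induction rule: finite_dim_psubset_induct)
  case (less M)
  show ?case
  proof (cases "minimal_coinv M")
    case False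
    then obtain N where "coinv N" "N \<subseteq> M" "N \<noteq> {0}" "N \<noteq> M"
      using less.prems by (auto simp: minimal_coinv_def)
    then show ?thesis using less.IH[of N] coinvD(2) by blast
  qed blast
qed

text \<open>By the angle argument \<open>Z\<close> meets \<open>M\<close>, and a minimal subspace
  that meets \<open>M\<close> lies in it.\<close>

lemma minimal_coinv_subset:
  assumes M: "finite_dim M" "coinv M" "M \<subseteq> sspan UNIV"
    and Z: "minimal_coinv Z" "Z \<subseteq> wspan UNIV M"
  shows "Z \<subseteq> M"
proof (rule minimal_coinv_Int[OF Z(1) M(2)])
  have "coinv Z" "Z \<noteq> {0}" using Z(1) by (auto simp: minimal_coinv_def)
  then obtain z where z: "z \<in> Z" "z \<noteq> 0"
    using csubspace_0[OF coinvD(2)] by blast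
  show "M \<inter> Z \<noteq> {0}"
    by (rule finite_dim_meets_coinv[OF M(1) coinvD(3)[OF M(2)] coinv_subset_sspan[OF M(2,3)] \<open>coinv Z\<close>])
       (use z Z(2) in auto)
qed

text \<open>The finite dimensional \<open>W\<close> around both summands guarantees that the
  algebraic sum is closed.\<close>

lemma coinv_sum:
  assumes "coinv M" "coinv N" "finite_dim W" "M \<subseteq> W" "N \<subseteq> W"
  shows "coinv {x + y |x y. x \<in> M \<and> y \<in> N}"
proof (rule coinvI)
  let ?K = "{x + y |x y. x \<in> M \<and> y \<in> N}"
  have K: "csubspace ?K"
    by (rule complex_vector.subspace_sums) (use coinvD(2) assms in blast)+
  have "csubspace W" using closed_csubspace_finite_dim[OF assms(3)] by (simp add: closed_csubspace_def)
  then have "?K \<subseteq> W" using assms csubspace_add by blast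
  then show "closed_csubspace ?K"
    using finite_dim_subspace[OF assms(3) K] closed_csubspace_finite_dim by blast
  show "\<rho> a h \<in> ?K" if "h \<in> ?K" for a h
    using that coinvD(4)[OF assms(1)] coinvD(4)[OF assms(2)] bop_add[OF rho_bop] by blast
  show "Sa \<xi> h \<in> ?K" if "h \<in> ?K" for \<xi> h
    using that coinvD(5)[OF assms(1)] coinvD(5)[OF assms(2)] bop_add[OF Sa_bop] by blast
qed

text \<open>The complement is the part of \<open>W\<close> in the complement of the reducing subspace generated by \<open>U\<close>.\<close>

lemma coinv_complement:
  assumes W: "finite_dim W" "coinv W" "W \<subseteq> sspan UNIV"
    and minimal: "\<And>Z. Z \<in> \<Z> \<Longrightarrow> minimal_coinv Z" "\<And>Z. Z \<in> \<Z> \<Longrightarrow> Z \<subseteq> W"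
    and gen: "\<And>M. coinv M \<Longrightarrow> (\<And>Z. Z \<in> \<Z> \<Longrightarrow> Z \<subseteq> M) \<Longrightarrow> W \<subseteq> M"
    and U: "coinv U" "U \<subseteq> W"
  shows "coinv (W \<inter> orth_compl U)"
proof -
  define U' where "U' = W \<inter> orth_compl (wspan UNIV U)"
  have U': "coinv U'" unfolding U'_def by (intro coinv_Int W coinv_orth_compl_wspan)
  \<comment> \<open>The goal is \<open>W \<subseteq> M\<close>; then \<open>U'\<close> is the whole
    orthogonal complement of \<open>U\<close> in \<open>W\<close>.\<close>
  define M where "M = {x + y |x y. x \<in> U \<and> y \<in> U'}"
  have M: "coinv M"
    unfolding M_def by (rule coinv_sum[OF U(1) U' W(1) U(2)]) (auto simp: U'_def)
  have MW: "M \<subseteq> W"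
    using U(2) csubspace_add[OF coinvD(2)[OF W(2)]] unfolding M_def U'_def by blast
  have UM: "U \<subseteq> M" "U' \<subseteq> M"
    using csubspace_0[OF coinvD(2)[OF U']] csubspace_0[OF coinvD(2)[OF U(1)]]
    unfolding M_def by force+
  have fin: "finite_dim M" by (rule finite_dim_subspace[OF W(1) coinvD(2)[OF M] MW])
  \<comment> \<open>\<open>K\<close> measures what \<open>M\<close> fails to generate. If nonzero,
    it meets \<open>W\<close>. A common vector is orthogonal to everything generated by
    \<open>U\<close>, so it lies in \<open>U'\<close>, hence in \<open>M\<close>, and is orthogonal
    to itself.\<close>
  define K where "K = wspan UNIV W \<inter> orth_compl (wspan UNIV M)"
  have K: "coinv K" unfolding K_def by (intro coinv_Int coinv_wspan_UNIV W coinv_orth_compl_wspan)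
  have "K = {0}"
  proof (rule ccontr)
    assume "K \<noteq> {0}"
    then obtain z where z: "z \<in> K" "z \<noteq> 0" using csubspace_0[OF coinvD(2)[OF K]] by blast
    have "W \<inter> K \<noteq> {0}"
      by (rule finite_dim_meets_coinv[OF W(1) coinvD(3)[OF W(2)] coinv_subset_sspan[OF W(2,3)] K z(1)])
         (use z in \<open>auto simp: K_def\<close>)
    then obtain w where w: "w \<in> W" "w \<in> K" "w \<noteq> 0"
      using csubspace_0[OF coinvD(2)[OF K]] csubspace_0[OF coinvD(2)[OF W(2)]] by blast
    have "w \<in> orth_compl (wspan UNIV U)"
      using w(2) wspan_mono[OF UM(1), of UNIV] unfolding K_def orth_compl_def by blast
    then have "w \<in> wspan UNIV M" using w(1) UM(2) subset_wspan_UNIV unfolding U'_def by blast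
    then show False using w(2,3) orth_compl_memD unfolding K_def by blast
  qed
  have "wspan UNIV W \<subseteq> wspan UNIV M"
  proof
    fix h assume h: "h \<in> wspan UNIV W"
    let ?r = "h - orth_proj (wspan UNIV M) h"
    have "orth_proj (wspan UNIV M) h \<in> wspan UNIV W"
      using orth_proj_mem[OF closed_wspan] wspan_mono[OF MW] by blast
    then have "?r \<in> K" unfolding K_def
      using h orth_proj_compl[OF closed_wspan] closed_wspan[of UNIV W]
      by (auto simp: closed_csubspace_def intro: csubspace_diff)
    then have "h = orth_proj (wspan UNIV M) h" using \<open>K = {0}\<close> by simp
    then show "h \<in> wspan UNIV M" using orth_proj_mem[OF closed_wspan] by metis
  qed
  \<comment> \<open>Each minimal \<open>Z\<close> lies in the space generated by \<open>M\<close>,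
    hence in \<open>M\<close> itself; then \<open>gen\<close> captures \<open>W\<close>.\<close>
  then have "Z \<subseteq> M" if "Z \<in> \<Z>" for Z
    using minimal_coinv_subset[OF fin M _ minimal(1)[OF that]] minimal(2)[OF that] subset_wspan_UNIV W(3) MW by blast
  then have WM: "W \<subseteq> M" by (rule gen[OF M])
  have "W \<inter> orth_compl U = U'"
  proof
    show U'U: "U' \<subseteq> W \<inter> orth_compl U"
      using subset_wspan_UNIV unfolding U'_def orth_compl_def by blast
    show "W \<inter> orth_compl U \<subseteq> U'"
    proof
      fix w assume w: "w \<in> W \<inter> orth_compl U"
      then obtain u u' where u: "u \<in> U" "u' \<in> U'" "w = u + u'" using WM unfolding M_def by blast
      have "u' \<in> orth_compl U" using u(2) U'U by blast
      then have "cinner u u = 0"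
        using w u cinner_add_right[of u u u'] by (auto simp: orth_compl_def)
      then show "w \<in> U'" using u by simp
    qed
  qed
  then show ?thesis using U' by simp
qed

end

section \<open>Square summable sequences\<close>

text \<open>The space \<open>\<H> \<otimes> \<ell>^2\<close>. It contains every finite direct sum of
  copies of \<open>\<H>\<close>, so the number of copies can be a variable although it does not
  appear in the type.\<close>

typedef (overloaded) ('h::complex_hilbert) ell2 = "{f :: nat \<Rightarrow> 'h. summable (\<lambda>i. (norm (f i))\<^sup>2)}"
  morphisms coord Abs_ell2
  by (rule exI[of _ "\<lambda>_. 0"]) simp

setup_lifting type_definition_ell2

lemma summable_coord: "summable (\<lambda>i. (norm (coord x i))\<^sup>2)"
  using coord[of x] by simp

lemma ell2_eqI: "(\<And>i. coord x i = coord y i) \<Longrightarrow> x = y"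
  by (metis coord_inject ext)

lemma norm_add_square_le: "(norm (x + y))\<^sup>2 \<le> 2 * (norm x)\<^sup>2 + 2 * (norm (y :: 'h::real_normed_vector))\<^sup>2"
proof -
  have "(norm (x + y))\<^sup>2 \<le> (norm x + norm y)\<^sup>2" by (intro power_mono norm_triangle_ineq) simp
  also have "\<dots> \<le> 2 * (norm x)\<^sup>2 + 2 * (norm y)\<^sup>2"
    using sum_squares_bound[of "norm x" "norm y"] by (simp add: power2_sum)
  finally show ?thesis .
qed

lemma square_summable_add:
  fixes f g :: "nat \<Rightarrow> 'h::real_normed_vector"
  assumes "summable (\<lambda>i. (norm (f i))\<^sup>2)" "summable (\<lambda>i. (norm (g i))\<^sup>2)"
  shows "summable (\<lambda>i. (norm (f i + g i))\<^sup>2)"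
proof (rule summable_comparison_test')
  show "summable (\<lambda>i. 2 * (norm (f i))\<^sup>2 + 2 * (norm (g i))\<^sup>2)"
    using assms by (intro summable_add summable_mult)
  show "norm ((norm (f n + g n))\<^sup>2) \<le> 2 * (norm (f n))\<^sup>2 + 2 * (norm (g n))\<^sup>2" if "n \<ge> 0" for n
    using norm_add_square_le by simp
qed

lemma square_summable_bounded:
  fixes f :: "nat \<Rightarrow> 'h::real_normed_vector" and g :: "nat \<Rightarrow> 'k::real_normed_vector"
  assumes "summable (\<lambda>i. (norm (f i))\<^sup>2)" "\<And>i. norm (g i) \<le> K * norm (f i)"
  shows "summable (\<lambda>i. (norm (g i))\<^sup>2)"
proof (rule summable_comparison_test')
  show "summable (\<lambda>i. K\<^sup>2 * (norm (f i))\<^sup>2)" using assms(1) by (rule summable_mult)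
  show "norm ((norm (g n))\<^sup>2) \<le> K\<^sup>2 * (norm (f n))\<^sup>2" if "n \<ge> 0" for n
    using power_mono[OF assms(2)[of n], of 2] by (simp add: power_mult_distrib)
qed

instantiation ell2 :: (complex_hilbert) complex_vector
begin

lift_definition zero_ell2 :: "'a ell2" is "\<lambda>_. 0" by simp

lift_definition plus_ell2 :: "'a ell2 \<Rightarrow> 'a ell2 \<Rightarrow> 'a ell2" is "\<lambda>f g i. f i + g i"
  by (rule square_summable_add)

lift_definition uminus_ell2 :: "'a ell2 \<Rightarrow> 'a ell2" is "\<lambda>f i. - f i" by simp

lift_definition minus_ell2 :: "'a ell2 \<Rightarrow> 'a ell2 \<Rightarrow> 'a ell2" is "\<lambda>f g i. f i - g i"
  using square_summable_add[of _ "\<lambda>i. - _ i"] by fastforce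

lift_definition scaleR_ell2 :: "real \<Rightarrow> 'a ell2 \<Rightarrow> 'a ell2" is "\<lambda>r f i. r *\<^sub>R f i"
proof -
  fix r :: real and f :: "nat \<Rightarrow> 'a"
  assume "summable (\<lambda>i. (norm (f i))\<^sup>2)"
  then show "summable (\<lambda>i. (norm (r *\<^sub>R f i))\<^sup>2)"
    by (rule square_summable_bounded[where K = "\<bar>r\<bar>"]) simp
qed

lift_definition scaleC_ell2 :: "complex \<Rightarrow> 'a ell2 \<Rightarrow> 'a ell2" is "\<lambda>c f i. scaleC c (f i)"
proof -
  fix c :: complex and f :: "nat \<Rightarrow> 'a"
  assume "summable (\<lambda>i. (norm (f i))\<^sup>2)"
  then show "summable (\<lambda>i. (norm (scaleC c (f i)))\<^sup>2)"
    by (rule square_summable_bounded[where K = "cmod c"]) (simp add: norm_scaleC_hilbert)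
qed

instance
  by standard
     (transfer, simp add: fun_eq_iff scaleR_add_right scaleR_add_left scaleC_add_right
       scaleC_add_left scaleC_scaleC scaleC_of_real add.assoc add.commute)+

end

lemma coord_simps [simp]:
  "coord 0 i = 0" "coord (x + y) i = coord x i + coord y i" "coord (- x) i = - coord x i"
  "coord (x - y) i = coord x i - coord y i" "coord (r *\<^sub>R x) i = r *\<^sub>R coord x i"
  "coord (scaleC c x) i = scaleC c (coord x i)"
  by (transfer; simp)+

lemma coord_sum: "coord (\<Sum>j\<in>J. f j) i = (\<Sum>j\<in>J. coord (f j) i)"
  by (induction J rule: infinite_finite_induct) auto

lemma summable_cmod_cinner_coord: "summable (\<lambda>i. cmod (cinner (coord x i) (coord y i)))"
proof (rule summable_comparison_test')
  show "summable (\<lambda>i. (norm (coord x i))\<^sup>2 + (norm (coord y i))\<^sup>2)"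
    by (intro summable_add summable_coord)
  fix n :: nat
  have "norm (coord x n) * norm (coord y n) \<le> (norm (coord x n))\<^sup>2 + (norm (coord y n))\<^sup>2"
    using sum_squares_bound[of "norm (coord x n)" "norm (coord y n)"]
      mult_nonneg_nonneg[OF norm_ge_zero[of "coord x n"] norm_ge_zero[of "coord y n"]] by linarith
  then show "norm (cmod (cinner (coord x n) (coord y n))) \<le> (norm (coord x n))\<^sup>2 + (norm (coord y n))\<^sup>2"
    using order.trans[OF cmod_cinner_le] by simp
qed

lemma summable_cinner_coord: "summable (\<lambda>i. cinner (coord x i) (coord y i))"
  by (rule summable_norm_cancel) (rule summable_cmod_cinner_coord)

lemma summable_inner_coord: "summable (\<lambda>i. inner (coord x i) (coord y i))"
  unfolding inner_eq_Re_cinner by (rule summable_Re) (rule summable_cinner_coord)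

instantiation ell2 :: (complex_hilbert) real_inner
begin

definition inner_ell2 :: "'a ell2 \<Rightarrow> 'a ell2 \<Rightarrow> real" where
  "inner_ell2 x y = (\<Sum>i. inner (coord x i) (coord y i))"

definition norm_ell2 :: "'a ell2 \<Rightarrow> real" where "norm_ell2 x = sqrt (inner x x)"

definition dist_ell2 :: "'a ell2 \<Rightarrow> 'a ell2 \<Rightarrow> real" where "dist_ell2 x y = norm (x - y)"

definition sgn_ell2 :: "'a ell2 \<Rightarrow> 'a ell2" where "sgn_ell2 x = x /\<^sub>R norm x"

definition uniformity_ell2 :: "('a ell2 \<times> 'a ell2) filter" where
  "uniformity_ell2 = (INF e\<in>{0<..}. principal {(x, y). dist x y < e})"

definition open_ell2 :: "'a ell2 set \<Rightarrow> bool" where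
  "open_ell2 U = (\<forall>x\<in>U. \<forall>\<^sub>F (x', y) in uniformity. x' = x \<longrightarrow> y \<in> U)"

instance
proof
  fix x y z :: "'a ell2" and r :: real
  show "inner x y = inner y x" by (simp add: inner_ell2_def inner_commute)
  show "inner (x + y) z = inner x z + inner y z"
    by (simp add: inner_ell2_def inner_add_left suminf_add summable_inner_coord)
  show "inner (r *\<^sub>R x) y = r * inner x y"
    by (simp add: inner_ell2_def suminf_mult summable_inner_coord)
  show "0 \<le> inner x x"
    unfolding inner_ell2_def by (intro suminf_nonneg summable_inner_coord) simp
  show "(inner x x = 0) = (x = 0)"
  proof
    assume "inner x x = 0"
    then have "\<forall>i. inner (coord x i) (coord x i) = 0"
      unfolding inner_ell2_def by (subst (asm) suminf_eq_zero_iff[OF summable_inner_coord]) auto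
    then show "x = 0" by (intro ell2_eqI) simp
  qed (simp add: inner_ell2_def)
qed (simp_all add: dist_ell2_def sgn_ell2_def norm_ell2_def uniformity_ell2_def open_ell2_def)

end

lemma norm_ell2_square: "(norm x)\<^sup>2 = (\<Sum>i. (norm (coord x i))\<^sup>2)"
  by (simp add: power2_norm_eq_inner inner_ell2_def)

lemma sum_norm_coord_le: "(\<Sum>i<k. (norm (coord x i))\<^sup>2) \<le> (norm x)\<^sup>2"
  unfolding norm_ell2_square by (rule sum_le_suminf) (auto intro: summable_coord)

lemma norm_coord_le: "norm (coord x i) \<le> norm x"
proof -
  have "(norm (coord x i))\<^sup>2 \<le> (\<Sum>j<Suc i. (norm (coord x j))\<^sup>2)"
    by (rule member_le_sum) auto
  also have "\<dots> \<le> (norm x)\<^sup>2" by (rule sum_norm_coord_le)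
  finally show ?thesis by (rule power2_le_imp_le) simp
qed

instance ell2 :: (complex_hilbert) complete_space
proof
  fix X :: "nat \<Rightarrow> 'a ell2" assume X: "Cauchy X"
  have "Cauchy (\<lambda>n. coord (X n) i)" for i
  proof (rule metric_CauchyI)
    fix e :: real assume "e > 0"
    then obtain N where N: "\<And>m n. m \<ge> N \<Longrightarrow> n \<ge> N \<Longrightarrow> dist (X m) (X n) < e"
      using metric_CauchyD[OF X] by blast
    have "dist (coord (X m) i) (coord (X n) i) \<le> dist (X m) (X n)" for m n
      using norm_coord_le[of "X m - X n" i] by (simp add: dist_norm)
    then show "\<exists>N. \<forall>m\<ge>N. \<forall>n\<ge>N. dist (coord (X m) i) (coord (X n) i) < e"
      using N le_less_trans by blast
  qed
  then have "\<exists>l. (\<lambda>n. coord (X n) i) \<longlonglongrightarrow> l" for i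
    by (simp add: Cauchy_convergent_iff convergent_def)
  then obtain f where f: "\<And>i. (\<lambda>n. coord (X n) i) \<longlonglongrightarrow> f i" by metis
  \<comment> \<open>For a fixed number \<open>k\<close> of coordinates the Cauchy bound passes to
    the limit in \<open>n\<close>; the bound obtained does not depend on \<open>k\<close>.\<close>
  have tail: "\<exists>N. \<forall>m\<ge>N. \<forall>k. (\<Sum>i<k. (norm (coord (X m) i - f i))\<^sup>2) \<le> e\<^sup>2" if "e > 0" for e
  proof -
    obtain N where N: "\<And>m n. m \<ge> N \<Longrightarrow> n \<ge> N \<Longrightarrow> dist (X m) (X n) < e"
      using metric_CauchyD[OF X \<open>e > 0\<close>] by blast
    have "(\<Sum>i<k. (norm (coord (X m) i - f i))\<^sup>2) \<le> e\<^sup>2" if m: "m \<ge> N" for m k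
    proof (rule LIMSEQ_le_const2)
      show "(\<lambda>n. \<Sum>i<k. (norm (coord (X m) i - coord (X n) i))\<^sup>2)
          \<longlonglongrightarrow> (\<Sum>i<k. (norm (coord (X m) i - f i))\<^sup>2)"
        by (intro tendsto_intros f)
      show "\<exists>N. \<forall>n\<ge>N. (\<Sum>i<k. (norm (coord (X m) i - coord (X n) i))\<^sup>2) \<le> e\<^sup>2"
      proof (intro exI allI impI)
        fix n assume "n \<ge> N"
        then have "(norm (X m - X n))\<^sup>2 \<le> e\<^sup>2"
          using N[OF m, of n] by (intro power_mono) (auto simp: dist_norm)
        then show "(\<Sum>i<k. (norm (coord (X m) i - coord (X n) i))\<^sup>2) \<le> e\<^sup>2"
          using sum_norm_coord_le[where x = "X m - X n" and k = k] by simp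
      qed
    qed
    then show ?thesis by blast
  qed
  have diff: "summable (\<lambda>i. (norm (coord (X m) i - f i))\<^sup>2)"
    if "\<forall>k. (\<Sum>i<k. (norm (coord (X m) i - f i))\<^sup>2) \<le> e\<^sup>2" for m and e :: real
    by (rule summableI_nonneg_bounded[where x = "e\<^sup>2"]) (use that in auto)
  \<comment> \<open>Up to sign, \<open>f\<close> is the sum of the negative of one member of the
    sequence and a square summable error.\<close>
  have "summable (\<lambda>i. (norm (f i))\<^sup>2)"
  proof -
    obtain N where "\<forall>k. (\<Sum>i<k. (norm (coord (X N) i - f i))\<^sup>2) \<le> 1\<^sup>2" using tail[of 1] by auto
    from square_summable_add[OF summable_coord[of "- X N"] diff[OF this]]
    show ?thesis by simp
  qed
  then have cf: "coord (Abs_ell2 f) = f" by (simp add: Abs_ell2_inverse)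
  have "X \<longlonglongrightarrow> Abs_ell2 f"
  proof (rule metric_LIMSEQ_I)
    fix e :: real assume "e > 0"
    then obtain N where N: "\<And>m k. m \<ge> N \<Longrightarrow> (\<Sum>i<k. (norm (coord (X m) i - f i))\<^sup>2) \<le> (e/2)\<^sup>2"
      using tail[of "e/2"] by auto
    have "dist (X m) (Abs_ell2 f) < e" if "m \<ge> N" for m
    proof -
      have "(norm (X m - Abs_ell2 f))\<^sup>2 \<le> (e/2)\<^sup>2"
        unfolding norm_ell2_square
        by (rule suminf_le_const[OF summable_coord]) (use N[OF that] cf in simp)
      then have "norm (X m - Abs_ell2 f) \<le> e/2" by (rule power2_le_imp_le) (use \<open>e > 0\<close> in simp)
      then show ?thesis using \<open>e > 0\<close> by (simp add: dist_norm)
    qed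
    then show "\<exists>N. \<forall>n\<ge>N. dist (X n) (Abs_ell2 f) < e" by blast
  qed
  then show "convergent X" by (auto simp: convergent_def)
qed

instantiation ell2 :: (complex_hilbert) complex_hilbert
begin

definition cinner_ell2 :: "'a ell2 \<Rightarrow> 'a ell2 \<Rightarrow> complex" where
  "cinner_ell2 x y = (\<Sum>i. cinner (coord x i) (coord y i))"

instance
proof
  fix x y z :: "'a ell2" and c :: complex
  show "cinner x y = cnj (cinner y x)"
    unfolding cinner_ell2_def
    by (subst cinner_commute)
       (metis (mono_tags) bounded_linear.suminf[OF bounded_linear_cnj summable_cinner_coord])
  show "cinner x (y + z) = cinner x y + cinner x z"
    by (simp add: cinner_ell2_def cinner_add_right suminf_add summable_cinner_coord)
  show "cinner x (scaleC c y) = c * cinner x y"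
    by (simp add: cinner_ell2_def cinner_scaleC_right suminf_mult summable_cinner_coord)
  show "inner x y = Re (cinner x y)"
    by (simp add: inner_ell2_def cinner_ell2_def inner_eq_Re_cinner Re_suminf summable_cinner_coord)
qed

end

section \<open>Finitely supported sequences and amplified operators\<close>

definition fin_tuple :: "nat \<Rightarrow> (nat \<Rightarrow> 'h) \<Rightarrow> 'h::complex_hilbert ell2" where
  "fin_tuple d f = Abs_ell2 (\<lambda>i. if i < d then f i else 0)"

lemma coord_fin_tuple [simp]: "coord (fin_tuple d f) i = (if i < d then f i else 0)"
proof -
  have "summable (\<lambda>i. (norm (if i < d then f i else 0))\<^sup>2)"
    by (rule summable_finite[of "{..<d}"]) auto
  then show ?thesis by (simp add: fin_tuple_def Abs_ell2_inverse)
qed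

definition single :: "nat \<Rightarrow> 'h \<Rightarrow> 'h::complex_hilbert ell2" where
  "single i h = fin_tuple (Suc i) (\<lambda>j. if j = i then h else 0)"

lemma coord_single [simp]: "coord (single i h) j = (if j = i then h else 0)"
  by (auto simp: single_def)

lemma cinner_fin_support:
  assumes "\<And>i. i \<ge> d \<Longrightarrow> coord y i = 0"
  shows "cinner x y = (\<Sum>i<d. cinner (coord x i) (coord y i))"
  unfolding cinner_ell2_def by (rule suminf_finite) (use assms in auto)

lemma norm_single [simp]: "norm (single i h) = norm h"
proof -
  have "(norm (single i h))\<^sup>2 = (\<Sum>j\<in>{i}. (norm (coord (single i h) j))\<^sup>2)"
    unfolding norm_ell2_square by (rule suminf_finite) auto
  then show ?thesis by simp
qed

lemma single_add: "single i (h + k) = single i h + single i k"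
  by (rule ell2_eqI) simp

lemma single_scaleC: "single i (scaleC c h) = scaleC c (single i h)"
  by (rule ell2_eqI) simp

lemma single_zero [simp]: "single i 0 = 0"
  by (rule ell2_eqI) simp

lemma bounded_linear_single: "bounded_linear (single i)"
  by (rule bounded_linear_intro[where K = 1])
     (simp_all add: single_add single_scaleC flip: scaleC_of_real)

lemma sum_single: "(\<And>i. i \<ge> d \<Longrightarrow> coord v i = 0) \<Longrightarrow> v = (\<Sum>i<d. single i (coord v i))"
  by (rule ell2_eqI) (simp add: coord_sum sum.delta not_less)

lemma norm_fin_tuple_le: "norm (fin_tuple d f) \<le> (\<Sum>i<d. norm (f i))"
proof -
  have "fin_tuple d f = (\<Sum>i<d. single i (f i))"
    using sum_single[of d "fin_tuple d f"] by simp
  then show ?thesis using norm_sum[of "\<lambda>i. single i (f i)" "{..<d}"] by simp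
qed

lemma closed_csubspace_single_vimage:
  assumes "closed_csubspace N"
  shows "closed_csubspace {h. single i h \<in> N}"
proof -
  have "csubspace {h. single i h \<in> N}"
    using assms by (intro csubspaceI)
      (auto simp: closed_csubspace_def single_add single_scaleC csubspace_0
        csubspace_add csubspace_scale)
  moreover have "closed (single i -` N)"
    by (rule closed_vimage)
       (use assms in \<open>auto simp: closed_csubspace_def intro: linear_continuous_on bounded_linear_single\<close>)
  ultimately show ?thesis by (simp add: closed_csubspace_def vimage_def)
qed

text \<open>The operator \<open>T \<otimes> I\<close>; boundedness of \<open>T\<close> keeps the
  sequence square summable.\<close>

definition amp :: "('h \<Rightarrow> 'h) \<Rightarrow> 'h::complex_hilbert ell2 \<Rightarrow> 'h ell2" where
  "amp T x = Abs_ell2 (\<lambda>i. T (coord x i))"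

lemma coord_amp [simp]:
  assumes "T \<in> bounded_ops UNIV"
  shows "coord (amp T x) i = T (coord x i)"
proof -
  obtain K where "\<And>h. norm (T h) \<le> K * norm h" using bop_bounded_pos[OF assms] by blast
  then have "summable (\<lambda>i. (norm (T (coord x i)))\<^sup>2)"
    by (rule square_summable_bounded[OF summable_coord])
  then show ?thesis by (simp add: amp_def Abs_ell2_inverse)
qed

lemma amp_bop:
  assumes T: "T \<in> bounded_ops UNIV"
  shows "amp T \<in> bounded_ops UNIV"
proof -
  obtain K where K: "K \<ge> 0" "\<And>h. norm (T h) \<le> K * norm h" using bop_bounded_pos[OF T] by blast
  have "norm (amp T x) \<le> K * norm x" for x
  proof -
    have "(norm (amp T x))\<^sup>2 \<le> (\<Sum>i. K\<^sup>2 * (norm (coord x i))\<^sup>2)"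
      unfolding norm_ell2_square
    proof (rule suminf_le)
      show "(norm (coord (amp T x) i))\<^sup>2 \<le> K\<^sup>2 * (norm (coord x i))\<^sup>2" for i
        using power_mono[OF K(2)[of "coord x i"], of 2] T by (simp add: power_mult_distrib)
    qed (intro summable_coord summable_mult)+
    also have "\<dots> = (K * norm x)\<^sup>2"
      by (simp add: suminf_mult[OF summable_coord] power_mult_distrib norm_ell2_square)
    finally show ?thesis by (rule power2_le_imp_le) (use K in simp)
  qed
  then show ?thesis unfolding bounded_ops_UNIV_iff
    using T by (auto intro!: ell2_eqI simp: bop_add bop_scaleC)
qed

lemma cinner_amp:
  assumes "T \<in> bounded_ops UNIV" "R \<in> bounded_ops UNIV" "\<And>h k. cinner (T h) k = cinner h (R k)"
  shows "cinner (amp T x) y = cinner x (amp R y)"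
  using assms by (simp add: cinner_ell2_def)

context isometric_system
begin

lemma isometric_system_amp:
  "isometric_system (\<lambda>\<xi>. amp (S \<xi>)) (\<lambda>\<xi>. amp (Sa \<xi>)) (\<lambda>a. amp (\<rho> a)) lact ip"
  by standard
     (auto intro!: amp_bop S_bop Sa_bop rho_bop cinner_amp S_adj rho_adj ell2_eqI
       simp: S_bop Sa_bop rho_bop rho_mult rho_one rho_zero S_lact S_isom)

end

section \<open>The generated algebra\<close>

abbreviation adj :: "('h::complex_hilbert \<Rightarrow> 'h) \<Rightarrow> 'h \<Rightarrow> 'h" where
  "adj \<equiv> adjoint_on UNIV"

section \<open>Rules for adjoints\<close>

lemma adj_eqI:
  "R \<in> bounded_ops UNIV \<Longrightarrow> (\<And>x y. cinner (T x) y = cinner x (R y)) \<Longrightarrow> adj T = R"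
  by (rule adjoint_on_eqI) auto

lemma adj_id: "adj (\<lambda>x. x) = (\<lambda>x. x)"
  by (rule adj_eqI) auto

lemma adj_add:
  assumes "S \<in> bounded_ops UNIV" "T \<in> bounded_ops UNIV"
  shows "adj (\<lambda>x. S x + T x) = (\<lambda>x. adj S x + adj T x)"
  by (rule adj_eqI)
     (use bounded_ops_op_add[of UNIV "adj S" "adj T"] assms in
       \<open>auto simp: bop_adjoint cinner_add_left cinner_add_right cinner_adjoint\<close>)

lemma adj_scaleC:
  assumes "T \<in> bounded_ops UNIV"
  shows "adj (\<lambda>x. scaleC c (T x)) = (\<lambda>x. scaleC (cnj c) (adj T x))"
  by (rule adj_eqI)
     (use bounded_ops_op_scale[of UNIV "adj T" "cnj c"] assms in
       \<open>auto simp: bop_adjoint cinner_scaleC_left cinner_scaleC_right cinner_adjoint\<close>)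

lemma adj_compose:
  assumes "S \<in> bounded_ops UNIV" "T \<in> bounded_ops UNIV"
  shows "adj (\<lambda>x. S (T x)) = (\<lambda>x. adj T (adj S x))"
  by (rule adj_eqI) (auto simp: assms bop_adjoint bop_compose cinner_adjoint)

context isometric_system
begin

definition alg :: "('h \<Rightarrow> 'h) set" where
  "alg = generated_algebra UNIV (range S \<union> range \<rho>)"

lemma alg_bop: "T \<in> alg \<Longrightarrow> T \<in> bounded_ops UNIV"
  unfolding alg_def
  by (rule generated_algebra_bounded[of UNIV "range S \<union> range \<rho>"]) (auto simp: S_bop rho_bop)

lemma adj_S: "adj (S \<xi>) = Sa \<xi>"
  by (rule adj_eqI) (simp_all add: Sa_bop S_adj)

lemma adj_rho: "adj (\<rho> a) = \<rho> (cstar a)"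
  by (rule adj_eqI) (simp_all add: rho_bop rho_adj)

lemma alg_intros:
  "(\<lambda>x. x) \<in> alg" "S \<xi> \<in> alg" "\<rho> a \<in> alg"
  "T \<in> alg \<Longrightarrow> R \<in> alg \<Longrightarrow> (\<lambda>x. T x + R x) \<in> alg"
  "T \<in> alg \<Longrightarrow> (\<lambda>x. scaleC c (T x)) \<in> alg"
  "T \<in> alg \<Longrightarrow> R \<in> alg \<Longrightarrow> (\<lambda>x. T (R x)) \<in> alg"
  unfolding alg_def
  using generated_algebra.ident[of UNIV "range S \<union> range \<rho>"]
    generated_algebra.add[of T UNIV "range S \<union> range \<rho>" R]
    generated_algebra.scale[of T UNIV "range S \<union> range \<rho>" c]
    generated_algebra.mult[of T UNIV "range S \<union> range \<rho>" R]
  by (auto intro: generated_algebra.gen)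

lemma alg_induct [consumes 1, case_names ident S rho add scale mult]:
  assumes "T \<in> alg" and "P (\<lambda>x. x)" and "\<And>\<xi>. P (S \<xi>)" and "\<And>a. P (\<rho> a)"
    and "\<And>T R. T \<in> alg \<Longrightarrow> R \<in> alg \<Longrightarrow> P T \<Longrightarrow> P R \<Longrightarrow> P (\<lambda>x. T x + R x)"
    and "\<And>c T. T \<in> alg \<Longrightarrow> P T \<Longrightarrow> P (\<lambda>x. scaleC c (T x))"
    and "\<And>T R. T \<in> alg \<Longrightarrow> R \<in> alg \<Longrightarrow> P T \<Longrightarrow> P R \<Longrightarrow> P (\<lambda>x. T (R x))"
  shows "P T"
  using assms(1) unfolding alg_def
proof induction
  case (gen T)
  then show ?case using assms(3,4) by auto
qed (use assms(2,5-) in \<open>auto simp: alg_def\<close>)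

lemma wop_alg: "wop x \<in> alg"
proof (induction x)
  case (Scal a)
  then show ?case using alg_intros(3)[of a] by simp
next
  case (Tens \<xi> x)
  have "wop (Tens \<xi> x) = (\<lambda>h. S \<xi> (wop x h))" by (simp add: fun_eq_iff)
  then show ?case using alg_intros(6)[OF alg_intros(2) Tens] by simp
qed

lemma coinv_adj_alg:
  assumes "coinv M" "T \<in> alg"
  shows "h \<in> M \<Longrightarrow> adj T h \<in> M"
  using assms(2)
proof (induction arbitrary: h rule: alg_induct)
  case (add T R)
  then show ?case using csubspace_add[OF coinvD(2)[OF assms(1)]]
    by (simp add: adj_add alg_bop)
next
  case (scale c T)
  then show ?case using csubspace_scale[OF coinvD(2)[OF assms(1)]]
    by (simp add: adj_scaleC alg_bop)
qed (use coinvD(4,5)[OF assms(1)] in \<open>auto simp: adj_id adj_S adj_rho adj_compose alg_bop\<close>)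

lemma csub_wspan: "csubspace (wspan D M)"
  using closed_wspan closed_csubspace_def by blast

lemma alg_wspan: "T \<in> alg \<Longrightarrow> h \<in> wspan UNIV M \<Longrightarrow> T h \<in> wspan UNIV M"
proof (induction arbitrary: h rule: alg_induct)
  case (add T R)
  then show ?case using csubspace_add[OF csub_wspan] by blast
next
  case (scale c T)
  then show ?case using csubspace_scale[OF csub_wspan] by blast
qed (auto intro: wspan_UNIV_S wspan_UNIV_rho)

abbreviation wot_alg :: "('h \<Rightarrow> 'h) set" where
  "wot_alg \<equiv> weak_op_topology UNIV closure_of alg"

text \<open>Weak operator limits generate nothing new: the space generated by words is closed and
  invariant under \<open>alg\<close>, and membership in a closed subspace passes to such
  limits.\<close>

lemma closed_image_span_wot_alg:
  "closed_image_span wot_alg M = wspan UNIV M"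
proof
  have "T h \<in> wspan UNIV M" if "T \<in> wot_alg" "h \<in> M" for T h
    by (rule weak_op_closure_mem[OF closed_wspan that(1)])
       (use that(2) subset_wspan_UNIV alg_wspan in blast)
  then show "closed_image_span wot_alg M \<subseteq> wspan UNIV M"
    unfolding closed_image_span_def
    by (intro closure_cspan_minimal closed_wspan) blast
  have "wop x \<in> wot_alg" for x
    using subset_weak_op_closure[of alg] alg_bop wop_alg by blast
  then show "wspan UNIV M \<subseteq> closed_image_span wot_alg M"
    unfolding closed_image_span_def
    by (intro wspan_minimal closed_csubspace_closure_cspan closure_cspan_base) blast
qed

end

text \<open>\<open>W\<close> will be \<open>Vhat\<close> and \<open>\<Z>\<close> the set of its
  minimal summands. That they span \<open>W\<close> is expressed by \<open>generating\<close>, which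
  refers to coinvariant subspaces only and passes to the amplification coordinate by
  coordinate.\<close>

locale semisimple_coinv = isometric_system S Sa \<rho> lact ip
  for S Sa :: "'e \<Rightarrow> 'h \<Rightarrow> 'h::complex_hilbert" and \<rho> :: "'a::cstar_algebra \<Rightarrow> 'h \<Rightarrow> 'h"
    and lact ip +
  fixes W :: "'h set" and \<Z> :: "'h set set" and d :: nat and b :: "nat \<Rightarrow> 'h"
  assumes coinv_W: "coinv W" and W_span: "W = cspan (b ` {..<d})" and W_full: "W \<subseteq> sspan UNIV"
    and minimal: "Z \<in> \<Z> \<Longrightarrow> minimal_coinv Z" and Z_sub: "Z \<in> \<Z> \<Longrightarrow> Z \<subseteq> W"
    and generating: "coinv M \<Longrightarrow> (\<And>Z. Z \<in> \<Z> \<Longrightarrow> Z \<subseteq> M) \<Longrightarrow> W \<subseteq> M"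
begin

sublocale amp: isometric_system "\<lambda>\<xi>. amp (S \<xi>)" "\<lambda>\<xi>. amp (Sa \<xi>)" "\<lambda>a. amp (\<rho> a)" lact ip
  by (rule isometric_system_amp)

lemma b_mem: "i < d \<Longrightarrow> b i \<in> W"
  unfolding W_span by (rule complex_vector.span_base) simp

lemma csub_W: "csubspace W"
  by (rule coinvD(2)[OF coinv_W])

text \<open>There is one copy of \<open>W\<close> for each spanning vector \<open>b i\<close>; the
  vanishing of the other coordinates keeps the space finite dimensional.\<close>

definition WT :: "'h ell2 set" where
  "WT = {v. (\<forall>i<d. coord v i \<in> W) \<and> (\<forall>i\<ge>d. coord v i = 0)}"

lemma single_mem_WT: "i < d \<Longrightarrow> h \<in> W \<Longrightarrow> single i h \<in> WT"
  using csubspace_0[OF csub_W] by (auto simp: WT_def)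

lemma csub_WT: "csubspace WT"
  by (rule csubspaceI)
     (use csub_W in \<open>auto simp: WT_def csubspace_0 csubspace_add
       csubspace_scale\<close>)

lemma WT_subset:
  assumes "csubspace N" "\<And>i h. i < d \<Longrightarrow> h \<in> W \<Longrightarrow> single i h \<in> N"
  shows "WT \<subseteq> N"
proof
  fix v assume v: "v \<in> WT"
  then have "v = (\<Sum>i<d. single i (coord v i))" by (intro sum_single) (auto simp: WT_def)
  also have "\<dots> \<in> N"
    by (rule complex_vector.subspace_sum[OF assms(1)]) (use v assms(2) in \<open>auto simp: WT_def\<close>)
  finally show "v \<in> N" .
qed

lemma finite_dim_WT: "finite_dim WT"
proof -
  let ?B = "\<Union>i<d. single i ` b ` {..<d}"
  have "WT \<subseteq> cspan ?B"
  proof (rule WT_subset)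
    fix i h assume i: "i < d" and h: "h \<in> W"
    have "csubspace {h. single i h \<in> cspan ?B}"
      by (rule csubspaceI)
         (auto simp: single_add single_scaleC complex_vector.span_zero intro: complex_vector.span_add
           complex_vector.span_scale)
    then have "cspan (b ` {..<d}) \<subseteq> {h. single i h \<in> cspan ?B}"
      by (rule complex_vector.span_minimal[rotated]) (use i in \<open>auto intro!: complex_vector.span_base\<close>)
    then show "single i h \<in> cspan ?B" using h W_span by blast
  qed (rule complex_vector.subspace_span)
  moreover have "finite_dim (cspan ?B)" unfolding finite_dim_def by (intro exI[of _ ?B]) simp
  ultimately show ?thesis using finite_dim_subspace csub_WT by blast
qed

lemma coinv_WT: "amp.coinv WT"
proof (rule amp.coinvI[OF closed_csubspace_finite_dim[OF finite_dim_WT]])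
  show "amp (\<rho> a) v \<in> WT" if "v \<in> WT" for a v
    using that coinvD(4)[OF coinv_W] by (auto simp: WT_def rho_bop bop_zero)
  show "amp (Sa \<xi>) v \<in> WT" if "v \<in> WT" for \<xi> v
    using that coinvD(5)[OF coinv_W] by (auto simp: WT_def Sa_bop bop_zero)
qed

lemma amp_single: "T \<in> bounded_ops UNIV \<Longrightarrow> amp T (single i h) = single i (T h)"
  by (rule ell2_eqI) (simp add: bop_zero)

lemma coinv_single_vimage:
  assumes "amp.coinv N"
  shows "coinv {h. single i h \<in> N}"
  by (rule coinvI[OF closed_csubspace_single_vimage[OF amp.coinvD(1)[OF assms]]])
     (use amp.coinvD(4,5)[OF assms, of "single i _"] in \<open>simp_all add: amp_single rho_bop Sa_bop\<close>)

lemma WT_full: "WT \<subseteq> amp.sspan UNIV"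
proof (rule WT_subset)
  show "csubspace (amp.sspan UNIV)" using amp.closed_sspan closed_csubspace_def by blast
  fix i h assume "h \<in> W"
  have "sspan UNIV \<subseteq> {h. single i h \<in> amp.sspan UNIV}"
    by (rule sspan_minimal[OF closed_csubspace_single_vimage[OF amp.closed_sspan]])
       (use amp.sspan_base[of "single i _" UNIV] in \<open>simp add: amp_single[OF S_bop]\<close>)
  then show "single i h \<in> amp.sspan UNIV" using \<open>h \<in> W\<close> W_full by blast
qed

text \<open>A coordinate embedding intertwines each operator with its amplification. A coinvariant
  subspace of a coordinate copy therefore pulls back to a coinvariant subspace of \<open>Z\<close>,
  and minimality is inherited.\<close>

lemma minimal_single:
  assumes "Z \<in> \<Z>" "i < d"
  shows "amp.minimal_coinv (single i ` Z)"
proof -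
  have Z: "coinv Z" "Z \<noteq> {0}" "\<And>N. coinv N \<Longrightarrow> N \<subseteq> Z \<Longrightarrow> N \<noteq> {0} \<Longrightarrow> N = Z"
    using minimal[OF assms(1)] unfolding minimal_coinv_def by auto
  have sub: "csubspace (single i ` Z)"
  proof (rule csubspaceI)
    show "0 \<in> single i ` Z"
      using csubspace_0[OF coinvD(2)[OF Z(1)]] by (intro image_eqI[of _ _ 0]) simp_all
    show "x + y \<in> single i ` Z" if "x \<in> single i ` Z" "y \<in> single i ` Z" for x y
      using that csubspace_add[OF coinvD(2)[OF Z(1)]] by (auto simp: single_add[symmetric])
    show "scaleC c x \<in> single i ` Z" if "x \<in> single i ` Z" for c x
      using that csubspace_scale[OF coinvD(2)[OF Z(1)]] by (auto simp: single_scaleC[symmetric])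
  qed
  have "single i ` Z \<subseteq> WT" using Z_sub[OF assms(1)] single_mem_WT[OF assms(2)] by blast
  then have "closed_csubspace (single i ` Z)"
    using finite_dim_subspace[OF finite_dim_WT sub] closed_csubspace_finite_dim by blast
  then have "amp.coinv (single i ` Z)"
    by (rule amp.coinvI) (use coinvD(4,5)[OF Z(1)] in \<open>auto simp: amp_single rho_bop Sa_bop\<close>)
  moreover have "single i ` Z \<noteq> {0}"
  proof -
    obtain z where "z \<in> Z" "z \<noteq> 0"
      using Z(2) csubspace_0[OF coinvD(2)[OF Z(1)]] by blast
    then have "single i z \<in> single i ` Z" "single i z \<noteq> 0"
      using norm_single[of i z] by (auto simp del: norm_single)
    then show ?thesis by blast
  qed
  moreover have "N = single i ` Z" if N: "amp.coinv N" "N \<subseteq> single i ` Z" "N \<noteq> {0}" for N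
  proof -
    have "{h. single i h \<in> N} = Z"
    proof (rule Z(3)[OF coinv_single_vimage[OF N(1)]])
      have inj: "h = k" if "single i h = single i k" for h k
        using that by (metis coord_single)
      show "{h. single i h \<in> N} \<subseteq> Z" using N(2) inj by blast
      have "0 \<in> N" using csubspace_0[OF amp.coinvD(2)[OF N(1)]] .
      then obtain v where "v \<in> N" "v \<noteq> 0" using N(3) by blast
      then obtain h where "single i h \<in> N" "h \<noteq> 0" using N(2) by fastforce
      then show "{h. single i h \<in> N} \<noteq> {0}" by blast
    qed
    then show ?thesis using N(2) by blast
  qed
  ultimately show ?thesis unfolding amp.minimal_coinv_def by blast
qed

text \<open>The copies of the minimal pieces in all \<open>d\<close> coordinates generate
  \<open>WT\<close>, so the complement result applies to the amplified system.\<close>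

lemma coinv_complement_WT:
  assumes "amp.coinv U" "U \<subseteq> WT"
  shows "amp.coinv (WT \<inter> orth_compl U)"
proof (rule amp.coinv_complement[OF finite_dim_WT coinv_WT WT_full _ _ _ assms])
  let ?\<Z> = "{single i ` Z |i Z. i < d \<and> Z \<in> \<Z>}"
  show "amp.minimal_coinv Z" if "Z \<in> ?\<Z>" for Z using that minimal_single by blast
  show "Z \<subseteq> WT" if "Z \<in> ?\<Z>" for Z using that single_mem_WT Z_sub by blast
  show "WT \<subseteq> M" if M: "amp.coinv M" "\<And>Z. Z \<in> ?\<Z> \<Longrightarrow> Z \<subseteq> M" for M
  proof (rule WT_subset[OF amp.coinvD(2)[OF M(1)]])
    fix i h assume "i < d" "h \<in> W"
    then have "W \<subseteq> {h. single i h \<in> M}"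
      by (intro generating coinv_single_vimage[OF M(1)]) (use M(2) in blast)
    then show "single i h \<in> M" using \<open>h \<in> W\<close> by blast
  qed
qed

text \<open>\<open>AT\<close> encodes \<open>alg\<^sup>*\<close> restricted to \<open>W\<close> by the values on the spanning vectors \<open>b\<close>.\<close>

definition AT :: "'h ell2 set" where
  "AT = {fin_tuple d (\<lambda>i. adj T (b i)) |T. T \<in> alg}"

lemma AT_WT: "AT \<subseteq> WT"
  using coinv_adj_alg[OF coinv_W] b_mem by (auto simp: AT_def WT_def)

lemma csub_AT: "csubspace AT"
proof (rule csubspaceI)
  have "0 = fin_tuple d (\<lambda>i. adj (\<lambda>x. scaleC 0 x) (b i))"
    unfolding adj_scaleC[OF bop_id] adj_id by (rule ell2_eqI) simp
  then show "0 \<in> AT" using alg_intros(5)[OF alg_intros(1)] unfolding AT_def by blast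
  show "x + y \<in> AT" if xy: "x \<in> AT" "y \<in> AT" for x y
  proof -
    obtain T R where T: "T \<in> alg" "x = fin_tuple d (\<lambda>i. adj T (b i))"
      and R: "R \<in> alg" "y = fin_tuple d (\<lambda>i. adj R (b i))" using xy by (auto simp: AT_def)
    then have "x + y = fin_tuple d (\<lambda>i. adj (\<lambda>x. T x + R x) (b i))"
      by (intro ell2_eqI) (simp add: adj_add alg_bop)
    then show ?thesis using alg_intros(4)[OF T(1) R(1)] unfolding AT_def by blast
  qed
  show "scaleC c x \<in> AT" if x: "x \<in> AT" for c x
  proof -
    obtain T where T: "T \<in> alg" "x = fin_tuple d (\<lambda>i. adj T (b i))" using x by (auto simp: AT_def)
    then have "scaleC c x = fin_tuple d (\<lambda>i. adj (\<lambda>x. scaleC (cnj c) (T x)) (b i))"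
      by (intro ell2_eqI) (simp add: adj_scaleC alg_bop)
    then show ?thesis using alg_intros(5)[OF T(1)] unfolding AT_def by blast
  qed
qed

lemma closed_AT: "closed_csubspace AT"
  by (rule closed_csubspace_finite_dim[OF finite_dim_subspace[OF finite_dim_WT csub_AT AT_WT]])

text \<open>Applying \<open>adj R\<close> to the tuple of \<open>T\<close> gives the tuple of the
  product of \<open>T\<close> and \<open>R\<close>, since adjoints reverse products. Closure of
  \<open>alg\<close> under multiplication is what makes \<open>AT\<close> invariant.\<close>

lemma coinv_AT: "amp.coinv AT"
proof (rule amp.coinvI[OF closed_AT])
  have *: "amp (adj R) v \<in> AT" if v: "v \<in> AT" and R: "R \<in> alg" for v R
  proof -
    obtain T where T: "T \<in> alg" "v = fin_tuple d (\<lambda>i. adj T (b i))" using v by (auto simp: AT_def)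
    have "amp (adj R) v = fin_tuple d (\<lambda>i. adj (\<lambda>x. T (R x)) (b i))"
      by (rule ell2_eqI) (simp add: T(2) adj_compose alg_bop T(1) R bop_adjoint bop_zero)
    then show ?thesis using alg_intros(6)[OF T(1) R] unfolding AT_def by blast
  qed
  show "amp (\<rho> a) v \<in> AT" if "v \<in> AT" for a v
    using *[OF that alg_intros(3)[of "cstar a"]] by (simp add: adj_rho cstar_cstar)
  show "amp (Sa \<xi>) v \<in> AT" if "v \<in> AT" for \<xi> v
    using *[OF that alg_intros(2)[of \<xi>]] by (simp add: adj_S)
qed

lemma amp_eqI: "T \<in> alg \<Longrightarrow> (\<And>i. coord w i = adj T (coord v i)) \<Longrightarrow> amp (adj T) v = w"
  by (rule ell2_eqI) (simp add: bop_adjoint alg_bop)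

lemma amp_adj_mem:
  assumes "amp.coinv N" "T \<in> alg"
  shows "v \<in> N \<Longrightarrow> amp (adj T) v \<in> N"
  using assms(2)
proof (induction arbitrary: v rule: alg_induct)
  case ident
  have "amp (\<lambda>x. x) v = v" by (rule ell2_eqI) simp
  then show ?case using ident by (simp add: adj_id)
next
  case (add T R)
  have "amp (adj (\<lambda>x. T x + R x)) v = amp (adj T) v + amp (adj R) v"
    by (rule amp_eqI[OF alg_intros(4)[OF add(1,2)]]) (simp add: add adj_add alg_bop bop_adjoint)
  then show ?case using add csubspace_add[OF amp.coinvD(2)[OF assms(1)]] by simp
next
  case (scale c T)
  have "amp (adj (\<lambda>x. scaleC c (T x))) v = scaleC (cnj c) (amp (adj T) v)"
    by (rule amp_eqI[OF alg_intros(5)[OF scale(1)]]) (simp add: scale adj_scaleC alg_bop bop_adjoint)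
  then show ?case using scale csubspace_scale[OF amp.coinvD(2)[OF assms(1)]] by simp
next
  case (mult T R)
  have "amp (adj (\<lambda>x. T (R x))) v = amp (adj R) (amp (adj T) v)"
    by (rule amp_eqI[OF alg_intros(6)[OF mult(1,2)]]) (simp add: mult adj_compose alg_bop bop_adjoint)
  then show ?case using mult by simp
qed (use amp.coinvD(4,5)[OF assms(1)] in \<open>auto simp: adj_S adj_rho\<close>)

text \<open>A linear map on \<open>W\<close> is determined by its values on the spanning vectors, so
  questions about the adjoint algebra on \<open>W\<close> become questions of membership in the
  closed subspace \<open>AT\<close>.\<close>

lemma AT_eq_on_W:
  assumes R: "fin_tuple d (\<lambda>i. R (b i)) \<in> AT"
    and add: "\<And>x y. x \<in> W \<Longrightarrow> y \<in> W \<Longrightarrow> R (x + y) = R x + R y"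
    and scale: "\<And>c x. x \<in> W \<Longrightarrow> R (scaleC c x) = scaleC c (R x)"
  shows "\<exists>T\<in>alg. \<forall>x\<in>W. R x = adj T x"
proof -
  obtain T where T: "T \<in> alg" "fin_tuple d (\<lambda>i. R (b i)) = fin_tuple d (\<lambda>i. adj T (b i))"
    using R by (auto simp: AT_def)
  have eq: "R (b i) = adj T (b i)" if "i < d" for i
    using arg_cong[OF T(2), of "\<lambda>v. coord v i"] that by simp
  note adjT = bop_adjoint[OF alg_bop[OF T(1)]]
  have R0: "R 0 = 0" using scale[of 0 0] csubspace_0[OF csub_W] by simp
  have "csubspace {x \<in> W. R x = adj T x}"
    by (rule csubspaceI)
       (auto simp: csub_W csubspace_0 csubspace_add
         csubspace_scale add scale R0 bop_zero[OF adjT] bop_add[OF adjT] bop_scaleC[OF adjT])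
  moreover have "b ` {..<d} \<subseteq> {x \<in> W. R x = adj T x}" using eq b_mem by auto
  ultimately have "W \<subseteq> {x \<in> W. R x = adj T x}"
    using complex_vector.span_minimal W_span by metis
  then show ?thesis using T(1) by blast
qed

text \<open>The adjoint of \<open>adj T\<close> on \<open>W\<close> is the compression of
  \<open>T\<close> to \<open>W\<close>, so this puts adjoints back into the algebra. The tuple of
  compressions is tested against the complement of \<open>AT\<close> in \<open>WT\<close>, which is
  coinvariant.\<close>

lemma compression_adjoint:
  assumes T: "T \<in> alg"
  shows "\<exists>R\<in>alg. \<forall>x\<in>W. orth_proj W (T x) = adj R x"
proof (rule AT_eq_on_W)
  have cW: "closed_csubspace W" by (rule coinvD(1)[OF coinv_W])
  let ?u = "fin_tuple d (\<lambda>i. orth_proj W (T (b i)))"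
  have u: "?u \<in> WT" using orth_proj_mem[OF cW] by (auto simp: WT_def)
  let ?N = "WT \<inter> orth_compl AT"
  have N: "amp.coinv ?N" by (rule coinv_complement_WT[OF coinv_AT AT_WT])
  \<comment> \<open>Pairing \<open>w\<close> with the tuple of compressions amounts to pairing
    \<open>amp (adj T) w\<close> with the tuple of the \<open>b i\<close>. The former stays in the
    complement of \<open>AT\<close>, and the latter belongs to \<open>AT\<close> through the
    identity.\<close>
  have orth: "cinner w ?u = 0" if w: "w \<in> ?N" for w
  proof -
    let ?x = "fin_tuple d b"
    have "?x = fin_tuple d (\<lambda>i. adj (\<lambda>x. x) (b i))" by (simp add: adj_id)
    then have x: "?x \<in> AT" using alg_intros(1) unfolding AT_def by blast
    have "cinner w ?u = (\<Sum>i<d. cinner (coord w i) (orth_proj W (T (b i))))"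
      by (subst cinner_fin_support[where d = d]) auto
    also have "\<dots> = (\<Sum>i<d. cinner (coord (amp (adj T) w) i) (coord ?x i))"
      using w by (intro sum.cong refl)
        (auto simp: WT_def cinner_orth_proj_right[OF cW] bop_adjoint alg_bop T cinner_adjoint')
    also have "\<dots> = cinner (amp (adj T) w) ?x"
      by (rule cinner_fin_support[symmetric]) auto
    also have "\<dots> = 0" using amp_adj_mem[OF N T w] x cinner_orth_compl' by blast
    finally show ?thesis .
  qed
  let ?p = "orth_proj AT ?u"
  have p: "?p \<in> AT" "?u - ?p \<in> orth_compl AT"
    by (rule orth_proj_mem[OF closed_AT], rule orth_proj_compl[OF closed_AT])
  have "?u - ?p \<in> ?N" using u p AT_WT csubspace_diff[OF csub_WT] by blast
  then show "?u \<in> AT" by (rule orth_residual_zero_mem[OF closed_AT orth])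
  show "orth_proj W (T (x + y)) = orth_proj W (T x) + orth_proj W (T y)" for x y
    by (simp add: bop_add[OF alg_bop[OF T]] orth_proj_add[OF cW])
  show "orth_proj W (T (scaleC c x)) = scaleC c (orth_proj W (T x))" for c x
    by (simp add: bop_scaleC[OF alg_bop[OF T]] orth_proj_scaleC[OF cW])
qed

text \<open>On \<open>W\<close> the weak closure contributes no new adjoints: \<open>AT\<close> is
  finite dimensional, hence closed, and pairing with a fixed tuple is, up to conjugation, a finite
  sum of matrix coefficients.\<close>

lemma wot_closure_adjoint:
  assumes T: "T \<in> wot_alg"
  shows "\<exists>R\<in>alg. \<forall>x\<in>W. adj T x = adj R x"
proof (rule AT_eq_on_W)
  note Tb = weak_op_closure_bounded[OF T]
  let ?u = "fin_tuple d (\<lambda>i. adj T (b i))"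
  let ?r = "?u - orth_proj AT ?u"
  have r: "?r \<in> orth_compl AT" by (rule orth_proj_compl[OF closed_AT])
  have sum_eq: "(\<Sum>i<d. cinner (b i) (R (coord ?r i))) = cnj (cinner ?r (fin_tuple d (\<lambda>i. adj R (b i))))"
    if "R \<in> bounded_ops UNIV" for R
  proof -
    have "cinner ?r (fin_tuple d (\<lambda>i. adj R (b i))) = (\<Sum>i<d. cinner (coord ?r i) (adj R (b i)))"
      by (subst cinner_fin_support[where d = d]) auto
    also have "\<dots> = (\<Sum>i<d. cnj (cinner (b i) (R (coord ?r i))))"
      by (intro sum.cong refl) (metis cinner_adjoint[OF that] cinner_commute)
    finally show ?thesis by simp
  qed
  have "(\<Sum>i<d. cinner (b i) (T (coord ?r i))) = 0"
  proof (rule weak_op_closure_sum_zero[OF T])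
    fix R assume R: "R \<in> alg" "R \<in> bounded_ops UNIV"
    then have "cinner ?r (fin_tuple d (\<lambda>i. adj R (b i))) = 0"
      by (intro cinner_orth_compl'[OF r]) (auto simp: AT_def)
    then show "(\<Sum>i<d. cinner (b i) (R (coord ?r i))) = 0" unfolding sum_eq[OF R(2)] by simp
  qed
  then have "cinner ?r ?u = 0" unfolding sum_eq[OF Tb] by simp
  then show "?u \<in> AT" by (rule orth_residual_zero_mem[OF closed_AT])
  show "adj T (x + y) = adj T x + adj T y" for x y by (rule bop_add[OF bop_adjoint[OF Tb]])
  show "adj T (scaleC c x) = scaleC c (adj T x)" for c x by (rule bop_scaleC[OF bop_adjoint[OF Tb]])
qed

lemma norm_closed_adjoint:
  assumes T: "T \<in> bounded_ops W"
    and approx: "\<And>e. e > 0 \<Longrightarrow> \<exists>R\<in>alg. \<forall>x\<in>W. norm (T x - adj R x) \<le> e * norm x"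
  shows "\<exists>R\<in>alg. \<forall>x\<in>W. T x = adj R x"
proof (rule AT_eq_on_W)
  let ?u = "fin_tuple d (\<lambda>i. T (b i))"
  have "?u \<in> closure AT"
    unfolding closure_approachable
  proof (intro allI impI)
    fix e :: real assume "e > 0"
    \<comment> \<open>The summand 1 keeps \<open>s\<close> positive even if all \<open>b i\<close>
      vanish, and leaves \<open>e / s * (s - 1)\<close> strictly below \<open>e\<close>.\<close>
    define s where "s = (\<Sum>i<d. norm (b i)) + 1"
    have s: "s > 0" unfolding s_def by (intro add_nonneg_pos sum_nonneg) auto
    obtain R where R: "R \<in> alg" "\<And>x. x \<in> W \<Longrightarrow> norm (T x - adj R x) \<le> e / s * norm x"
      using approx[of "e / s"] \<open>e > 0\<close> s by auto
    let ?v = "fin_tuple d (\<lambda>i. adj R (b i))"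
    have "?v - ?u = fin_tuple d (\<lambda>i. adj R (b i) - T (b i))" by (rule ell2_eqI) simp
    then have "norm (?v - ?u) \<le> (\<Sum>i<d. norm (adj R (b i) - T (b i)))"
      using norm_fin_tuple_le by metis
    also have "\<dots> \<le> (\<Sum>i<d. e / s * norm (b i))"
      using R(2) b_mem by (intro sum_mono) (auto simp: norm_minus_commute)
    also have "\<dots> = e / s * (s - 1)" by (simp add: s_def sum_distrib_left)
    also have "\<dots> < e" using s \<open>e > 0\<close> by (simp add: field_simps)
    finally have "dist ?v ?u < e" by (simp add: dist_norm)
    then show "\<exists>y\<in>AT. dist y ?u < e" using R(1) unfolding AT_def by blast
  qed
  then show "?u \<in> AT" using closed_AT by (simp add: closed_csubspace_def)
qed (use bounded_ops_add[OF T] bounded_ops_scale[OF T] in auto)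

lemma cstar_algebra_on_W:
  "cstar_algebra_on W {restrict T W |T. T \<in> star_set UNIV wot_alg}"
proof -
  let ?C = "{restrict T W |T. T \<in> star_set UNIV wot_alg}"
  have sub: "alg \<subseteq> wot_alg"
    by (rule subset_weak_op_closure) (use alg_bop in blast)
  have C: "?C = {restrict (adj T) W |T. T \<in> alg}"
  proof
    show "?C \<subseteq> {restrict (adj T) W |T. T \<in> alg}"
    proof clarify
      fix T assume "T \<in> star_set UNIV wot_alg"
      then obtain T' where T': "T = adj T'" "T' \<in> wot_alg"
        by (auto simp: star_set_def)
      obtain R where R: "R \<in> alg" "\<forall>x\<in>W. adj T' x = adj R x"
        using wot_closure_adjoint[OF T'(2)] by blast
      have "restrict T W = restrict (adj R) W" using R(2) T'(1) by (auto intro: restrict_ext)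
      then show "\<exists>T'. restrict T W = restrict (adj T') W \<and> T' \<in> alg" using R(1) by blast
    qed
    show "{restrict (adj T) W |T. T \<in> alg} \<subseteq> ?C" using sub by (auto simp: star_set_def)
  qed
  have CI: "Q \<in> ?C" if "Q \<in> extensional W" "T \<in> alg" "\<And>x. x \<in> W \<Longrightarrow> Q x = adj T x" for Q T
  proof -
    have "Q = restrict (adj T) W" using that by (auto simp: extensional_def restrict_def)
    then show ?thesis unfolding C using that(2) by blast
  qed
  have CE: "\<exists>T\<in>alg. Q = restrict (adj T) W" if "Q \<in> ?C" for Q using that unfolding C by blast
  have adjW: "adj T x \<in> W" if "T \<in> alg" "x \<in> W" for T x using coinv_adj_alg[OF coinv_W] that by blast
  have bdd: "restrict (adj T) W \<in> bounded_ops W" if "T \<in> alg" for T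
    by (rule bop_restrict) (use that adjW csub_W bop_adjoint alg_bop in auto)
  show ?thesis
    unfolding cstar_algebra_on_def
  proof (intro conjI ballI allI impI)
    show "?C \<subseteq> bounded_ops W"
    proof
      fix Q assume "Q \<in> ?C"
      then obtain T where "T \<in> alg" "Q = restrict (adj T) W" using CE by meson
      then show "Q \<in> bounded_ops W" using bdd by simp
    qed
    show "op_id W \<in> ?C" by (rule CI[OF _ alg_intros(1)]) (auto simp: op_id_def adj_id)
    show "op_add W Q P \<in> ?C" if QP: "Q \<in> ?C" "P \<in> ?C" for Q P
    proof -
      obtain T R where T: "T \<in> alg" "Q = restrict (adj T) W" and R: "R \<in> alg" "P = restrict (adj R) W"
        using CE QP by meson
      show ?thesis
        by (rule CI[OF _ alg_intros(4)[OF T(1) R(1)]])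
           (auto simp: op_add_def T(2) R(2) adj_add alg_bop T(1) R(1))
    qed
    show "compose W Q P \<in> ?C" if QP: "Q \<in> ?C" "P \<in> ?C" for Q P
    proof -
      obtain T R where T: "T \<in> alg" "Q = restrict (adj T) W" and R: "R \<in> alg" "P = restrict (adj R) W"
        using CE QP by meson
      \<comment> \<open>The factors are swapped because taking adjoints reverses products.\<close>
      show ?thesis
        by (rule CI[OF _ alg_intros(6)[OF R(1) T(1)]])
           (auto simp: compose_def T(2) R(2) adj_compose alg_bop T(1) R(1) adjW)
    qed
    show "op_scale W c Q \<in> ?C" if Q: "Q \<in> ?C" for c Q
    proof -
      obtain T where T: "T \<in> alg" "Q = restrict (adj T) W" using CE Q by meson
      show ?thesis
        by (rule CI[OF _ alg_intros(5)[OF T(1), of "cnj c"]])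
           (auto simp: op_scale_def T(2) adj_scaleC alg_bop T(1))
    qed
    show "adjoint_on W Q \<in> ?C" if Q: "Q \<in> ?C" for Q
    proof -
      obtain T where T: "T \<in> alg" "Q = restrict (adj T) W" using CE Q by meson
      obtain R where R: "R \<in> alg" "\<And>x. x \<in> W \<Longrightarrow> orth_proj W (T x) = adj R x"
        using compression_adjoint[OF T(1)] by blast
      have "adjoint_on W Q = restrict (adj R) W"
      proof (rule adjoint_on_eqI[OF csub_W bdd[OF R(1)]])
        fix x y assume xy: "x \<in> W" "y \<in> W"
        have "cinner (adj T x) y = cinner x (T y)" by (rule cinner_adjoint'[OF alg_bop[OF T(1)]])
        also have "\<dots> = cinner x (adj R y)"
          using cinner_orth_proj_right[OF coinvD(1)[OF coinv_W] xy(1), of "T y"] R(2)[OF xy(2)] by simp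
        finally show "cinner (Q x) y = cinner x (restrict (adj R) W y)" using xy T(2) by simp
      qed
      then show ?thesis unfolding C using R(1) by blast
    qed
    show "Q \<in> ?C" if Q: "Q \<in> bounded_ops W"
      and approx: "\<forall>e>0. \<exists>P\<in>?C. \<forall>x\<in>W. norm (Q x - P x) \<le> e * norm x" for Q
    proof -
      have "\<exists>R\<in>alg. \<forall>x\<in>W. norm (Q x - adj R x) \<le> e * norm x" if "e > 0" for e
      proof -
        obtain P where P: "P \<in> ?C" "\<forall>x\<in>W. norm (Q x - P x) \<le> e * norm x" using approx \<open>e > 0\<close> by blast
        obtain R where R: "R \<in> alg" "P = restrict (adj R) W" using CE[OF P(1)] by blast
        show ?thesis using P(2) R by (intro bexI[of _ R]) auto
      qed
      then obtain R where "R \<in> alg" "\<And>x. x \<in> W \<Longrightarrow> Q x = adj R x"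
        using norm_closed_adjoint[OF Q] by blast
      then show ?thesis by (intro CI) (use Q in \<open>auto simp: bounded_ops_def PiE_def\<close>)
    qed
  qed
qed

end

section \<open>Tensor products and induced representations\<close>

text \<open>\<open>B\<close> sends elementary tensors to vectors with the same inner products. Hence
  \<open>tens_map B\<close> identifies the abstract completion with a closed subspace of the ambient
  space, where its classes, sums and operators can be computed.\<close>

locale tensor_realization =
  fixes X :: "'x set" and ip :: "'x \<Rightarrow> 'x \<Rightarrow> 'a" and \<sigma> :: "'a \<Rightarrow> 'h \<Rightarrow> 'h::complex_hilbert"
    and W :: "'h set" and B :: "'x \<Rightarrow> 'h \<Rightarrow> 'h"
  assumes csub_W: "csubspace W"
    and gram: "x \<in> X \<Longrightarrow> y \<in> X \<Longrightarrow> h \<in> W \<Longrightarrow> k \<in> W \<Longrightarrow>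
      cinner (B x h) (B y k) = cinner h (\<sigma> (ip x y) k)"
    and B_scaleC: "x \<in> X \<Longrightarrow> h \<in> W \<Longrightarrow> B x (scaleC c h) = scaleC c (B x h)"
begin

abbreviation "J \<equiv> fsum_val B"
abbreviation "\<T> \<equiv> tensor_space X ip \<sigma> W"
abbreviation "\<C> \<equiv> tens_Cauchy X ip \<sigma> W"
abbreviation "cls \<equiv> tens_class X ip \<sigma> W"

lemma W_uminus: "h \<in> W \<Longrightarrow> - h \<in> W"
  by (rule complex_vector.subspace_neg[OF csub_W])

lemma B_uminus: "x \<in> X \<Longrightarrow> h \<in> W \<Longrightarrow> B x (- h) = - B x h"
  using B_scaleC[of x h "-1"] by simp

lemma fsum_inner_J:
  "set u \<subseteq> X \<times> W \<Longrightarrow> set v \<subseteq> X \<times> W \<Longrightarrow> fsum_inner ip \<sigma> u v = cinner (J u) (J v)"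
  by (rule cinner_fsum_val[symmetric]) (auto intro: gram)

lemma fsum_dist_J:
  assumes "set u \<subseteq> X \<times> W" "set v \<subseteq> X \<times> W"
  shows "fsum_dist ip \<sigma> u v = norm (J u - J v)"
proof -
  let ?v = "map (\<lambda>(x, h). (x, - h)) v"
  have v: "set ?v \<subseteq> X \<times> W" using assms(2) W_uminus by auto
  have "J ?v = - J v" using assms(2) by (induction v) (auto simp: B_uminus)
  then have J: "J (u @ ?v) = J u - J v" by simp
  have "set (u @ ?v) \<subseteq> X \<times> W" using assms(1) v by simp
  then have "Re (fsum_inner ip \<sigma> (u @ ?v) (u @ ?v)) = (norm (J u - J v))\<^sup>2"
    using fsum_inner_J[of "u @ ?v" "u @ ?v"] by (simp only: J cinner_self Re_complex_of_real)
  then show ?thesis unfolding fsum_dist_def Let_def by simp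
qed

lemma tens_Cauchy_iff:
  "u \<in> \<C> \<longleftrightarrow> (\<forall>n. set (u n) \<subseteq> X \<times> W) \<and> Cauchy (\<lambda>n. J (u n))"
  unfolding tens_Cauchy_def Cauchy_def dist_norm by (auto simp: fsum_dist_J)

lemma tens_Cauchy_set: "u \<in> \<C> \<Longrightarrow> set (u n) \<subseteq> X \<times> W"
  by (simp add: tens_Cauchy_iff)

lemma tens_Cauchy_LIMSEQ: "u \<in> \<C> \<Longrightarrow> (\<lambda>n. J (u n)) \<longlonglongrightarrow> lim (\<lambda>n. J (u n))"
  by (simp add: tens_Cauchy_iff Cauchy_convergent_iff convergent_LIMSEQ_iff)

text \<open>The seminorm distance of formal sums is the distance of their values under
  \<open>B\<close>, so a class amounts to one limit vector.\<close>

lemma tens_class_iff: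
  assumes u: "u \<in> \<C>"
  shows "v \<in> cls u \<longleftrightarrow>
    v \<in> \<C> \<and> lim (\<lambda>n. J (v n)) = lim (\<lambda>n. J (u n))"
proof (cases "v \<in> \<C>")
  case True
  have "(\<lambda>n. fsum_dist ip \<sigma> (u n) (v n)) = (\<lambda>n. norm (J (u n) - J (v n)))"
    using u True by (auto simp: tens_Cauchy_iff fsum_dist_J)
  moreover have "(\<lambda>n. norm (J (u n) - J (v n))) \<longlonglongrightarrow> norm (lim (\<lambda>n. J (u n)) - lim (\<lambda>n. J (v n)))"
    by (intro tendsto_intros tens_Cauchy_LIMSEQ u True)
  ultimately have "(\<lambda>n. fsum_dist ip \<sigma> (u n) (v n)) \<longlonglongrightarrow> 0 \<longleftrightarrow>
      norm (lim (\<lambda>n. J (u n)) - lim (\<lambda>n. J (v n))) = 0"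
    using LIMSEQ_unique by metis
  then show ?thesis using True by (auto simp: tens_class_def)
qed (simp add: tens_class_def)

lemma tens_rep:
  assumes "P \<in> \<T>"
  shows "tens_rep P \<in> \<C>" "cls (tens_rep P) = P"
    "(\<lambda>n. J (tens_rep P n)) \<longlonglongrightarrow> tens_map B P"
proof -
  obtain u where u: "u \<in> \<C>" "P = cls u"
    using assms by (auto simp: tensor_space_def)
  have "u \<in> P" using u tens_class_iff by blast
  then have "tens_rep P \<in> P" unfolding tens_rep_def by (rule someI[of "\<lambda>u. u \<in> P"])
  then have r: "tens_rep P \<in> \<C>" "lim (\<lambda>n. J (tens_rep P n)) = lim (\<lambda>n. J (u n))"
    using u tens_class_iff by auto
  then show "tens_rep P \<in> \<C>" by blast
  show "cls (tens_rep P) = P"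
    using u r by (auto simp: tens_class_iff)
  show "(\<lambda>n. J (tens_rep P n)) \<longlonglongrightarrow> tens_map B P"
    using tens_Cauchy_LIMSEQ[OF r(1)] unfolding tens_map_def fsum_val_def .
qed

lemma tens_class_space:
  "u \<in> \<C> \<Longrightarrow> cls u \<in> \<T>"
  by (simp add: tensor_space_def)

lemma tens_map_class:
  assumes "\<And>n. set (u n) \<subseteq> X \<times> W" "(\<lambda>n. J (u n)) \<longlonglongrightarrow> l"
  shows "tens_map B (cls u) = l" "cls u \<in> \<T>"
proof -
  have u: "u \<in> \<C>"
    using assms by (auto simp: tens_Cauchy_iff intro: LIMSEQ_imp_Cauchy)
  then show F: "cls u \<in> \<T>" by (rule tens_class_space)
  let ?r = "tens_rep (cls u)"
  have "?r \<in> cls u"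
    using tens_rep(1,2)[OF F] tens_class_iff by blast
  then have "lim (\<lambda>n. J (?r n)) = lim (\<lambda>n. J (u n))" using tens_class_iff[OF u] by blast
  then show "tens_map B (cls u) = l"
    using tens_rep(3)[OF F] assms(2) by (metis limI)
qed

lemma tens_map_inj:
  assumes "P \<in> \<T>" "Q \<in> \<T>" "tens_map B P = tens_map B Q"
  shows "P = Q"
proof -
  have "lim (\<lambda>n. J (tens_rep P n)) = lim (\<lambda>n. J (tens_rep Q n))"
    using tens_rep(3)[OF assms(1)] tens_rep(3)[OF assms(2)] assms(3) by (metis limI)
  then have "cls (tens_rep P) = cls (tens_rep Q)"
    by (intro set_eqI) (simp add: tens_class_iff tens_rep(1) assms(1,2))
  then show ?thesis using tens_rep(2) assms(1,2) by metis
qed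

text \<open>A limit of sums is the value of the Cauchy sequence formed by these sums; this is how
  completion becomes closure.\<close>

lemma tens_map_image:
  "tens_map B ` \<T> = closure (cspan {B x h |x h. x \<in> X \<and> h \<in> W})"
proof -
  have eq: "cspan {B x h |x h. x \<in> X \<and> h \<in> W} = {J u |u. set u \<subseteq> X \<times> W}"
    by (rule cspan_fsum_val[OF csub_W]) (simp add: B_scaleC)
  show ?thesis unfolding eq
  proof
    show "tens_map B ` \<T> \<subseteq> closure {J u |u. set u \<subseteq> X \<times> W}"
    proof clarify
      fix P assume "P \<in> \<T>"
      from tens_rep(3)[OF this] tens_Cauchy_set[OF tens_rep(1)[OF this]]
      show "tens_map B P \<in> closure {J u |u. set u \<subseteq> X \<times> W}"
        unfolding closure_sequential by (intro exI[of _ "\<lambda>n. J (tens_rep P n)"]) auto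
    qed
    show "closure {J u |u. set u \<subseteq> X \<times> W} \<subseteq> tens_map B ` \<T>"
    proof
      fix y assume "y \<in> closure {J u |u. set u \<subseteq> X \<times> W}"
      then obtain z where z: "\<And>n. z n \<in> {J u |u. set u \<subseteq> X \<times> W}" "z \<longlonglongrightarrow> y"
        unfolding closure_sequential by blast
      have "\<exists>u. z n = J u \<and> set u \<subseteq> X \<times> W" for n using z(1)[of n] by blast
      then obtain u where u: "\<And>n. z n = J (u n)" "\<And>n. set (u n) \<subseteq> X \<times> W" by metis
      from z(2) have "(\<lambda>n. J (u n)) \<longlonglongrightarrow> y" unfolding u(1)[symmetric] by simp
      from tens_map_class[OF u(2) this] show "y \<in> tens_map B ` \<T>" by blast
    qed
  qed
qed

lemma tens_inner_eq:
  assumes "P \<in> \<T>" "Q \<in> \<T>"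
  shows "tens_inner ip \<sigma> P Q = cinner (tens_map B P) (tens_map B Q)"
proof -
  have "(\<lambda>n. cinner (J (tens_rep P n)) (J (tens_rep Q n))) \<longlonglongrightarrow> cinner (tens_map B P) (tens_map B Q)"
    by (intro tendsto_cinner tens_rep assms)
  then have "(\<lambda>n. fsum_inner ip \<sigma> (tens_rep P n) (tens_rep Q n)) \<longlonglongrightarrow> cinner (tens_map B P) (tens_map B Q)"
    using fsum_inner_J tens_Cauchy_set[OF tens_rep(1)] assms by simp
  then show ?thesis unfolding tens_inner_def by (rule limI)
qed

lemma tens_map_add:
  assumes "P \<in> \<T>" "Q \<in> \<T>"
  shows "tens_map B (tens_add X ip \<sigma> W P Q) = tens_map B P + tens_map B Q"
  unfolding tens_add_def
proof (rule tens_map_class(1))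
  show "set (tens_rep P n @ tens_rep Q n) \<subseteq> X \<times> W" for n
    using tens_Cauchy_set[OF tens_rep(1)] assms by simp
  show "(\<lambda>n. J (tens_rep P n @ tens_rep Q n)) \<longlonglongrightarrow> tens_map B P + tens_map B Q"
    unfolding fsum_val_simps by (intro tendsto_add tens_rep assms)
qed

lemma tens_map_scale:
  assumes "P \<in> \<T>"
  shows "tens_map B (tens_scale X ip \<sigma> W c P) = scaleC c (tens_map B P)"
  unfolding tens_scale_def
proof (rule tens_map_class(1))
  have J: "J (map (\<lambda>(x, h). (x, scaleC c h)) u) = scaleC c (J u)" if "set u \<subseteq> X \<times> W" for u
    using that by (induction u) (auto simp: B_scaleC scaleC_add_right)
  note s = tens_Cauchy_set[OF tens_rep(1)[OF assms]]
  show "set (map (\<lambda>(x, h). (x, scaleC c h)) (tens_rep P n)) \<subseteq> X \<times> W" for n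
    using s[of n] csubspace_scale[OF csub_W] by auto
  show "(\<lambda>n. J (map (\<lambda>(x, h). (x, scaleC c h)) (tens_rep P n))) \<longlonglongrightarrow> scaleC c (tens_map B P)"
    unfolding J[OF s] by (intro tendsto_scaleC_right tens_rep assms)
qed

lemma tens_map_left:
  assumes P: "P \<in> \<T>" and T: "T \<in> bounded_ops UNIV"
    and t: "\<And>x. x \<in> X \<Longrightarrow> t x \<in> X" "\<And>x h. x \<in> X \<Longrightarrow> h \<in> W \<Longrightarrow> B (t x) h = T (B x h)"
  shows "tens_map B (tens_left X ip \<sigma> W t P) = T (tens_map B P)"
  unfolding tens_left_def
proof (rule tens_map_class(1))
  have J: "J (map (\<lambda>(x, h). (t x, h)) u) = T (J u)" if "set u \<subseteq> X \<times> W" for u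
    using that by (induction u) (auto simp: t bop_add[OF T] bop_zero[OF T])
  note s = tens_Cauchy_set[OF tens_rep(1)[OF P]]
  show "set (map (\<lambda>(x, h). (t x, h)) (tens_rep P n)) \<subseteq> X \<times> W" for n
    using s[of n] t(1) by auto
  show "(\<lambda>n. J (map (\<lambda>(x, h). (t x, h)) (tens_rep P n))) \<longlonglongrightarrow> T (tens_map B P)"
    unfolding J[OF s] by (intro bounded_linear.tendsto[OF bop_bounded_linear[OF T]] tens_rep P)
qed

text \<open>\<open>C\<close> may fail to preserve inner products. In the application
  \<open>B\<close> is \<open>S\<close>, \<open>C\<close> is \<open>A\<close> and \<open>T\<close> is
  the projection onto \<open>V\<close>.\<close>

lemma tens_map_compress:
  assumes P: "P \<in> \<T>" and T: "T \<in> bounded_ops UNIV"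
    and C: "\<And>x h. x \<in> X \<Longrightarrow> h \<in> W \<Longrightarrow> C x h = T (B x h)"
  shows "tens_map C P = T (tens_map B P)"
proof -
  have J: "fsum_val C u = T (J u)" if "set u \<subseteq> X \<times> W" for u
    using that by (induction u) (auto simp: C bop_add[OF T] bop_zero[OF T])
  have "(\<lambda>n. T (J (tens_rep P n))) \<longlonglongrightarrow> T (tens_map B P)"
    by (intro bounded_linear.tendsto[OF bop_bounded_linear[OF T]] tens_rep P)
  then have "(\<lambda>n. fsum_val C (tens_rep P n)) \<longlonglongrightarrow> T (tens_map B P)"
    using J[OF tens_Cauchy_set[OF tens_rep(1)[OF P]]] by simp
  then show ?thesis unfolding tens_map_def fsum_val_def by (rule limI)
qed

end

lemma unital_star_rep_restrict:
  assumes rep: "unital_star_rep UNIV \<rho>" and M: "csubspace M" and inv: "\<And>a h. h \<in> M \<Longrightarrow> \<rho> a h \<in> M"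
  shows "unital_star_rep M (\<lambda>a. restrict (\<rho> a) M)"
proof -
  have bop: "\<rho> a \<in> bounded_ops UNIV" for a using rep by (simp add: unital_star_rep_def)
  have bM: "restrict (\<rho> a) M \<in> bounded_ops M" for a by (rule bop_restrict[OF bop M inv])
  have "adjoint_on M (restrict (\<rho> a) M) = restrict (\<rho> (cstar a)) M" for a
  proof (rule adjoint_on_eqI[OF M bM])
    fix x y assume "x \<in> M" "y \<in> M"
    moreover have "\<rho> (cstar a) = adjoint_on UNIV (\<rho> a)" using rep by (simp add: unital_star_rep_def)
    ultimately show "cinner (restrict (\<rho> a) M x) y = cinner x (restrict (\<rho> (cstar a)) M y)"
      using cinner_adjoint[OF bop] by simp
  qed
  then show ?thesis
    using rep bM inv
    by (auto simp: unital_star_rep_def op_add_def op_scale_def op_id_def compose_def fun_eq_iff)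
qed

context isometric_system
begin

lemma wop_mem:
  assumes "rho_inv N" "\<And>\<xi> h. h \<in> N \<Longrightarrow> S \<xi> h \<in> N" "h \<in> N"
  shows "wop x h \<in> N"
  by (induction x) (use assms in \<open>auto simp: rho_inv_def\<close>)

text \<open>Here degrees may differ. Letters are removed in pairs until one word is scalar. If the
  other is not, its vector lies in \<open>sspan N\<close>, to which \<open>Y\<close> is orthogonal,
  and \<open>word_inner\<close> of the two is 0 as well.\<close>

lemma wandering_gram:
  assumes N: "\<And>\<xi> h. h \<in> N \<Longrightarrow> S \<xi> h \<in> N" "rho_inv N"
    and Y: "Y \<subseteq> N" "Y \<subseteq> orth_compl (sspan N)" "rho_inv Y"
    and h: "h \<in> Y" and k: "k \<in> Y"
  shows "cinner (wop x h) (wop y k) = cinner h (\<rho> (word_inner lact ip x y) k)"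
proof -
  note wN = wop_mem[OF N(2,1)]
  have perp: "cinner (S \<xi> (wop x h)) (\<rho> a k) = 0" if "h \<in> Y" "k \<in> Y" for \<xi> x h a k
  proof -
    have "S \<xi> (wop x h) \<in> sspan N" using wN that(1) Y(1) by (intro sspan_base) blast
    moreover have "\<rho> a k \<in> orth_compl (sspan N)" using Y(2,3) that(2) by (auto simp: rho_inv_def)
    ultimately show ?thesis by (rule cinner_orth_compl)
  qed
  show ?thesis
  proof (induction x arbitrary: y)
    case (Scal a)
    show ?case
    proof (cases y)
      case (Scal b)
      then show ?thesis by (simp add: rho_adj rho_mult)
    next
      case (Tens \<eta> z)
      then show ?thesis using perp[OF k h, of \<eta> z a] cinner_commute[of "\<rho> a h"] by (simp add: rho_zero)
    qed
  next
    case (Tens \<xi> x)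
    show ?case
    proof (cases y)
      case (Scal b)
      then show ?thesis using perp[OF h k] by (simp add: rho_zero)
    next
      case y: (Tens \<eta> z)
      then show ?thesis using Tens[of "word_act lact (ip \<xi> \<eta>) z"] by (simp add: S_adj S_isom wop_act)
    qed
  qed
qed

lemma sspan_rho: "rho_inv (sspan N)" if "rho_inv N"
  unfolding rho_inv_def
proof (intro allI ballI)
  fix a h assume h: "h \<in> sspan N"
  show "\<rho> a h \<in> sspan N"
  proof (rule bop_closure_cspan_mem[OF rho_bop closed_sspan])
    show "h \<in> closure (cspan {S \<xi> h |\<xi> h. h \<in> N})" using h by (simp add: sspan_def)
    fix k assume "k \<in> {S \<xi> h |\<xi> h. h \<in> N}"
    then obtain \<xi> h' where "k = S \<xi> h'" "h' \<in> N" by blast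
    then show "\<rho> a k \<in> sspan N" using sspan_base[of h' N "lact a \<xi>"] by (simp add: S_lact)
  qed
qed

text \<open>Wold decomposition of the restriction to the complement of \<open>V\<close>: there is no
  fully coisometric part, since it would be orthogonal to every \<open>wspan (words n) V\<close>.\<close>

lemma wandering_wspan:
  assumes V: "coinv V" "V \<subseteq> sspan UNIV" "wspan UNIV V = UNIV"
    and N_def: "N = orth_compl V" and Y_def: "Y = N \<inter> orth_compl (sspan N)"
  shows "wspan UNIV Y = N"
proof
  have N: "closed_csubspace N" "rho_inv N" "\<And>\<xi> h. h \<in> N \<Longrightarrow> S \<xi> h \<in> N"
    using closed_csubspace_orth_compl rho_inv_orth_compl[OF coinvD(3)[OF V(1)]] orth_compl_coinv_S[OF V(1)]
    by (auto simp: N_def)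
  then have csubN: "csubspace N" by (simp add: closed_csubspace_def)
  note wN = wop_mem[OF N(2,3)]
  let ?R = "wspan UNIV Y"
  show RN: "?R \<subseteq> N" by (rule wspan_minimal[OF N(1)]) (use wN in \<open>auto simp: Y_def\<close>)
  \<comment> \<open>The candidate for a fully coisometric part, to be shown zero.\<close>
  define K where "K = N \<inter> orth_compl ?R"
  have K: "rho_inv K" "csubspace K"
    using N rho_inv_orth_compl[of ?R] wspan_UNIV_rho[of _ Y]
    by (auto simp: K_def rho_inv_def closed_csubspace_def orth_compl_csubspace
        intro!: complex_vector.subspace_inter)
  have sN: "sspan N \<subseteq> N" by (rule sspan_minimal[OF N(1,3)])
  \<comment> \<open>This makes the spaces \<open>wspan (words n) K\<close> increase, so that each of
    them contains \<open>K\<close>.\<close>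
  have KS: "K \<subseteq> sspan K"
  proof
    fix k assume k: "k \<in> K"
    let ?p = "orth_proj (sspan N) k"
    have p: "?p \<in> sspan N" "k - ?p \<in> orth_compl (sspan N)"
      by (rule orth_proj_mem[OF closed_sspan], rule orth_proj_compl[OF closed_sspan])
    \<comment> \<open>The residual of \<open>k\<close> modulo \<open>sspan N\<close> is wandering,
      whereas \<open>k\<close> is orthogonal to all that wandering vectors generate.\<close>
    have "k - ?p \<in> Y"
      using k p sN csubspace_diff[OF csubN] by (auto simp: Y_def K_def)
    then have "cinner (k - ?p) k = 0"
      using k subset_wspan_UNIV[of Y] by (auto simp: K_def orth_compl_def)
    then have kN: "k \<in> sspan N" by (rule orth_residual_zero_mem[OF closed_sspan])
    show "k \<in> sspan K"
    proof (rule sspan_orth_part[OF K(1), where N = N and ?M2.0 = ?R])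
      show "orthogonal_sets K ?R"
        using cinner_orth_compl' by (fastforce simp: orthogonal_sets_def K_def)
      show "\<exists>h1\<in>K. \<exists>h2\<in>?R. h = h1 + h2" if h: "h \<in> N" for h
      proof (intro bexI)
        show r: "orth_proj ?R h \<in> ?R" by (rule orth_proj_mem[OF closed_wspan])
        show "h - orth_proj ?R h \<in> K"
          unfolding K_def using h r RN orth_proj_compl[OF closed_wspan] csubspace_diff[OF csubN]
          by blast
      qed simp
      show "cinner k (S \<xi> h) = 0" if "h \<in> ?R" for \<xi> h
        using cinner_orth_compl'[of k ?R "S \<xi> h"] wspan_UNIV_S[OF that] k by (simp add: K_def)
    qed (use kN in \<open>auto simp: K_def\<close>)
  qed
  have "k = 0" if k: "k \<in> K" for k
  proof -
    have "k \<in> orth_compl (wspan (words n) V)" for n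
    proof -
      have "wop (Scal 1) k \<in> wspan (words 0) K" by (rule wspan_base) (use k in auto)
      then have "k \<in> wspan (words n) K"
        using wspan_words_mono[OF KS, of 0 n] by (auto simp: rho_one)
      \<comment> \<open>By \<open>wop_gram\<close>, words of one degree preserve the orthogonality
        of \<open>K\<close> and \<open>V\<close>.\<close>
      moreover have "wspan (words n) K \<subseteq> orth_compl (wspan (words n) V)"
      proof (rule wspan_minimal[OF closed_csubspace_orth_compl])
        fix x h assume x: "x \<in> words n" and h: "h \<in> K"
        have "cinner (wop y v) (wop x h) = 0" if "y \<in> words n" "v \<in> V" for y v
        proof -
          have "\<rho> (word_inner lact ip y x) h \<in> N" using h N(2) by (auto simp: K_def rho_inv_def)
          then show ?thesis using that x by (subst wop_gram) (auto simp: N_def orth_compl_def)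
        qed
        then have "wop x h \<in> orth_compl {wop y v |y v. y \<in> words n \<and> v \<in> V}"
          by (auto simp: orth_compl_def)
        then show "wop x h \<in> orth_compl (wspan (words n) V)"
          by (simp add: wspan_def orth_compl_closure_cspan)
      qed
      ultimately show ?thesis by blast
    qed
    then have "(\<Union>n. wspan (words n) V) \<subseteq> orth_compl {k}"
      using cinner_commute[of k] by (fastforce simp: orth_compl_def)
    then have "closure (\<Union>n. wspan (words n) V) \<subseteq> orth_compl {k}"
      using closed_csubspace_orth_compl closure_minimal unfolding closed_csubspace_def by blast
    then have "k \<in> orth_compl {k}"
      using wspan_UNIV_subset[OF coinv_subset_sspan[OF V(1,2)]] V(3) by blast
    then show "k = 0" by (simp add: orth_compl_def)
  qed
  then have K0: "K \<subseteq> {0}" by blast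
  show "N \<subseteq> ?R"
  proof
    fix h assume h: "h \<in> N"
    have "h - orth_proj ?R h \<in> K"
      unfolding K_def using h RN orth_proj_mem[OF closed_wspan] orth_proj_compl[OF closed_wspan]
        csubspace_diff[OF csubN] by blast
    then have "h = orth_proj ?R h" using K0 by auto
    then show "h \<in> ?R" using orth_proj_mem[OF closed_wspan] by metis
  qed
qed

end

locale isometric_representation = isometric_system S Sa \<rho> lact ip
  for S Sa :: "'e::{complex_vector,banach} \<Rightarrow> 'h \<Rightarrow> 'h::complex_hilbert"
    and \<rho> :: "'a::cstar_algebra \<Rightarrow> 'h \<Rightarrow> 'h" and lact ip +
  fixes ract :: "'e \<Rightarrow> 'a \<Rightarrow> 'e"
  assumes rep: "representation lact ract ip UNIV S \<rho>"
begin

text \<open>The inducing space is the wandering subspace \<open>Y\<close> of the restriction to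
  \<open>N\<close>. Words applied to it have the Gram form of the Fock space and generate
  \<open>N\<close>, so \<open>tens_map wop\<close> is the unitary.\<close>

lemma induced_rep_orth_compl:
  assumes V: "coinv V" "V \<subseteq> sspan UNIV" "wspan UNIV V = UNIV"
  shows "induced_rep lact ract ip (orth_compl V)
    (\<lambda>\<xi>. \<lambda>h\<in>orth_compl V. orth_proj (orth_compl V) (S \<xi> h)) (\<lambda>a. \<lambda>h\<in>orth_compl V. \<rho> a h)"
proof -
  define N where "N = orth_compl V"
  define Y where "Y = N \<inter> orth_compl (sspan N)"
  have N: "closed_csubspace N" "csubspace N" "rho_inv N" "\<And>\<xi> h. h \<in> N \<Longrightarrow> S \<xi> h \<in> N"
    using closed_csubspace_orth_compl orth_compl_csubspace rho_inv_orth_compl[OF coinvD(3)[OF V(1)]]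
      orth_compl_coinv_S[OF V(1)]
    by (auto simp: N_def)
  \<comment> \<open>\<open>N\<close> is invariant under \<open>S\<close>, so the projection in the
    compression acts as the identity.\<close>
  have T: "(\<lambda>\<xi>. \<lambda>h\<in>N. orth_proj N (S \<xi> h)) = (\<lambda>\<xi>. restrict (S \<xi>) N)"
    using orth_proj_id[OF N(1)] N(4) by (auto simp: fun_eq_iff restrict_def)
  have star: "unital_star_rep UNIV \<rho>" using rep by (simp add: representation_def)
  have "representation lact ract ip N (\<lambda>\<xi>. restrict (S \<xi>) N) (\<lambda>a. restrict (\<rho> a) N)"
    unfolding representation_def
  proof (intro conjI allI)
    show "unital_star_rep N (\<lambda>a. restrict (\<rho> a) N)"
      by (rule unital_star_rep_restrict[OF star N(2)]) (use N(3) in \<open>auto simp: rho_inv_def\<close>)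
    show "restrict (S \<xi>) N \<in> bounded_ops N" for \<xi> by (rule bop_restrict[OF S_bop N(2,4)])
    have "S (\<xi> + \<eta>) = op_add UNIV (S \<xi>) (S \<eta>)" for \<xi> \<eta> using rep by (simp add: representation_def)
    then show "restrict (S (\<xi> + \<eta>)) N = op_add N (restrict (S \<xi>) N) (restrict (S \<eta>) N)" for \<xi> \<eta>
      by (auto simp: op_add_def)
    have "S (scaleC c \<xi>) = op_scale UNIV c (S \<xi>)" for c \<xi> using rep by (simp add: representation_def)
    then show "restrict (S (scaleC c \<xi>)) N = op_scale N c (restrict (S \<xi>) N)" for c \<xi>
      by (auto simp: op_scale_def)
    have "S (lact a (ract \<xi> b)) = compose UNIV (\<rho> a) (compose UNIV (S \<xi>) (\<rho> b))" for a \<xi> b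
      using rep by (simp add: representation_def)
    then show "restrict (S (lact a (ract \<xi> b))) N =
        compose N (restrict (\<rho> a) N) (compose N (restrict (S \<xi>) N) (restrict (\<rho> b) N))" for a \<xi> b
      using N(3,4) by (auto simp: compose_def rho_inv_def fun_eq_iff)
    have cc: "completely_contractive ract ip UNIV S" using rep by (simp add: representation_def)
    show "completely_contractive ract ip N (\<lambda>\<xi>. restrict (S \<xi>) N)"
      unfolding completely_contractive_def
    proof (intro allI impI)
      fix n \<xi> and h :: "nat \<Rightarrow> 'h" assume "\<forall>j<n. h j \<in> N"
      then have "(\<Sum>i<n. (norm (\<Sum>j<n. restrict (S (\<xi> i j)) N (h j)))\<^sup>2) =
          (\<Sum>i<n. (norm (\<Sum>j<n. S (\<xi> i j) (h j)))\<^sup>2)" by simp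
      then show "sqrt (\<Sum>i<n. (norm (\<Sum>j<n. restrict (S (\<xi> i j)) N (h j)))\<^sup>2)
          \<le> matrix_norm ract ip n \<xi> * sqrt (\<Sum>j<n. (norm (h j))\<^sup>2)"
        using cc unfolding completely_contractive_def by simp
    qed
  qed (rule N(1))
  moreover have "closed_csubspace Y"
    unfolding Y_def by (rule closed_csubspace_Int[OF N(1) closed_csubspace_orth_compl])
  moreover have "rho_inv Y"
    using N(3) rho_inv_orth_compl[OF sspan_rho[OF N(3)]] by (auto simp: Y_def rho_inv_def)
  moreover have csubY: "csubspace Y" using \<open>closed_csubspace Y\<close> by (simp add: closed_csubspace_def)
  moreover have "unital_star_rep Y (\<lambda>a. restrict (\<rho> a) Y)"
    by (rule unital_star_rep_restrict[OF star csubY]) (use \<open>rho_inv Y\<close> in \<open>auto simp: rho_inv_def\<close>)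
  moreover interpret tensor_realization UNIV "word_inner lact ip" "\<lambda>a. restrict (\<rho> a) Y" Y wop
  proof
    show "cinner (wop x h) (wop y k) = cinner h (restrict (\<rho> (word_inner lact ip x y)) Y k)"
      if "h \<in> Y" "k \<in> Y" for x y h k
      using wandering_gram[OF N(4,3) _ _ \<open>rho_inv Y\<close> that, of x y] that by (simp add: Y_def)
    show "wop x (scaleC c h) = scaleC c (wop x h)" for x c h by (rule bop_scaleC[OF wop_bop])
  qed (rule csubY)
  let ?F = "tensor_space UNIV (word_inner lact ip) (\<lambda>a. restrict (\<rho> a) Y) Y"
  have img: "tens_map wop ` ?F = N"
    unfolding tens_map_image wandering_wspan[OF V N_def Y_def, symmetric] wspan_def ..
  then have UN: "tens_map wop P \<in> N" if "P \<in> ?F" for P using that by blast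
  have "bij_betw (tens_map wop) ?F N"
    unfolding bij_betw_def using img tens_map_inj by (auto intro: inj_onI)
  moreover have "tens_map wop (tens_left UNIV (word_inner lact ip) (\<lambda>a. restrict (\<rho> a) Y) Y (Tens \<xi>) P) =
      restrict (S \<xi>) N (tens_map wop P)" if "P \<in> ?F" for P \<xi>
    using tens_map_left[OF that S_bop, of "Tens \<xi>"] UN[OF that] by simp
  moreover have "tens_map wop (tens_left UNIV (word_inner lact ip) (\<lambda>a. restrict (\<rho> a) Y) Y (word_act lact a) P) =
      restrict (\<rho> a) N (tens_map wop P)" if "P \<in> ?F" for P a
    using tens_map_left[OF that rho_bop, of "word_act lact a"] UN[OF that] by (simp add: wop_act)
  ultimately have "induced_rep lact ract ip N (\<lambda>\<xi>. restrict (S \<xi>) N) (\<lambda>a. restrict (\<rho> a) N)"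
    unfolding induced_rep_def Let_def
    by (intro conjI exI[of _ Y] exI[of _ "\<lambda>a. restrict (\<rho> a) Y"] exI[of _ "tens_map wop"])
       (simp_all add: tens_map_add tens_map_scale tens_inner_eq)
  then show ?thesis unfolding T N_def[symmetric] .
qed

end

section \<open>The minimal isometric dilation\<close>

locale coisometric_dilation =
  fixes lact :: "'a::cstar_algebra \<Rightarrow> 'e::{complex_vector,banach} \<Rightarrow> 'e"
    and ract :: "'e \<Rightarrow> 'a \<Rightarrow> 'e" and ip :: "'e \<Rightarrow> 'e \<Rightarrow> 'a"
    and V :: "'h::complex_hilbert set" and A S :: "'e \<Rightarrow> 'h \<Rightarrow> 'h" and \<sigma> \<rho> :: "'a \<Rightarrow> 'h \<Rightarrow> 'h"
  assumes corr: "cstar_correspondence lact ract ip"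
    and rep_A: "representation lact ract ip V A \<sigma>"
    and fin_V: "finite_dim V"
    and coisometric: "fully_coisometric ip V A \<sigma>"
    and dilation: "minimal_isometric_dilation lact ract ip V A \<sigma> S \<rho>"
begin

definition Sa :: "'e \<Rightarrow> 'h \<Rightarrow> 'h" where "Sa \<xi> = adj (S \<xi>)"

lemma
  shows rep_S: "representation lact ract ip UNIV S \<rho>"
    and rho_V: "h \<in> V \<Longrightarrow> \<rho> a h \<in> V"
    and rho_sigma: "h \<in> V \<Longrightarrow> \<rho> a h = \<sigma> a h"
    and S_compl: "h \<in> orth_compl V \<Longrightarrow> S \<xi> h \<in> orth_compl V"
    and compress_S: "h \<in> V \<Longrightarrow> orth_proj V (S \<xi> h) = A \<xi> h"
    and isometric: "isometric_rep ip UNIV S \<rho>"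
    and generates: "closure (cspan (\<Union>n. tens_map (word_op S \<rho>) `
       tensor_space {x. word_degree x = n} (word_inner lact ip) \<rho> V)) = UNIV"
  using dilation unfolding minimal_isometric_dilation_def is_dilation_def by blast+

lemma closed_V: "closed_csubspace V"
  using rep_A by (simp add: representation_def)

lemma csub_V: "csubspace V"
  using closed_V by (simp add: closed_csubspace_def)

sublocale isometric_representation S Sa \<rho> lact ip ract
proof
  have S_bop: "S \<xi> \<in> bounded_ops UNIV" for \<xi> using rep_S by (simp add: representation_def)
  then show "S \<xi> \<in> bounded_ops UNIV" "Sa \<xi> \<in> bounded_ops UNIV" for \<xi>
    by (simp_all add: Sa_def bop_adjoint)
  have star: "unital_star_rep UNIV \<rho>" using rep_S by (simp add: representation_def)
  then show rho_bop: "\<rho> a \<in> bounded_ops UNIV" for a by (simp add: unital_star_rep_def)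
  show "cinner (S \<xi> h) k = cinner h (Sa \<xi> k)" for \<xi> h k
    unfolding Sa_def by (rule cinner_adjoint[OF S_bop])
  have "\<rho> (cstar a) = adj (\<rho> a)" for a using star by (simp add: unital_star_rep_def)
  then show "cinner (\<rho> a h) k = cinner h (\<rho> (cstar a) k)" for a h k
    using cinner_adjoint[OF rho_bop] by simp
  have "\<rho> (a * b) = compose UNIV (\<rho> a) (\<rho> b)" for a b using star unfolding unital_star_rep_def by blast
  then show "\<rho> (a * b) h = \<rho> a (\<rho> b h)" for a b h by simp
  have "\<rho> 1 = op_id UNIV" using star unfolding unital_star_rep_def by blast
  then show one: "\<rho> 1 h = h" for h by simp
  have "\<rho> (scaleC 0 0) = op_scale UNIV 0 (\<rho> 0)" using star unfolding unital_star_rep_def by blast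
  then show "\<rho> 0 h = 0" for h by simp
  \<comment> \<open>The covariance relation with \<open>b = 1\<close> isolates the left
    action.\<close>
  have "S (lact a (ract \<xi> 1)) = compose UNIV (\<rho> a) (compose UNIV (S \<xi>) (\<rho> 1))" for a \<xi>
    using rep_S unfolding representation_def by blast
  moreover have "ract \<xi> 1 = \<xi>" for \<xi> using corr by (simp add: cstar_correspondence_def)
  ultimately show "S (lact a \<xi>) h = \<rho> a (S \<xi> h)" for a \<xi> h by (simp add: one)
  have "compose UNIV (adj (S \<xi>)) (S \<eta>) = \<rho> (ip \<xi> \<eta>)" for \<xi> \<eta>
    using isometric unfolding isometric_rep_def by blast
  then show "Sa \<xi> (S \<eta> h) = \<rho> (ip \<xi> \<eta>) h" for \<xi> \<eta> h by (simp add: Sa_def fun_eq_iff)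
qed (rule rep_S)

text \<open>A dilation leaves the complement of \<open>V\<close> invariant under \<open>S\<close>,
  so the adjoints leave \<open>V\<close> invariant.\<close>

lemma coinv_V: "coinv V"
proof (rule coinvI[OF closed_V rho_V])
  fix \<xi> h assume "h \<in> V"
  then have "Sa \<xi> h \<in> orth_compl (orth_compl V)"
    using S_compl by (auto simp: orth_compl_def[of "orth_compl V"] S_adj[symmetric] intro: cinner_orth_compl')
  then show "Sa \<xi> h \<in> V" by (simp add: orth_compl_orth_compl[OF closed_V])
qed

text \<open>\<open>E \<otimes>\<^sub>\<sigma> V\<close> is realised as \<open>sspan V\<close>, where the operator induced by \<open>A\<close> becomes the compression
  to \<open>V\<close>. A compression to \<open>V\<close> is coisometric only if its domain contains \<open>V\<close>.\<close>

lemma V_full: "V \<subseteq> sspan UNIV"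
proof
  interpret tensor_realization UNIV ip \<sigma> V S
  proof (rule tensor_realization.intro[OF csub_V])
    show "cinner (S \<xi> h) (S \<eta> k) = cinner h (\<sigma> (ip \<xi> \<eta>) k)" if "k \<in> V" for \<xi> \<eta> h k
      using that by (simp add: S_adj S_isom rho_sigma)
  qed (rule bop_scaleC[OF S_bop])
  let ?F = "tensor_space UNIV ip \<sigma> V"
  obtain B where B: "\<And>h. h \<in> V \<Longrightarrow> B h \<in> ?F"
    "\<And>P h. P \<in> ?F \<Longrightarrow> h \<in> V \<Longrightarrow> cinner (tens_map A P) h = tens_inner ip \<sigma> P (B h)"
    "\<And>h. h \<in> V \<Longrightarrow> tens_map A (B h) = h"
    using coisometric unfolding fully_coisometric_def by blast
  fix h assume h: "h \<in> V"
  let ?y = "tens_map S (B h)"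
  have "tens_map A (B h) = orth_proj V ?y"
    by (rule tens_map_compress[OF B(1)[OF h] bop_orth_proj[OF closed_V]]) (simp add: compress_S)
  then have py: "orth_proj V ?y = h" using B(3)[OF h] by simp
  \<comment> \<open>Full coisometry with \<open>P = B h\<close> gives \<open>?y\<close> the norm of
    \<open>h\<close>, which is the projection of \<open>?y\<close>. A projection that preserves the
    norm of a vector fixes it.\<close>
  have "cinner h h = cinner ?y ?y"
    using B(2)[OF B(1)[OF h] h] tens_inner_eq[OF B(1)[OF h] B(1)[OF h]] B(3)[OF h] by simp
  then have "norm h = norm ?y"
    by (metis cinner_self of_real_eq_iff norm_ge_zero power2_eq_imp_eq)
  then have "?y \<in> V" using norm_orth_proj_eq_imp[OF closed_V] py by simp
  then have "h = ?y" using py orth_proj_id[OF closed_V] by simp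
  then have "h \<in> closure (cspan {S x h |x h. x \<in> UNIV \<and> h \<in> V})"
    using B(1)[OF h] tens_map_image by blast
  then show "h \<in> sspan UNIV" using sspan_mono[of V UNIV] by (auto simp: sspan_def)
qed

lemma wspan_V: "wspan UNIV V = UNIV"
proof -
  have "tens_map wop ` tensor_space (words n) (word_inner lact ip) \<rho> V \<subseteq> wspan UNIV V" for n
  proof -
    interpret tensor_realization "words n" "word_inner lact ip" \<rho> V wop
      by (rule tensor_realization.intro[OF csub_V]) (simp_all add: wop_gram bop_scaleC[OF wop_bop])
    have "wspan (words n) V \<subseteq> wspan UNIV V"
      by (rule wspan_minimal[OF closed_wspan]) (rule wspan_base[OF UNIV_I])
    then show ?thesis unfolding tens_map_image wspan_def .
  qed
  then have "closure (cspan (\<Union>n. tens_map wop ` tensor_space (words n) (word_inner lact ip) \<rho> V))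
      \<subseteq> wspan UNIV V"
    by (intro closure_cspan_minimal closed_wspan) blast
  then show ?thesis unfolding generates by blast
qed

section \<open>The adjoint algebra on \<open>V\<close> in terms of the dilation\<close>

definition star_alg :: "('h \<Rightarrow> 'h) set" where
  "star_alg = star_set V (generated_algebra V (range A \<union> range \<sigma>))"

text \<open>Elements of \<open>alg\<close> map the complement of \<open>V\<close> into itself, so
  compression to \<open>V\<close> is multiplicative.\<close>

lemma orth_proj_alg:
  assumes T: "T \<in> alg"
  shows "orth_proj V (T (orth_proj V h)) = orth_proj V (T h)"
proof -
  let ?k = "h - orth_proj V h"
  have "cinner z (T ?k) = 0" if "z \<in> V" for z
    unfolding cinner_adjoint'[OF alg_bop[OF T], symmetric]
    by (rule cinner_orth_compl[OF coinv_adj_alg[OF coinv_V T that] orth_proj_compl[OF closed_V]])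
  then have "T h - T (orth_proj V h) \<in> orth_compl V"
    by (simp add: orth_compl_def bop_diff[OF alg_bop[OF T]])
  then have "orth_proj V (T h - T (orth_proj V h)) = 0"
    by (intro orth_proj_eqI[OF closed_V csubspace_0[OF csub_V]]) simp
  then show ?thesis by (simp add: bop_diff[OF bop_orth_proj[OF closed_V]])
qed

lemma generated_algebra_compression:
  assumes "T \<in> generated_algebra V (range A \<union> range \<sigma>)"
  shows "\<exists>R\<in>alg. \<forall>x\<in>V. T x = orth_proj V (R x)"
  using assms
proof induction
  case ident
  show ?case by (rule bexI[OF _ alg_intros(1)]) (simp add: op_id_def orth_proj_id[OF closed_V])
next
  case (gen T)
  then consider \<xi> where "T = A \<xi>" | a where "T = \<sigma> a" by blast
  then show ?case
  proof cases
    case (1 \<xi>)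
    then show ?thesis by (intro bexI[OF _ alg_intros(2)[of \<xi>]]) (simp add: compress_S)
  next
    case (2 a)
    then show ?thesis
      by (intro bexI[OF _ alg_intros(3)[of a]])
         (simp add: rho_sigma[symmetric] orth_proj_id[OF closed_V] rho_V)
  qed
next
  case (add T R)
  then obtain T' R' where "T' \<in> alg" "\<forall>x\<in>V. T x = orth_proj V (T' x)"
    "R' \<in> alg" "\<forall>x\<in>V. R x = orth_proj V (R' x)" by blast
  then show ?case
    by (intro bexI[OF _ alg_intros(4)[of T' R']]) (simp_all add: op_add_def orth_proj_add[OF closed_V])
next
  case (scale T c)
  then obtain T' where "T' \<in> alg" "\<forall>x\<in>V. T x = orth_proj V (T' x)" by blast
  then show ?case
    by (intro bexI[OF _ alg_intros(5)[of T' c]])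
       (simp_all add: op_scale_def orth_proj_scaleC[OF closed_V])
next
  case (mult T R)
  then obtain T' R' where "T' \<in> alg" "\<forall>x\<in>V. T x = orth_proj V (T' x)"
    "R' \<in> alg" "\<forall>x\<in>V. R x = orth_proj V (R' x)" by blast
  then show ?case
    by (intro bexI[OF _ alg_intros(6)[of T' R']])
       (simp_all add: compose_def orth_proj_mem[OF closed_V] orth_proj_alg)
qed

lemma adjoint_compression:
  assumes R: "R \<in> alg" and T: "\<And>x. x \<in> V \<Longrightarrow> T x = orth_proj V (R x)"
  shows "adjoint_on V T = restrict (adj R) V"
proof (rule adjoint_on_eqI[OF csub_V])
  show "restrict (adj R) V \<in> bounded_ops V"
    by (rule bop_restrict[OF bop_adjoint[OF alg_bop[OF R]] csub_V coinv_adj_alg[OF coinv_V R]])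
  fix x y assume "x \<in> V" "y \<in> V"
  then show "cinner (T x) y = cinner x (restrict (adj R) V y)"
    by (simp add: T cinner_orth_proj_left[OF closed_V] cinner_adjoint[OF alg_bop[OF R]])
qed

text \<open>Each element of the algebra of \<open>(A, \<sigma>)\<close> is a compression of an
  element of \<open>alg\<close>, and the adjoint of such a compression is the restriction of an
  adjoint.\<close>

lemma invariant_star_alg_iff:
  assumes M: "closed_csubspace M" "M \<subseteq> V"
  shows "invariant star_alg M \<longleftrightarrow> coinv M"
proof
  assume inv: "invariant star_alg M"
  have adj_mem: "adjoint_on V T h \<in> M" if "T \<in> range A \<union> range \<sigma>" "h \<in> M" for T h
    using inv that generated_algebra.gen[OF that(1), of V]
    by (auto simp: invariant_def star_alg_def star_set_def)
  show "coinv M"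
  proof (rule coinvI[OF M(1)])
    show "\<rho> a h \<in> M" if "h \<in> M" for a h
      \<comment> \<open>\<open>\<rho> a\<close> is the adjoint of \<open>\<rho> (cstar a)\<close>,
        which explains the choice of \<open>\<sigma> (cstar a)\<close>.\<close>
      using adj_mem[of "\<sigma> (cstar a)" h] adjoint_compression[OF alg_intros(3), of "\<sigma> (cstar a)" "cstar a"] that M(2)
      by (auto simp: rho_sigma[symmetric] orth_proj_id[OF closed_V] rho_V adj_rho cstar_cstar)
    show "Sa \<xi> h \<in> M" if "h \<in> M" for \<xi> h
      using adj_mem[of "A \<xi>" h] adjoint_compression[OF alg_intros(2), of "A \<xi>" \<xi>] that M(2)
      by (auto simp: compress_S adj_S)
  qed
next
  assume coinv: "coinv M"
  show "invariant star_alg M"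
    unfolding invariant_def
  proof
    fix Q assume "Q \<in> star_alg"
    then obtain T where T: "T \<in> generated_algebra V (range A \<union> range \<sigma>)" "Q = adjoint_on V T"
      by (auto simp: star_alg_def star_set_def)
    obtain R where R: "R \<in> alg" "\<And>x. x \<in> V \<Longrightarrow> T x = orth_proj V (R x)"
      using generated_algebra_compression[OF T(1)] by blast
    have "Q = restrict (adj R) V" unfolding T(2) using R by (rule adjoint_compression)
    then show "Q ` M \<subseteq> M" using coinv_adj_alg[OF coinv R(1)] M(2) by auto
  qed
qed

lemma minimal_invariant_iff:
  "minimal_invariant V star_alg M \<longleftrightarrow> minimal_coinv M \<and> M \<subseteq> V"
proof -
  have "closed_csubspace N \<and> N \<subseteq> M \<and> N \<noteq> {0} \<and> invariant star_alg N \<longleftrightarrow>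
      coinv N \<and> N \<subseteq> M \<and> N \<noteq> {0}" if "M \<subseteq> V" for N
    using invariant_star_alg_iff[of N] coinvD(1)[of N] that by blast
  then show ?thesis
    using invariant_star_alg_iff[of M] coinvD(1)[of M]
    unfolding minimal_invariant_def minimal_coinv_def by blast
qed

end

locale maximal_minimal_sum = coisometric_dilation lact ract ip V A S \<sigma> \<rho>
  for lact :: "'a::cstar_algebra \<Rightarrow> 'e::{complex_vector,banach} \<Rightarrow> 'e" and ract ip
    and V :: "'h::complex_hilbert set" and A S \<sigma> \<rho> +
  fixes Vhat :: "'h set" and Vs :: "nat \<Rightarrow> 'h set" and n :: nat
  assumes minimal_Vs: "j \<in> {1..n} \<Longrightarrow> minimal_coinv (Vs j)" and Vs_V: "j \<in> {1..n} \<Longrightarrow> Vs j \<subseteq> V"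
    and orth_sum: "is_orth_sum n Vs Vhat"
    and maximal: "\<not> (\<exists>M. minimal_coinv M \<and> M \<subseteq> V \<and> (\<forall>j\<in>{1..n}. orthogonal_sets M (Vs j)))"
begin

section \<open>The sum of the minimal subspaces\<close>

lemma Vhat_eq: "Vhat = {\<Sum>j=1..n. v j |v. \<forall>j\<in>{1..n}. v j \<in> Vs j}"
  using orth_sum by (simp add: is_orth_sum_def)

lemma coinv_Vs: "j \<in> {1..n} \<Longrightarrow> coinv (Vs j)"
  using minimal_Vs by (simp add: minimal_coinv_def)

lemma Vs_Vhat:
  assumes "j \<in> {1..n}"
  shows "Vs j \<subseteq> Vhat"
proof
  fix x assume "x \<in> Vs j"
  then have "\<forall>i\<in>{1..n}. (if i = j then x else 0) \<in> Vs i"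
    using csubspace_0[OF coinvD(2)[OF coinv_Vs]] by auto
  moreover have "x = (\<Sum>i=1..n. if i = j then x else 0)" using assms by (simp add: sum.delta)
  ultimately show "x \<in> Vhat" unfolding Vhat_eq
    by (intro CollectI exI[of _ "\<lambda>i. if i = j then x else 0"]) blast
qed

lemma Vhat_subset:
  assumes "csubspace M" "\<And>j. j \<in> {1..n} \<Longrightarrow> Vs j \<subseteq> M"
  shows "Vhat \<subseteq> M"
proof
  fix x assume "x \<in> Vhat"
  then obtain v where "x = (\<Sum>j=1..n. v j)" "\<forall>j\<in>{1..n}. v j \<in> Vs j" unfolding Vhat_eq by blast
  then show "x \<in> M" using assms(2) by (auto simp: subset_iff intro!: complex_vector.subspace_sum[OF assms(1)])
qed

lemma Vhat_closed_under:
  assumes "\<And>j h. j \<in> {1..n} \<Longrightarrow> h \<in> Vs j \<Longrightarrow> T h \<in> Vs j" and T: "T \<in> bounded_ops UNIV" and h: "h \<in> Vhat"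
  shows "T h \<in> Vhat"
proof -
  obtain v where v: "h = (\<Sum>j=1..n. v j)" "\<forall>j\<in>{1..n}. v j \<in> Vs j" using h unfolding Vhat_eq by blast
  have "T h = (\<Sum>j=1..n. T (v j))"
    unfolding v(1) by (rule linear_sum[OF bounded_linear.linear[OF bop_bounded_linear[OF T]]])
  then show ?thesis unfolding Vhat_eq using v(2) assms(1) by blast
qed

lemma csub_Vhat: "csubspace Vhat"
proof (rule csubspaceI)
  note sub = coinvD(2)[OF coinv_Vs]
  show "0 \<in> Vhat"
    unfolding Vhat_eq using csubspace_0[OF sub] by (intro CollectI exI[of _ "\<lambda>_. 0"]) simp
  show "x + y \<in> Vhat" if xy: "x \<in> Vhat" "y \<in> Vhat" for x y
  proof -
    obtain v w where "x = (\<Sum>j=1..n. v j)" "\<forall>j\<in>{1..n}. v j \<in> Vs j"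
      "y = (\<Sum>j=1..n. w j)" "\<forall>j\<in>{1..n}. w j \<in> Vs j" using xy unfolding Vhat_eq by blast
    then show ?thesis unfolding Vhat_eq using csubspace_add[OF sub]
      by (intro CollectI exI[of _ "\<lambda>j. v j + w j"]) (simp add: sum.distrib)
  qed
  show "scaleC c x \<in> Vhat" if x: "x \<in> Vhat" for c x
  proof (rule Vhat_closed_under[OF _ _ x])
    show "scaleC c \<in> bounded_ops UNIV"
      using bounded_ops_op_scale[of UNIV "\<lambda>x. x" c] by (simp add: op_scale_UNIV)
  qed (rule csubspace_scale[OF sub])
qed

lemma Vhat_V: "Vhat \<subseteq> V"
  by (rule Vhat_subset[OF csub_V Vs_V])

lemma fin_Vhat: "finite_dim Vhat"
  by (rule finite_dim_subspace[OF fin_V csub_Vhat Vhat_V])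

lemma coinv_Vhat: "coinv Vhat"
  by (rule coinvI[OF closed_csubspace_finite_dim[OF fin_Vhat]])
     (erule Vhat_closed_under[rotated 2], use coinvD(4,5)[OF coinv_Vs] rho_bop Sa_bop in auto)+

lemma Vhat_full: "Vhat \<subseteq> sspan UNIV"
  using Vhat_V V_full by blast

text \<open>Otherwise the complement of the generated space, being coinvariant, meets
  \<open>V\<close> by the angle argument. The intersection contains a minimal coinvariant subspace
  orthogonal to all \<open>Vs j\<close>, against maximality.\<close>

lemma wspan_Vhat: "wspan UNIV Vhat = UNIV"
proof (rule orth_compl_eq_zero_imp[OF closed_wspan], rule ccontr)
  let ?K = "orth_compl (wspan UNIV Vhat)"
  assume "\<not> ?K \<subseteq> {0}"
  then obtain z where z: "z \<in> ?K" "z \<noteq> 0" by blast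
  have "V \<inter> ?K \<noteq> {0}"
    by (rule finite_dim_meets_coinv[OF fin_V coinvD(3)[OF coinv_V] coinv_subset_sspan[OF coinv_V V_full]
        coinv_orth_compl_wspan z(1) _ z(2)]) (simp add: wspan_V)
  moreover have "coinv (V \<inter> ?K)" by (rule coinv_Int[OF coinv_V coinv_orth_compl_wspan])
  moreover have "finite_dim (V \<inter> ?K)"
    using finite_dim_subspace[OF fin_V] coinvD(2)[OF \<open>coinv (V \<inter> ?K)\<close>] by blast
  ultimately obtain Z where Z: "Z \<subseteq> V \<inter> ?K" "minimal_coinv Z" using minimal_coinv_exists by blast
  have "orthogonal_sets Z (Vs j)" if "j \<in> {1..n}" for j
    using Z(1) Vs_Vhat[OF that] subset_wspan_UNIV[of Vhat] cinner_orth_compl'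
    unfolding orthogonal_sets_def by blast
  then show False using maximal Z by blast
qed

text \<open>Every minimal piece lies in the space generated by \<open>M\<close>, hence in
  \<open>M\<close>; this gives the uniqueness in (1).\<close>

lemma Vhat_subset_generating:
  assumes "coinv M" "M \<subseteq> V" "wspan UNIV M = UNIV"
  shows "Vhat \<subseteq> M"
proof (rule Vhat_subset[OF coinvD(2)[OF assms(1)]])
  fix j assume j: "j \<in> {1..n}"
  have "finite_dim M" by (rule finite_dim_subspace[OF fin_V coinvD(2)[OF assms(1)] assms(2)])
  then show "Vs j \<subseteq> M"
    by (rule minimal_coinv_subset[OF _ assms(1) _ minimal_Vs[OF j]]) (use assms V_full in auto)
qed

text \<open>Orthogonality is inherited from the \<open>Vs j\<close>. For the sum, the part of
  \<open>h\<close> left after removing its projections onto all pieces is orthogonal to every word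
  applied to \<open>Vhat\<close>, and such vectors generate the whole space.\<close>

lemma is_orth_sum_wspan: "is_orth_sum n (\<lambda>j. wspan UNIV (Vs j)) UNIV"
  unfolding is_orth_sum_def
proof (intro conjI ballI impI)
  show orth: "orthogonal_sets (wspan UNIV (Vs i)) (wspan UNIV (Vs j))"
    if "i \<in> {1..n}" "j \<in> {1..n}" "i \<noteq> j" for i j
    using that orth_sum by (intro wspan_orthogonal coinv_Vs) (auto simp: is_orth_sum_def)
  let ?M = "\<lambda>j. wspan UNIV (Vs j)"
  have "h \<in> {\<Sum>j=1..n. v j |v. \<forall>j\<in>{1..n}. v j \<in> ?M j}" for h
  proof -
    let ?v = "\<lambda>j. orth_proj (?M j) h"
    let ?r = "h - (\<Sum>j=1..n. ?v j)"
    have r: "cinner m ?r = 0" if i: "i \<in> {1..n}" and m: "m \<in> ?M i" for i m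
    proof -
      have "(\<Sum>j=1..n. cinner m (?v j)) = (\<Sum>j=1..n. if j = i then cinner m h else 0)"
      proof (rule sum.cong[OF refl])
        fix j assume j: "j \<in> {1..n}"
        show "cinner m (?v j) = (if j = i then cinner m h else 0)"
          using orth[OF i j] m orth_proj_mem[OF closed_wspan] cinner_orth_proj_right[OF closed_wspan]
          by (auto simp: orthogonal_sets_def)
      qed
      also have "\<dots> = cinner m h" using i by (simp add: sum.delta)
      finally show ?thesis by (simp add: cinner_diff_right cinner_sum_right)
    qed
    have "wspan UNIV Vhat \<subseteq> orth_compl {?r}"
    proof (rule wspan_minimal[OF closed_csubspace_orth_compl])
      fix x k assume "k \<in> Vhat"
      then obtain v where v: "k = (\<Sum>j=1..n. v j)" "\<forall>j\<in>{1..n}. v j \<in> Vs j" unfolding Vhat_eq by blast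
      have k: "wop x k = (\<Sum>j=1..n. wop x (v j))"
        unfolding v(1) by (rule linear_sum[OF bounded_linear.linear[OF bop_bounded_linear[OF wop_bop]]])
      have "wop x (v j) \<in> orth_compl {?r}" if j: "j \<in> {1..n}" for j
      proof -
        have "wop x (v j) \<in> ?M j" using v(2) j by (intro wspan_base) auto
        then show ?thesis using r[OF j] cinner_commute[of ?r] by (simp add: orth_compl_def)
      qed
      then show "wop x k \<in> orth_compl {?r}"
        unfolding k by (rule complex_vector.subspace_sum[OF orth_compl_csubspace])
    qed
    then have "?r \<in> orth_compl {?r}" unfolding wspan_Vhat by blast
    then have "cinner ?r ?r = 0" unfolding orth_compl_def by blast
    then have "h = (\<Sum>j=1..n. ?v j)" by (simp only: cinner_eq_zero_iff) simp
    then show ?thesis using orth_proj_mem[OF closed_wspan] by blast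
  qed
  then show "UNIV = {\<Sum>j=1..n. v j |v. \<forall>j\<in>{1..n}. v j \<in> ?M j}" by blast
qed

lemma cstar_algebra_on_Vhat:
  "cstar_algebra_on Vhat {restrict T Vhat |T. T \<in> star_set UNIV wot_alg}"
proof -
  obtain B where B: "finite B" "Vhat = cspan B" using fin_Vhat by (auto simp: finite_dim_def)
  obtain d and b :: "nat \<Rightarrow> 'h" where b: "B = b ` {..<d}"
    using finite_imp_nat_seg_image_inj_on[OF B(1)] by (metis lessThan_def)
  interpret semisimple_coinv S Sa \<rho> lact ip Vhat "Vs ` {1..n}" d b
  proof
    show "Vhat \<subseteq> M" if "coinv M" "\<And>Z. Z \<in> Vs ` {1..n} \<Longrightarrow> Z \<subseteq> M" for M
      using that by (intro Vhat_subset) (auto dest: coinvD(2))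
    show "Z \<subseteq> Vhat" if "Z \<in> Vs ` {1..n}" for Z using that Vs_Vhat by blast
  qed (use coinv_Vhat B(2) b Vhat_full minimal_Vs in auto)
  show ?thesis by (rule cstar_algebra_on_W)
qed

end

theorem theorem2p27:
  fixes lact :: "'a::cstar_algebra \<Rightarrow> 'e::{complex_vector,banach} \<Rightarrow> 'e"
    and ract :: "'e \<Rightarrow> 'a \<Rightarrow> 'e"
    and ip :: "'e \<Rightarrow> 'e \<Rightarrow> 'a"
    and V Vhat :: "'h::complex_hilbert set"
    and A S :: "'e \<Rightarrow> 'h \<Rightarrow> 'h"
    and \<sigma> \<rho> :: "'a \<Rightarrow> 'h \<Rightarrow> 'h"
    and \<AA> \<SS> :: "('h \<Rightarrow> 'h) set"
    and n :: nat
    and Vs :: "nat \<Rightarrow> 'h set"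
  assumes "cstar_correspondence lact ract ip"
    and "representation lact ract ip V A \<sigma>"
    and "finite_dim V"
    and "fully_coisometric ip V A \<sigma>"
    and "minimal_isometric_dilation lact ract ip V A \<sigma> S \<rho>"
    and "\<AA> = generated_algebra V (range A \<union> range \<sigma>)"
    and "\<SS> = weak_op_topology UNIV closure_of generated_algebra UNIV (range S \<union> range \<rho>)"
    and "\<forall>j\<in>{1..n}. minimal_invariant V (star_set V \<AA>) (Vs j)"
    and "is_orth_sum n Vs Vhat"
    and "\<not> (\<exists>M. minimal_invariant V (star_set V \<AA>) M \<and> (\<forall>j\<in>{1..n}. orthogonal_sets M (Vs j)))"
  shows "(let generating = (\<lambda>M. closed_csubspace M \<and> M \<subseteq> V \<and> invariant (star_set V \<AA>) M \<and>
                              closed_image_span \<SS> M = UNIV)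
          in \<forall>M. (generating M \<and> (\<forall>N. generating N \<and> N \<subseteq> M \<longrightarrow> N = M)) \<longleftrightarrow> M = Vhat) \<and>
         is_orth_sum n (\<lambda>j. closed_image_span \<SS> (Vs j)) UNIV \<and>
         induced_rep lact ract ip (orth_compl Vhat)
           (\<lambda>\<xi>. \<lambda>h\<in>orth_compl Vhat. orth_proj (orth_compl Vhat) (S \<xi> h))
           (\<lambda>a. \<lambda>h\<in>orth_compl Vhat. \<rho> a h) \<and>
         cstar_algebra_on Vhat {restrict T Vhat |T. T \<in> star_set UNIV \<SS>}"
proof -
  interpret coisometric_dilation lact ract ip V A S \<sigma> \<rho>
    by standard (rule assms(1-5))+
  have star: "star_set V \<AA> = star_alg" by (simp add: star_alg_def assms(6))
  have wot: "\<SS> = weak_op_topology UNIV closure_of alg" by (simp add: alg_def assms(7))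
  interpret maximal_minimal_sum lact ract ip V A S \<sigma> \<rho> Vhat Vs n
    by standard (use assms(8-10) in \<open>auto simp: star minimal_invariant_iff\<close>)
  have gen: "closed_csubspace M \<and> M \<subseteq> V \<and> invariant (star_set V \<AA>) M \<and> closed_image_span \<SS> M = UNIV
      \<longleftrightarrow> coinv M \<and> M \<subseteq> V \<and> wspan UNIV M = UNIV" for M
    unfolding star wot closed_image_span_wot_alg
    using invariant_star_alg_iff[of M] coinvD(1)[of M] by blast
  \<comment> \<open>\<open>Vhat\<close> is generating and contained in every generating subspace, so
    it is the only minimal one.\<close>
  have "\<forall>M. ((coinv M \<and> M \<subseteq> V \<and> wspan UNIV M = UNIV) \<and>
      (\<forall>N. (coinv N \<and> N \<subseteq> V \<and> wspan UNIV N = UNIV) \<and> N \<subseteq> M \<longrightarrow> N = M)) \<longleftrightarrow> M = Vhat"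
    using coinv_Vhat Vhat_V wspan_Vhat Vhat_subset_generating by blast
  moreover have "is_orth_sum n (\<lambda>j. closed_image_span \<SS> (Vs j)) UNIV"
    unfolding wot closed_image_span_wot_alg by (rule is_orth_sum_wspan)
  moreover note induced_rep_orth_compl[OF coinv_Vhat Vhat_full wspan_Vhat]
  moreover have "cstar_algebra_on Vhat {restrict T Vhat |T. T \<in> star_set UNIV \<SS>}"
    unfolding wot by (rule cstar_algebra_on_Vhat)
  ultimately show ?thesis unfolding Let_def gen by blast
qed

end
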